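(* Let $s\in[\tfrac12,1)$. Let $I,J_1,J_2\subset\mathbb{R}$ be open, connected, bounded, non-empty intervals with $\overline I\cap\overline{J_j}=\emptyset$ for $j=1,2$, with $J_1$ located to the left of $I$ and $J_2$ to the right of $I$. Let $J=J_1\cup J_2$. Then there exist constants $C>0$, $\mu>0$ such that for any $g\in C_c^\infty(I)$ $$\|g\|_{H^{2s}(I)}\le C\,e^{C\left(\frac{\|g\|_{H^{2s}(I)}}{\|g\|_{L^2(I)}}\right)^{\mu}}\,\||D|^{2s}g\|_{H^{-s}(J)}.$$
   Context: $|D|^{2s}$ is the Fourier multiplier $|D|^{2s}g=\mathcal{F}^{-1}(|\xi|^{2s}\mathcal{F}g)$, where $\mathcal{F}g(\xi)=\int_{\mathbb{R}}g(x)e^{-ix\xi}dx$ and $g$ is extended by zero. For $r\in\mathbb{R}$, $H^r(\mathbb{R})=\{f\in\mathcal{S}'(\mathbb{R}):\|(1+|\cdot|^2)^{r/2}\hat f\|_{L^2}<\infty\}$, and for an open set $U\subset\mathbb{R}$, $H^r(U)$ is the space of restrictions to $U$ of elements of $H^r(\mathbb{R})$ with the quotient norm. For $g=0$ the inequality is understood to hold trivially. *)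

theory Defs
  imports "HOL-Analysis.Analysis" "HOL-Library.FuncSet"
begin

definition vderiv :: "nat \<Rightarrow> (real \<Rightarrow> complex) \<Rightarrow> real \<Rightarrow> complex" where
  "vderiv n f = ((\<lambda>h x. vector_derivative h (at x)) ^^ n) f"

definition smooth :: "(real \<Rightarrow> complex) \<Rightarrow> bool" where
  "smooth f \<longleftrightarrow> (\<forall>n x. vderiv n f differentiable (at x))"

text \<open>The space of test functions on \<open>U\<close>; its elements are functions on the whole line,
  i.e. they are already extended by zero.\<close>

definition test_functions :: "real set \<Rightarrow> (real \<Rightarrow> complex) set" where
  "test_functions U = {f. smooth f \<and> compact (closure {x. f x \<noteq> 0}) \<and> closure {x. f x \<noteq> 0} \<subseteq> U}"

definition schwartz :: "(real \<Rightarrow> complex) set" where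
  "schwartz = {f. smooth f \<and> (\<forall>j k. bounded (range (\<lambda>x. x ^ j *\<^sub>R vderiv k f x)))}"

definition schwartz_seminorm :: "nat \<Rightarrow> nat \<Rightarrow> (real \<Rightarrow> complex) \<Rightarrow> real" where
  "schwartz_seminorm j k f = (SUP x. norm (x ^ j *\<^sub>R vderiv k f x))"

text \<open>Distributions are functionals that are \<open>undefined\<close> outside their space of test functions,
  so that equality of distributions is equality in HOL.\<close>

definition tempered :: "((real \<Rightarrow> complex) \<Rightarrow> complex) set" where
  "tempered = {T \<in> extensional schwartz.
     (\<forall>\<phi>\<in>schwartz. \<forall>\<psi>\<in>schwartz. \<forall>a b. T (\<lambda>x. a * \<phi> x + b * \<psi> x) = a * T \<phi> + b * T \<psi>) \<and>
     (\<exists>C N. \<forall>\<phi>\<in>schwartz. cmod (T \<phi>) \<le> C * (\<Sum>j\<le>N. \<Sum>k\<le>N. schwartz_seminorm j k \<phi>))}"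

definition distribution_of :: "(real \<Rightarrow> complex) \<Rightarrow> (real \<Rightarrow> complex) \<Rightarrow> complex" where
  "distribution_of f = (\<lambda>\<phi>\<in>schwartz. LINT x|lborel. f x * \<phi> x)"

definition restrict_distribution ::
  "real set \<Rightarrow> ((real \<Rightarrow> complex) \<Rightarrow> complex) \<Rightarrow> (real \<Rightarrow> complex) \<Rightarrow> complex" where
  "restrict_distribution U T = restrict T (test_functions U)"

definition fourier :: "(real \<Rightarrow> complex) \<Rightarrow> real \<Rightarrow> complex" where
  "fourier f \<xi> = (LINT x|lborel. f x * exp (- (\<i> * of_real x * of_real \<xi>)))"

definition inv_fourier :: "(real \<Rightarrow> complex) \<Rightarrow> real \<Rightarrow> complex" where
  "inv_fourier f x = (LINT \<xi>|lborel. f \<xi> * exp (\<i> * of_real x * of_real \<xi>)) / of_real (2 * pi)"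

definition fourier_distribution ::
  "((real \<Rightarrow> complex) \<Rightarrow> complex) \<Rightarrow> (real \<Rightarrow> complex) \<Rightarrow> complex" where
  "fourier_distribution T = (\<lambda>\<phi>\<in>schwartz. T (fourier \<phi>))"

text \<open>The operator \<open>|D|\<close> to the power \<open>a\<close>, used for \<open>a > 0\<close>, where the value \<open>0 powr a = 0\<close>
  of the symbol at the origin is the right one.\<close>

definition abs_D_powr :: "real \<Rightarrow> (real \<Rightarrow> complex) \<Rightarrow> real \<Rightarrow> complex" where
  "abs_D_powr a g = inv_fourier (\<lambda>\<xi>. of_real (\<bar>\<xi>\<bar> powr a) * fourier g \<xi>)"

definition square_integrable :: "(real \<Rightarrow> complex) \<Rightarrow> bool" where
  "square_integrable f \<longleftrightarrow> f \<in> borel_measurable lborel \<and> integrable lborel (\<lambda>x. (cmod (f x))\<^sup>2)"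

definition l2_norm_on :: "real set \<Rightarrow> (real \<Rightarrow> complex) \<Rightarrow> real" where
  "l2_norm_on A f = sqrt (LINT x:A|lborel. (cmod (f x))\<^sup>2)"

definition sobolev_weighted :: "real \<Rightarrow> (real \<Rightarrow> complex) \<Rightarrow> real \<Rightarrow> complex" where
  "sobolev_weighted r h \<xi> = of_real ((1 + \<xi>\<^sup>2) powr (r / 2)) * h \<xi>"

text \<open>The Fourier transform of \<open>T\<close> is the function \<open>h\<close>, with finite weighted norm. The weighted
  norm bound is part of the relation because it makes \<open>h\<close> times any Schwartz function integrable,
  so that \<open>distribution_of h\<close> is meaningful and determines \<open>h\<close> almost everywhere.\<close>

definition fourier_density ::
  "real \<Rightarrow> ((real \<Rightarrow> complex) \<Rightarrow> complex) \<Rightarrow> (real \<Rightarrow> complex) \<Rightarrow> bool" where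
  "fourier_density r T h \<longleftrightarrow> h \<in> borel_measurable lborel \<and>
     square_integrable (sobolev_weighted r h) \<and> fourier_distribution T = distribution_of h"

definition sobolev :: "real \<Rightarrow> ((real \<Rightarrow> complex) \<Rightarrow> complex) set" where
  "sobolev r = {T \<in> tempered. \<exists>h. fourier_density r T h}"

definition sobolev_norm :: "real \<Rightarrow> ((real \<Rightarrow> complex) \<Rightarrow> complex) \<Rightarrow> real" where
  "sobolev_norm r T = l2_norm_on UNIV (sobolev_weighted r (SOME h. fourier_density r T h))"

definition sobolev_on :: "real \<Rightarrow> real set \<Rightarrow> ((real \<Rightarrow> complex) \<Rightarrow> complex) set" where
  "sobolev_on r U = restrict_distribution U ` sobolev r"

text \<open>The quotient norm, meaningful for \<open>u \<in> sobolev_on r U\<close> only.\<close>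

definition sobolev_norm_on ::
  "real \<Rightarrow> real set \<Rightarrow> ((real \<Rightarrow> complex) \<Rightarrow> complex) \<Rightarrow> real" where
  "sobolev_norm_on r U u =
     (INF T\<in>{T \<in> sobolev r. restrict_distribution U T = u}. sobolev_norm r T)"

text \<open>The norm of the restriction to \<open>U\<close> of a function given on the whole line.\<close>

definition fun_sobolev_norm_on :: "real \<Rightarrow> real set \<Rightarrow> (real \<Rightarrow> complex) \<Rightarrow> real" where
  "fun_sobolev_norm_on r U f =
     sobolev_norm_on r U (restrict_distribution U (distribution_of f))"

end

theory Submission
  imports Defs "HOL-Probability.Probability" "HOL-Real_Asymp.Real_Asymp"
begin

text \<open>
  To the left of \<open>I\<close> the function \<open>|D|\<^sup>2\<^sup>s g\<close> is a nonzero multiple of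
  \<open>F(x) = \<integral> g(y) (y - x) powr (- 1 - 2 s) dy\<close>. Fix \<open>x0\<close> in \<open>J1\<close>. The derivatives of \<open>F\<close> at \<open>x0\<close> are,
  up to constants, the moments of the weight \<open>g(y) (y - x0) powr (- 1 - 2 s)\<close> with respect to the
  variable \<open>t = 1 / (y - x0)\<close>, so Bernstein polynomials in \<open>t\<close> recover \<open>\<integral> |g|\<^sup>2\<close> from finitely many
  derivatives of \<open>F\<close> at this single point.

  The approximation error is controlled because \<open>2 s \<ge> 1\<close> makes \<open>g\<close> Hoelder continuous of order \<open>1 / 2\<close>,
  with constant a multiple of \<open>M = \<parallel>g\<parallel>\<close> in \<open>H\<^sup>2\<^sup>s(I)\<close>: degree \<open>N = n\<^sup>4\<close> costs the error \<open>M / n\<close> and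
  coefficients of size \<open>3\<^sup>N\<close>. The derivatives are replaced by iterated difference quotients with a
  tiny step, and the values of \<open>F\<close> by mollified values, which are bounded by the \<open>H\<^sup>-\<^sup>s(J)\<close> norm.
  With \<open>n\<close> comparable to \<open>M / \<parallel>g\<parallel>\<close> in \<open>L\<^sup>2(I)\<close>, all losses are exponential in \<open>N\<^sup>2 = n\<^sup>8\<close>, whence \<open>\<mu> = 8\<close>.
\<close>

section \<open>Smooth functions, Schwartz functions and test functions\<close>

text \<open>Both Sobolev norms of the statement are infima over extensions, so \<open>g\<close> on
  \<open>I\<close> and its fractional Laplacian on \<open>J\<close> are accessible only by pairing
  an arbitrary extension with test functions supported there. Mollifiers are such test functions,
  and their Fourier transforms give bounds uniform in the extension. For the order
  \<open>2 * s\<close> these bounds do not depend on the radius, which may shrink to 0; for the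
  order \<open>- s\<close> they cost a factor \<open>1 / r\<^sup>2\<close>, so \<open>r\<close>
  stays positive and the smoothness of the potential off \<open>I\<close> pays for it. The square of
  \<open>N\<close> in the exponent has this origin. Bernstein coefficients amplify errors of moments
  by \<open>3 ^ N\<close>, so the step \<open>h\<close> must be exponentially small in
  \<open>N\<close>. A difference quotient of order \<open>N\<close> then amplifies errors of
  \<open>F\<close> by a power \<open>N\<close> of \<open>1 / h\<close>, which is exponential in
  \<open>N * N\<close>, and \<open>r\<close> has to undercut the inverse of that. Factorials do no
  harm: passing from the derivative of order \<open>k\<close> to the moment divides by the
  Pochhammer factor, which also divides the error.\<close>

lemma vderiv_0 [simp]: "vderiv 0 f = f"
  by (simp add: vderiv_def)

lemma vderiv_Suc: "vderiv (Suc n) f = (\<lambda>x. vector_derivative (vderiv n f) (at x))"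
  by (simp add: vderiv_def)

text \<open>The value of \<open>vector_derivative\<close> is known only where a derivative has been
  exhibited. Giving the whole sequence of candidates at once settles all iterated derivatives and,
  in \<open>smooth_chain\<close>, smoothness as well.\<close>

lemma vderiv_chain:
  assumes "F 0 = f" "\<And>n x. (F n has_vector_derivative F (Suc n) x) (at x)"
  shows "vderiv n f = F n"
proof (induction n)
  case (Suc n)
  then show ?case
    using vector_derivative_at[OF assms(2)[of n]] by (simp add: vderiv_Suc)
qed (use assms in simp)

lemma smooth_chain:
  assumes "F 0 = f" "\<And>n x. (F n has_vector_derivative F (Suc n) x) (at x)"
  shows "smooth f"
  unfolding smooth_def vderiv_chain[of F, OF assms] using differentiableI_vector[OF assms(2)] by blast

lemma smooth_has_vderiv:
  "smooth f \<Longrightarrow> (vderiv n f has_vector_derivative vderiv (Suc n) f x) (at x)"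
  unfolding smooth_def vderiv_Suc using vector_derivative_works by blast

lemma vderiv_vderiv: "smooth f \<Longrightarrow> vderiv n (vderiv k f) = vderiv (n + k) f"
  using vderiv_chain[of "\<lambda>n. vderiv (n + k) f" "vderiv k f" n] smooth_has_vderiv by simp

lemma smooth_vderiv: "smooth f \<Longrightarrow> smooth (vderiv k f)"
  using smooth_chain[of "\<lambda>n. vderiv (n + k) f" "vderiv k f"] smooth_has_vderiv by simp

lemma smooth_continuous: "smooth f \<Longrightarrow> continuous_on A (vderiv n f)"
  by (meson continuous_at_imp_continuous_on has_vector_derivative_continuous smooth_has_vderiv)

text \<open>Choosing one derivative for each member of \<open>S\<close> gives an operator on
  \<open>S\<close>, whose iterates form the chain of \<open>smooth_chain\<close>. No formula for
  higher derivatives is required, only a family that differentiation does not leave.\<close>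

lemma smooth_closed:
  assumes f: "f \<in> S" and S: "\<And>f. f \<in> S \<Longrightarrow> \<exists>f'\<in>S. \<forall>x. (f has_vector_derivative f' x) (at x)"
  shows "smooth f"
proof -
  obtain D where D: "\<And>f. f \<in> S \<Longrightarrow> D f \<in> S \<and> (\<forall>x. (f has_vector_derivative D f x) (at x))"
    using S by metis
  have "(D ^^ n) f \<in> S" for n by (induction n) (use f D in auto)
  then show ?thesis
    using smooth_chain[of "\<lambda>n. (D ^^ n) f" f] D by simp
qed

text \<open>Finite sums of products of derivatives: a family containing \<open>f * g\<close> that is
  visibly closed under differentiation. It takes the place of the Leibniz formula in
  \<open>smooth_mult\<close>.\<close>

inductive_set vderiv_products :: "(real \<Rightarrow> complex) \<Rightarrow> (real \<Rightarrow> complex) \<Rightarrow> (real \<Rightarrow> complex) set"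
  for f g where
  mult: "(\<lambda>x. vderiv m f x * vderiv n g x) \<in> vderiv_products f g"
| add: "u \<in> vderiv_products f g \<Longrightarrow> v \<in> vderiv_products f g \<Longrightarrow> (\<lambda>x. u x + v x) \<in> vderiv_products f g"

lemma smooth_mult:
  assumes "smooth f" "smooth g"
  shows "smooth (\<lambda>x. f x * g x)"
proof (rule smooth_closed)
  show "(\<lambda>x. f x * g x) \<in> vderiv_products f g"
    using vderiv_products.mult[of 0 f 0 g] by simp
  fix w assume "w \<in> vderiv_products f g"
  then show "\<exists>w'\<in>vderiv_products f g. \<forall>x. (w has_vector_derivative w' x) (at x)"
  proof induction
    case (mult m n)
    have "(\<lambda>x. vderiv m f x * vderiv (Suc n) g x + vderiv (Suc m) f x * vderiv n g x)
        \<in> vderiv_products f g"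
      by (intro vderiv_products.intros)
    then show ?case
      by (rule bexI[rotated]) (intro allI has_vector_derivative_mult smooth_has_vderiv assms)
  next
    case (add u v)
    then obtain u' v' where "u' \<in> vderiv_products f g" "\<forall>x. (u has_vector_derivative u' x) (at x)"
      "v' \<in> vderiv_products f g" "\<forall>x. (v has_vector_derivative v' x) (at x)" by blast
    then show ?case
      by (intro bexI[of _ "\<lambda>x. u' x + v' x"]) (auto intro: has_vector_derivative_add vderiv_products.add)
  qed
qed

lemma vderiv_affine_chain:
  assumes "smooth f"
  shows "((\<lambda>x. of_real (c ^ n) * vderiv n f (c * x + d)) has_vector_derivative
      of_real (c ^ Suc n) * vderiv (Suc n) f (c * x + d)) (at x)"
proof -
  have "((\<lambda>x. c * x + d) has_vector_derivative c) (at x)"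
    by (auto intro!: derivative_eq_intros)
  from vector_diff_chain_at[OF this smooth_has_vderiv[OF assms, of n "c * x + d"]]
  have "((\<lambda>x. vderiv n f (c * x + d)) has_vector_derivative
      c *\<^sub>R vderiv (Suc n) f (c * x + d)) (at x)" by (simp add: o_def)
  from has_vector_derivative_mult_right[OF this, of "of_real (c ^ n)"] show ?thesis
    by (simp add: scaleR_conv_of_real mult_ac)
qed

lemma smooth_affine: "smooth f \<Longrightarrow> smooth (\<lambda>x. f (c * x + d))"
  by (rule smooth_chain[of "\<lambda>n x. of_real (c ^ n) * vderiv n f (c * x + d)"])
    (use vderiv_affine_chain in auto)

lemma vderiv_cmult_chain:
  "smooth f \<Longrightarrow> ((\<lambda>x. a * vderiv n f x) has_vector_derivative a * vderiv (Suc n) f x) (at x)"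
  by (rule has_vector_derivative_mult_right[OF smooth_has_vderiv])

lemma smooth_cmult: "smooth f \<Longrightarrow> smooth (\<lambda>x. a * f x)"
  by (rule smooth_chain[of "\<lambda>n x. a * vderiv n f x"]) (use vderiv_cmult_chain in auto)

lemma vderiv_cmult: "smooth f \<Longrightarrow> vderiv n (\<lambda>x. a * f x) = (\<lambda>x. a * vderiv n f x)"
  by (rule vderiv_chain) (use vderiv_cmult_chain in auto)

section \<open>Schwartz functions: decay bounds and closure properties\<close>

lemma schwartz_smooth: "f \<in> schwartz \<Longrightarrow> smooth f"
  by (simp add: schwartz_def)

lemma schwartz_bound:
  assumes "f \<in> schwartz"
  obtains B where "B \<ge> 0" "\<And>x. \<bar>x\<bar> ^ j * cmod (vderiv k f x) \<le> B"
proof -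
  have "bounded (range (\<lambda>x. x ^ j *\<^sub>R vderiv k f x))"
    using assms by (simp add: schwartz_def)
  then obtain B where "\<And>x. norm (x ^ j *\<^sub>R vderiv k f x) \<le> B"
    unfolding bounded_iff by auto
  then have "\<And>x. \<bar>x\<bar> ^ j * cmod (vderiv k f x) \<le> B" by (simp add: power_abs)
  moreover from this[of 0] have "B \<ge> 0"
    by (smt (verit) abs_ge_zero norm_ge_zero mult_nonneg_nonneg zero_le_power)
  ultimately show thesis using that by blast
qed

lemma schwartz_chain:
  assumes "F 0 = f" "\<And>n x. (F n has_vector_derivative F (Suc n) x) (at x)"
    and B: "\<And>j k. \<exists>B. \<forall>x. \<bar>x\<bar> ^ j * cmod (F k x) \<le> B"
  shows "f \<in> schwartz"
  unfolding schwartz_def mem_Collect_eq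
proof (intro conjI allI)
  show "smooth f" by (rule smooth_chain[OF assms(1,2)])
  fix j k
  show "bounded (range (\<lambda>x. x ^ j *\<^sub>R vderiv k f x))"
    using B[of j k] unfolding bounded_iff vderiv_chain[OF assms(1,2)] by (auto simp: power_abs)
qed

lemma schwartz_vderiv: "f \<in> schwartz \<Longrightarrow> vderiv k f \<in> schwartz"
  unfolding schwartz_def by (auto simp: smooth_vderiv vderiv_vderiv)

lemma schwartz_cmult:
  assumes "f \<in> schwartz" shows "(\<lambda>x. a * f x) \<in> schwartz"
proof (rule schwartz_chain[of "\<lambda>n x. a * vderiv n f x"])
  fix j k
  obtain B where "\<And>x. \<bar>x\<bar> ^ j * cmod (vderiv k f x) \<le> B" using schwartz_bound[OF assms] by metis
  then have "\<forall>x. \<bar>x\<bar> ^ j * cmod (a * vderiv k f x) \<le> cmod a * B"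
    by (metis mult.left_commute mult_left_mono norm_ge_zero norm_mult)
  then show "\<exists>B. \<forall>x. \<bar>x\<bar> ^ j * cmod (a * vderiv k f x) \<le> B" ..
qed (use vderiv_cmult_chain schwartz_smooth[OF assms] in auto)

lemma schwartz_times:
  assumes "f \<in> schwartz" shows "(\<lambda>x. of_real x * f x) \<in> schwartz"
\<comment> \<open>The product rule for a linear factor. At \<open>n = 0\<close> the truncated index
  \<open>n - 1\<close> is harmless because its coefficient is 0.\<close>
proof (rule schwartz_chain[of "\<lambda>n x. of_real x * vderiv n f x + of_nat n * vderiv (n - 1) f x"])
  note f = smooth_has_vderiv[OF schwartz_smooth[OF assms]]
  fix n x
  have id: "((\<lambda>x. complex_of_real x) has_vector_derivative 1) (at x)"
    using has_vector_derivative_of_real[of "\<lambda>x. x" 1 "at x"] by (simp add: has_real_derivative_iff_has_vector_derivative[symmetric])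
  have "((\<lambda>x. of_real x * vderiv n f x + of_nat n * vderiv (n - 1) f x) has_vector_derivative
      (of_real x * vderiv (Suc n) f x + 1 * vderiv n f x) + of_nat n * vderiv (Suc (n - 1)) f x) (at x)"
    by (intro has_vector_derivative_add has_vector_derivative_mult f id has_vector_derivative_mult_right)
  moreover have "of_nat n * vderiv (Suc (n - 1)) f x = of_nat n * vderiv n f x"
    by (cases n) auto
  ultimately show "((\<lambda>x. of_real x * vderiv n f x + of_nat n * vderiv (n - 1) f x) has_vector_derivative
      of_real x * vderiv (Suc n) f x + of_nat (Suc n) * vderiv (Suc n - 1) f x) (at x)"
    by (simp only:) (simp add: algebra_simps)
next
  fix j k
  obtain B where B: "\<And>x. \<bar>x\<bar> ^ Suc j * cmod (vderiv k f x) \<le> B" using schwartz_bound[OF assms] by metis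
  obtain B' where B': "\<And>x. \<bar>x\<bar> ^ j * cmod (vderiv (k - 1) f x) \<le> B'" using schwartz_bound[OF assms] by metis
  have "\<bar>x\<bar> ^ j * cmod (of_real x * vderiv k f x + of_nat k * vderiv (k - 1) f x) \<le> B + k * B'" for x
  proof -
    have "\<bar>x\<bar> ^ j * cmod (of_real x * vderiv k f x + of_nat k * vderiv (k - 1) f x)
      \<le> \<bar>x\<bar> ^ j * (\<bar>x\<bar> * cmod (vderiv k f x) + k * cmod (vderiv (k - 1) f x))"
      by (intro mult_left_mono order_trans[OF norm_triangle_ineq]) (auto simp: norm_mult)
    also have "\<dots> = \<bar>x\<bar> ^ Suc j * cmod (vderiv k f x) + k * (\<bar>x\<bar> ^ j * cmod (vderiv (k - 1) f x))"
      by (simp add: algebra_simps)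
    also have "\<dots> \<le> B + k * B'" by (intro add_mono B mult_left_mono B') auto
    finally show ?thesis .
  qed
  then show "\<exists>B. \<forall>x. \<bar>x\<bar> ^ j * cmod (of_real x * vderiv k f x + of_nat k * vderiv (k - 1) f x) \<le> B" by blast
qed auto

lemma schwartz_lincomb:
  assumes "f \<in> schwartz" "g \<in> schwartz" shows "(\<lambda>x. a * f x + b * g x) \<in> schwartz"
proof (rule schwartz_chain[of "\<lambda>n x. a * vderiv n f x + b * vderiv n g x"])
  fix j k
  obtain A where "\<And>x. \<bar>x\<bar> ^ j * cmod (vderiv k (\<lambda>x. a * f x) x) \<le> A"
    using schwartz_bound[OF schwartz_cmult[OF assms(1)]] by metis
  moreover obtain B where "\<And>x. \<bar>x\<bar> ^ j * cmod (vderiv k (\<lambda>x. b * g x) x) \<le> B"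
    using schwartz_bound[OF schwartz_cmult[OF assms(2)]] by metis
  ultimately have *: "\<bar>x\<bar> ^ j * cmod (a * vderiv k f x) + \<bar>x\<bar> ^ j * cmod (b * vderiv k g x) \<le> A + B" for x
    using schwartz_smooth[OF assms(1)] schwartz_smooth[OF assms(2)]
    by (simp only: vderiv_cmult) (meson add_mono)
  have "\<bar>x\<bar> ^ j * cmod (a * vderiv k f x + b * vderiv k g x) \<le> A + B" for x
    by (rule order_trans[OF _ *[of x]])
      (simp flip: distrib_left add: mult_left_mono norm_triangle_ineq)
  then show "\<exists>B. \<forall>x. \<bar>x\<bar> ^ j * cmod (a * vderiv k f x + b * vderiv k g x) \<le> B" by blast
qed (use vderiv_cmult_chain schwartz_smooth assms in \<open>auto intro!: has_vector_derivative_add\<close>)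

lemma schwartz_reflect:
  assumes "f \<in> schwartz" shows "(\<lambda>x. f (- x)) \<in> schwartz"
proof -
  note s = schwartz_smooth[OF assms]
  have "(\<lambda>x. f (- 1 * x + 0)) \<in> schwartz"
  proof (rule schwartz_chain[of "\<lambda>n x. of_real ((- 1) ^ n) * vderiv n f (- 1 * x + 0)"])
    show "\<exists>B. \<forall>x. \<bar>x\<bar> ^ j * cmod (of_real ((- 1) ^ k) * vderiv k f (- 1 * x + 0)) \<le> B" for j k
    proof -
      obtain B where "\<And>x. \<bar>x\<bar> ^ j * cmod (vderiv k f x) \<le> B" using schwartz_bound[OF assms] by metis
      from this[of "- x" for x] show ?thesis
        by (auto simp: norm_mult norm_power intro!: exI[of _ B])
    qed
  qed (use vderiv_affine_chain[OF s, of "- 1" _ 0] in auto)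
  then show ?thesis by simp
qed

lemma vderiv_zero_outside:
  assumes "closed K" "\<And>x. x \<notin> K \<Longrightarrow> f x = 0" "x \<notin> K"
  shows "vderiv n f x = 0"
  using assms(3)
proof (induction n arbitrary: x)
  case (Suc n)
  have "((\<lambda>_. 0) has_vector_derivative 0) (at x)" by simp
  then have "(vderiv n f has_vector_derivative 0) (at x)"
    by (rule has_vector_derivative_transform_within_open[of _ _ _ "- K"])
      (use assms(1) Suc in \<open>auto simp: open_Compl\<close>)
  then show ?case by (simp add: vderiv_Suc vector_derivative_at)
qed (use assms in simp)

lemma test_functions_schwartz: "test_functions U \<subseteq> schwartz"
proof
  fix f assume f: "f \<in> test_functions U"
  let ?K = "closure {x. f x \<noteq> 0}"
  have s: "smooth f" and K: "compact ?K" using f by (auto simp: test_functions_def)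
  have 0: "vderiv k f x = 0" if "x \<notin> ?K" for k x
    by (rule vderiv_zero_outside[OF closed_closure _ that])
      (use closure_subset[of "{x. f x \<noteq> 0}"] in auto)
  have "bounded (range (\<lambda>x. x ^ j *\<^sub>R vderiv k f x))" for j k
  proof -
    have "bounded ((\<lambda>x. x ^ j *\<^sub>R vderiv k f x) ` ?K)"
      by (intro compact_imp_bounded compact_continuous_image K continuous_intros smooth_continuous s)
    then have "bounded (insert 0 ((\<lambda>x. x ^ j *\<^sub>R vderiv k f x) ` ?K))" by simp
    moreover have "range (\<lambda>x. x ^ j *\<^sub>R vderiv k f x) \<subseteq> insert 0 ((\<lambda>x. x ^ j *\<^sub>R vderiv k f x) ` ?K)"
    proof
      fix y assume "y \<in> range (\<lambda>x. x ^ j *\<^sub>R vderiv k f x)"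
      then obtain x where "y = x ^ j *\<^sub>R vderiv k f x" by blast
      then show "y \<in> insert 0 ((\<lambda>x. x ^ j *\<^sub>R vderiv k f x) ` ?K)"
        using 0[of x k] by (cases "x \<in> ?K") auto
    qed
    ultimately show ?thesis by (rule bounded_subset)
  qed
  then show "f \<in> schwartz" using s by (simp add: schwartz_def)
qed

section \<open>Integrability by comparison with the inverse square\<close>

lemma integrable_dominated:
  fixes f :: "'a \<Rightarrow> 'b::{banach, second_countable_topology}"
  assumes "f \<in> borel_measurable M" "integrable M g" "\<And>x. norm (f x) \<le> g x"
  shows "integrable M f"
  by (rule Bochner_Integration.integrable_bound[OF assms(2,1)])
    (use assms(3) in \<open>auto intro: order_trans[OF _ abs_ge_self]\<close>)

lemma integrable_inverse_square: "integrable lborel (\<lambda>x::real. inverse (1 + x\<^sup>2))"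
  using integrable_inverse_1_plus_square by (simp add: set_integrable_def)

lemma schwartz_inverse_square_bound:
  assumes "f \<in> schwartz"
  obtains B where "B \<ge> 0" "\<And>x. cmod (f x) \<le> B * inverse (1 + x\<^sup>2)"
proof -
  obtain A where A: "A \<ge> 0" "\<And>x. \<bar>x\<bar> ^ 0 * cmod (vderiv 0 f x) \<le> A" using schwartz_bound[OF assms] by metis
  obtain B where B: "B \<ge> 0" "\<And>x. \<bar>x\<bar> ^ 2 * cmod (vderiv 0 f x) \<le> B" using schwartz_bound[OF assms] by metis
  show thesis
  proof (rule that[of "A + B"])
    fix x
    have "(1 + x\<^sup>2) * cmod (f x) \<le> A + B" using A(2)[of x] B(2)[of x] by (simp add: algebra_simps)
    moreover have "1 + x\<^sup>2 > 0" by (simp add: add_pos_nonneg)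
    ultimately show "cmod (f x) \<le> (A + B) * inverse (1 + x\<^sup>2)"
      by (simp add: field_simps)
  qed (use A B in simp)
qed

lemma smooth_borel: "smooth f \<Longrightarrow> f \<in> borel_measurable borel"
  using smooth_continuous[of f UNIV 0] by (simp add: borel_measurable_continuous_onI)

lemma schwartz_integrable:
  assumes "f \<in> schwartz" shows "integrable lborel f"
proof -
  obtain B where "\<And>x. cmod (f x) \<le> B * inverse (1 + x\<^sup>2)"
    using schwartz_inverse_square_bound[OF assms] by metis
  then show ?thesis
    by (rule integrable_dominated[OF _ integrable_mult_right[OF integrable_inverse_square], rotated])
      (use smooth_borel[OF schwartz_smooth[OF assms]] in simp)
qed

lemma schwartz_measurable: "f \<in> schwartz \<Longrightarrow> f \<in> borel_measurable borel"
  using smooth_borel schwartz_smooth by blast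

section \<open>The Fourier transform on Schwartz functions\<close>

abbreviation wave :: "real \<Rightarrow> real \<Rightarrow> complex" where
  "wave x t \<equiv> exp (\<i> * of_real x * of_real t)"

abbreviation nwave :: "real \<Rightarrow> real \<Rightarrow> complex" where
  "nwave x t \<equiv> exp (- (\<i> * of_real x * of_real t))"

lemma cmod_exp_i [simp]:
  "cmod (wave x y) = 1"  "cmod (nwave x y) = 1"
  by (simp_all flip: of_real_mult minus_mult_right add: mult.assoc)

lemma fourier_integrable:
  assumes "integrable lborel f"
  shows "integrable lborel (\<lambda>x. f x * nwave x \<xi>)"
    and "integrable lborel (\<lambda>x. f x * wave x \<xi>)"
proof -
  have [measurable]: "f \<in> borel_measurable borel" using assms by auto
  show "integrable lborel (\<lambda>x. f x * nwave x \<xi>)"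
    "integrable lborel (\<lambda>x. f x * wave x \<xi>)"
    by (rule Bochner_Integration.integrable_bound[OF assms]; simp add: norm_mult)+
qed

lemma inv_fourier_eq: "inv_fourier f x = fourier f (- x) / of_real (2 * pi)"
  unfolding inv_fourier_def fourier_def by (simp add: mult_ac)

lemma fourier_norm_le: "cmod (fourier f \<xi>) \<le> (LINT x|lborel. cmod (f x))"
  unfolding fourier_def by (rule order_trans[OF integral_norm_bound]) (simp add: norm_mult)

lemma inv_fourier_norm_le: "cmod (inv_fourier f x) \<le> (LINT x|lborel. cmod (f x))"
proof -
  have "cmod (inv_fourier f x) = cmod (fourier f (- x)) / (2 * pi)"
    by (simp add: inv_fourier_eq norm_divide)
  also have "\<dots> \<le> cmod (fourier f (- x)) / 1"
    using pi_gt3 by (intro divide_left_mono) auto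
  finally show ?thesis using fourier_norm_le[of f "- x"] by simp
qed

text \<open>The remainder \<open>exp (- \<i> u) - 1 + \<i> u\<close> has modulus at most
  \<open>u\<^sup>2\<close>. With \<open>u = x * h\<close>, integration bounds the error of the
  linear approximation by \<open>h\<^sup>2\<close> times the second absolute moment of
  \<open>f\<close>; this is where the third hypothesis enters.\<close>

lemma fourier_has_derivative:
  assumes f: "integrable lborel f" and xf: "integrable lborel (\<lambda>x. of_real x * f x)"
    and xxf: "integrable lborel (\<lambda>x. of_real x * (of_real x * f x))"
  shows "(fourier f has_vector_derivative fourier (\<lambda>x. - \<i> * (of_real x * f x)) \<xi>) (at \<xi>)"
proof -
  define F' where "F' = fourier (\<lambda>x. - \<i> * (of_real x * f x))"
  define B where "B = (LINT x|lborel. cmod (of_real x * (of_real x * f x)))"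
  have xf': "integrable lborel (\<lambda>x. - \<i> * (of_real x * f x))" using xf by simp
  have le: "cmod (fourier f (\<xi> + h) - fourier f \<xi> - h *\<^sub>R F' \<xi>) \<le> h\<^sup>2 * B" for h
  proof -
    have eq: "fourier f (\<xi> + h) - fourier f \<xi> - h *\<^sub>R F' \<xi> =
       (LINT x|lborel. f x * nwave x (\<xi> + h) - f x * nwave x \<xi>
         - h *\<^sub>R (- \<i> * (of_real x * f x) * nwave x \<xi>))"
      unfolding fourier_def F'_def
      by (subst Bochner_Integration.integral_diff Bochner_Integration.integral_scaleR_right;
          (intro Bochner_Integration.integrable_diff integrable_scaleR_right fourier_integrable f xf')?)+ simp
    have "cmod (fourier f (\<xi> + h) - fourier f \<xi> - h *\<^sub>R F' \<xi>) \<le> (LINT x|lborel. h\<^sup>2 * cmod (of_real x * (of_real x * f x)))"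
      unfolding eq
    proof (rule Bochner_Integration.integral_norm_bound_integral)
      show "integrable lborel (\<lambda>x. f x * nwave x (\<xi> + h) - f x * nwave x \<xi>
         - h *\<^sub>R (- \<i> * (of_real x * f x) * nwave x \<xi>))"
        by (intro Bochner_Integration.integrable_diff integrable_scaleR_right fourier_integrable f xf')
      show "integrable lborel (\<lambda>x. h\<^sup>2 * cmod (of_real x * (of_real x * f x)))"
        using integrable_norm[OF xxf] by simp
      fix x :: real
      have *: "cmod (iexp (- (x * h)) - 1 - \<i> * of_real (- (x * h))) \<le> (x * h)\<^sup>2"
    proof -
      have "cmod (iexp (- (x * h)) - (1 + \<i> * of_real (- (x * h)))) \<le> (x * h)\<^sup>2 / 2"
        using iexp_approx1[of "- (x * h)" 1] by (simp add: power2_abs numeral_2_eq_2[symmetric] del: of_real_minus of_real_mult)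
      also have "\<dots> \<le> (x * h)\<^sup>2" by simp
      finally show ?thesis by (simp only: diff_diff_eq)
    qed
      have "f x * nwave x (\<xi> + h) - f x * nwave x \<xi>
         - h *\<^sub>R (- \<i> * (of_real x * f x) * nwave x \<xi>)
         = f x * nwave x \<xi> * (iexp (- (x * h)) - 1 - \<i> * of_real (- (x * h)))"
        by (simp add: algebra_simps exp_add exp_diff exp_minus scaleR_conv_of_real divide_inverse)
      then have "cmod (f x * nwave x (\<xi> + h) - f x * nwave x \<xi>
         - h *\<^sub>R (- \<i> * (of_real x * f x) * nwave x \<xi>))
         = cmod (f x) * cmod (iexp (- (x * h)) - 1 - \<i> * of_real (- (x * h)))"
        by (simp add: norm_mult)
      also have "\<dots> \<le> cmod (f x) * (x * h)\<^sup>2" by (intro mult_left_mono *) simp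
      also have "\<dots> = h\<^sup>2 * cmod (of_real x * (of_real x * f x))"
      proof -
        have "(x * h)\<^sup>2 = h\<^sup>2 * (\<bar>x\<bar> * \<bar>x\<bar>)" by (simp add: power2_eq_square)
        then show ?thesis by (simp only: norm_mult norm_of_real real_norm_def) simp
      qed
      finally show "cmod (f x * nwave x (\<xi> + h) - f x * nwave x \<xi>
         - h *\<^sub>R (- \<i> * (of_real x * f x) * nwave x \<xi>))
         \<le> h\<^sup>2 * cmod (of_real x * (of_real x * f x))" .
    qed
    also have "\<dots> = h\<^sup>2 * B" unfolding B_def by (rule integral_mult_right_zero)
    finally show ?thesis .
  qed
  have "((\<lambda>h. cmod (fourier f (\<xi> + h) - fourier f \<xi> - h *\<^sub>R F' \<xi>) / norm h) \<longlongrightarrow> 0) (at 0)"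
  proof (rule Lim_null_comparison)
    show "\<forall>\<^sub>F h in at 0. norm (cmod (fourier f (\<xi> + h) - fourier f \<xi> - h *\<^sub>R F' \<xi>) / norm h) \<le> \<bar>h\<bar> * B"
    proof (rule always_eventually, rule allI)
      fix h :: real
      let ?N = "cmod (fourier f (\<xi> + h) - fourier f \<xi> - h *\<^sub>R F' \<xi>)"
      have "h\<^sup>2 * B = (\<bar>h\<bar> * \<bar>h\<bar>) * B" by (simp add: power2_eq_square)
      then have "?N \<le> (\<bar>h\<bar> * B) * \<bar>h\<bar>" using le[of h] by (simp only: mult_ac)
      then have "h \<noteq> 0 \<Longrightarrow> ?N / \<bar>h\<bar> \<le> \<bar>h\<bar> * B" by (simp add: pos_divide_le_eq)
      then show "norm (?N / norm h) \<le> \<bar>h\<bar> * B" by (cases "h = 0") simp_all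
    qed
    show "((\<lambda>h. \<bar>h\<bar> * B) \<longlongrightarrow> 0) (at 0)" by (auto intro!: tendsto_eq_intros)
  qed
  then show ?thesis
    unfolding has_vector_derivative_def has_derivative_at F'_def[symmetric]
    by (simp add: bounded_linear_scaleR_left)
qed

text \<open>The fundamental theorem of calculus on the whole line. Applied to \<open>f\<close> times
  a wave it serves as integration by parts in \<open>fourier_vderiv1\<close>.\<close>

lemma integral_derivative_eq_0:
  fixes F f :: "real \<Rightarrow> complex"
  assumes "\<And>x. (F has_vector_derivative f x) (at x)" "continuous_on UNIV f" "integrable lborel f"
    and "(F \<longlongrightarrow> 0) at_top" "(F \<longlongrightarrow> 0) at_bot"
  shows "(LINT x|lborel. f x) = 0"
proof -
  have "(LBINT x=-\<infinity>..\<infinity>. f x) = 0 - 0"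
  proof (rule interval_integral_FTC_integrable)
    show "((F \<circ> real_of_ereal) \<longlongrightarrow> 0) (at_right (-\<infinity>))" "((F \<circ> real_of_ereal) \<longlongrightarrow> 0) (at_left \<infinity>)"
      using assms(4,5) by (simp_all add: ereal_tendsto_simps)
  qed (use assms in \<open>auto simp: continuous_on_eq_continuous_at set_integrable_def\<close>)
  then show ?thesis
    by (simp add: interval_lebesgue_integral_def set_lebesgue_integral_def)
qed

lemma schwartz_times_i:
  "f \<in> schwartz \<Longrightarrow> (\<lambda>x. - \<i> * (of_real x * f x)) \<in> schwartz"
  by (intro schwartz_cmult schwartz_times)

lemma schwartz_tendsto_0:
  assumes "f \<in> schwartz" shows "(f \<longlongrightarrow> 0) at_top" "(f \<longlongrightarrow> 0) at_bot"
proof -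
  obtain B where B: "\<And>x. cmod (f x) \<le> B * inverse (1 + x\<^sup>2)"
    using schwartz_inverse_square_bound[OF assms] by metis
  show "(f \<longlongrightarrow> 0) at_top" "(f \<longlongrightarrow> 0) at_bot"
    by (rule Lim_null_comparison[OF always_eventually[OF allI[OF B]]], real_asymp)+
qed

lemma fourier_vderiv1:
  assumes "f \<in> schwartz"
  shows "fourier (vderiv 1 f) \<xi> = \<i> * of_real \<xi> * fourier f \<xi>"
proof -
  let ?e = "\<lambda>x. nwave x \<xi>"
  note s = schwartz_smooth[OF assms]
  have e: "(?e has_vector_derivative - (\<i> * of_real \<xi>) * ?e x) (at x)" for x
    by (rule has_vector_derivative_real_field[of "\<lambda>z. exp (- (\<i> * z * of_real \<xi>))", simplified])
      (auto intro!: derivative_eq_intros)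
  have "((\<lambda>x. f x * ?e x) has_vector_derivative
      (f x * (- (\<i> * of_real \<xi>) * ?e x) + vderiv 1 f x * ?e x)) (at x)" for x
    using has_vector_derivative_mult[OF smooth_has_vderiv[OF s, of 0 x] e] by simp
  moreover have "continuous_on UNIV (\<lambda>x. f x * (- (\<i> * of_real \<xi>) * ?e x) + vderiv 1 f x * ?e x)"
    using smooth_continuous[OF s, of UNIV 0] by (intro continuous_intros smooth_continuous s) simp
  moreover have i1: "integrable lborel (\<lambda>x. - (\<i> * of_real \<xi>) * (f x * ?e x))"
    by (intro integrable_mult_right fourier_integrable schwartz_integrable assms)
  have i2: "integrable lborel (\<lambda>x. vderiv 1 f x * ?e x)"
    by (intro fourier_integrable schwartz_integrable schwartz_vderiv assms)
  have eq: "(\<lambda>x. f x * (- (\<i> * of_real \<xi>) * ?e x) + vderiv 1 f x * ?e x)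
    = (\<lambda>x. - (\<i> * of_real \<xi>) * (f x * ?e x) + vderiv 1 f x * ?e x)"
    by (auto simp: fun_eq_iff)
  have "integrable lborel (\<lambda>x. f x * (- (\<i> * of_real \<xi>) * ?e x) + vderiv 1 f x * ?e x)"
    unfolding eq by (intro Bochner_Integration.integrable_add i1 i2)
  moreover have "((\<lambda>x. f x * ?e x) \<longlongrightarrow> 0) at_top" "((\<lambda>x. f x * ?e x) \<longlongrightarrow> 0) at_bot"
    by (rule tendsto_norm_zero_cancel, simp add: norm_mult,
        rule tendsto_norm_zero, rule schwartz_tendsto_0[OF assms])+
  ultimately have "(LINT x|lborel. f x * (- (\<i> * of_real \<xi>) * ?e x) + vderiv 1 f x * ?e x) = 0"
    by (rule integral_derivative_eq_0)
  then show ?thesis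
    unfolding eq fourier_def using i1 i2
    by (subst (asm) Bochner_Integration.integral_add) auto
qed

lemma fourier_vderiv:
  assumes "f \<in> schwartz"
  shows "fourier (vderiv j f) \<xi> = (\<i> * of_real \<xi>) ^ j * fourier f \<xi>"
proof (induction j)
  case (Suc j)
  have "vderiv (Suc j) f = vderiv 1 (vderiv j f)" by (simp add: vderiv_Suc)
  then show ?case
    using fourier_vderiv1[OF schwartz_vderiv[OF assms, of j]] Suc by simp
qed simp

text \<open>Derivatives of the transform are transforms of \<open>f\<close> multiplied by powers of
  \<open>- \<i> * x\<close>, and powers of the frequency are transforms of derivatives. So each
  weighted derivative is again a transform of a Schwartz function and is bounded by an
  \<open>L\<^sup>1\<close> norm.\<close>

lemma schwartz_fourier:
  assumes "f \<in> schwartz" shows "fourier f \<in> schwartz"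
proof (rule schwartz_chain)
  let ?m = "\<lambda>f x. - \<i> * (complex_of_real x * f x)"
  let ?F = "\<lambda>n. fourier ((?m ^^ n) f)"
  have S: "(?m ^^ n) f \<in> schwartz" for n
    by (induction n) (use assms schwartz_times_i in auto)
  show "?F 0 = fourier f" by simp
  show "(?F n has_vector_derivative ?F (Suc n) x) (at x)" for n x
    using fourier_has_derivative[OF schwartz_integrable[OF S[of n]] schwartz_integrable[OF schwartz_times[OF S[of n]]]
        schwartz_integrable[OF schwartz_times[OF schwartz_times[OF S[of n]]]]]
    by simp
  fix j k
  have "\<bar>x\<bar> ^ j * cmod (?F k x) \<le> (LINT x|lborel. cmod (vderiv j ((?m ^^ k) f) x))" for x
    using fourier_norm_le[of "vderiv j ((?m ^^ k) f)" x] fourier_vderiv[OF S, of j k x]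
    by (simp add: norm_mult norm_power)
  then show "\<exists>B. \<forall>x. \<bar>x\<bar> ^ j * cmod (?F k x) \<le> B" by blast
qed

lemma schwartz_inv_fourier: "f \<in> schwartz \<Longrightarrow> inv_fourier f \<in> schwartz"
  using schwartz_cmult[OF schwartz_reflect[OF schwartz_fourier], of f "1 / of_real (2 * pi)"]
  by (simp add: inv_fourier_eq[abs_def])

text \<open>Read off from the characteristic function of the standard normal distribution after
  removing the normalisation of its density.\<close>

lemma gaussian_integral:
  fixes t :: real
  shows "(LINT x|lborel. of_real (exp (- x\<^sup>2 / 2)) * wave x t) = of_real (sqrt (2 * pi) * exp (- t\<^sup>2 / 2))"
    and "integrable lborel (\<lambda>x::real. exp (- x\<^sup>2 / 2))"
proof -
  have d: "std_normal_density = (\<lambda>x. exp (- x\<^sup>2 / 2) / sqrt (2 * pi))"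
    by (auto simp: normal_density_def fun_eq_iff)
  have "integrable lborel std_normal_density" by simp
  from integrable_mult_right[OF this, of "sqrt (2 * pi)"]
  show "integrable lborel (\<lambda>x::real. exp (- x\<^sup>2 / 2))" by (simp add: d)
  have "char std_normal_distribution t = (LINT x|lborel. std_normal_density x *\<^sub>R iexp (t * x))"
    unfolding char_def by (subst integral_density) auto
  also have "\<dots> = (LINT x|lborel. (1 / of_real (sqrt (2 * pi))) * (of_real (exp (- x\<^sup>2 / 2)) * wave x t))"
    by (intro Bochner_Integration.integral_cong refl) (simp add: d scaleR_conv_of_real mult_ac del: of_real_exp)
  finally have "of_real (exp (- t\<^sup>2 / 2)) = 1 / of_real (sqrt (2 * pi)) * (LINT x|lborel. of_real (exp (- x\<^sup>2 / 2)) * wave x t)"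
    by (simp add: char_std_normal_distribution del: of_real_exp)
  from arg_cong[OF this, of "\<lambda>z. of_real (sqrt (2 * pi)) * z"]
  show "(LINT x|lborel. of_real (exp (- x\<^sup>2 / 2)) * wave x t) = of_real (sqrt (2 * pi) * exp (- t\<^sup>2 / 2))"
    by (simp del: of_real_exp)
qed

text \<open>Letting \<open>e\<close> tend to \<open>0\<close> on both sides yields the inversion formula.\<close>

lemma gaussian_means:
  fixes e :: real
  assumes f: "integrable lborel f" and e: "e > 0"
  shows "(LINT \<xi>|lborel. fourier f \<xi> * wave x \<xi> * of_real (exp (- (e * \<xi>)\<^sup>2 / 2)))
    = of_real (sqrt (2 * pi)) * (LINT u|lborel. f (x + e * u) * of_real (exp (- u\<^sup>2 / 2)))"
proof -
  have [measurable]: "f \<in> borel_measurable borel" using f by auto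
  have ge: "integrable lborel (\<lambda>\<xi>::real. exp (- (e * \<xi>)\<^sup>2 / 2))"
    using lborel_integrable_real_affine[OF gaussian_integral(2), of e 0] e by simp
  let ?G = "\<lambda>\<xi> y. f y * nwave y \<xi> * wave x \<xi> * of_real (exp (- (e * \<xi>)\<^sup>2 / 2))"
  \<comment> \<open>The Gaussian supplies the integrability in \<open>\<xi>\<close> that makes the
    exchange of integrals legitimate for an \<open>f\<close> that is merely integrable.\<close>
  have int: "integrable (lborel \<Otimes>\<^sub>M lborel) (case_prod ?G)"
  proof (rule lborel_pair.Fubini_integrable)
    show "integrable lborel (\<lambda>\<xi>. LINT y|lborel. norm (case (\<xi>, y) of (\<xi>, y) \<Rightarrow> ?G \<xi> y))"
      using ge by (simp add: norm_mult)
    show "AE \<xi> in lborel. integrable lborel (\<lambda>y. case (\<xi>, y) of (\<xi>, y) \<Rightarrow> ?G \<xi> y)"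
      by (intro AE_I2) (use fourier_integrable[OF f] in simp)
  qed (simp add: case_prod_beta')
  have "(LINT \<xi>|lborel. fourier f \<xi> * wave x \<xi> * of_real (exp (- (e * \<xi>)\<^sup>2 / 2)))
    = (LINT \<xi>|lborel. LINT y|lborel. ?G \<xi> y)"
    unfolding fourier_def by simp
  also have "\<dots> = (LINT y|lborel. LINT \<xi>|lborel. ?G \<xi> y)"
    by (rule lborel_pair.Fubini_integral[OF int, symmetric])
  also have "\<dots> = (LINT y|lborel. f y * (of_real (sqrt (2 * pi)) / of_real e * of_real (exp (- ((x - y) / e)\<^sup>2 / 2))))"
  proof (intro Bochner_Integration.integral_cong refl)
    fix y
    have "(LINT \<xi>|lborel. ?G \<xi> y) = f y * (LINT \<xi>|lborel. of_real (exp (- (e * \<xi>)\<^sup>2 / 2)) * wave (e * \<xi>) ((x - y) / e))"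
    proof (subst integral_mult_right_zero[symmetric], intro Bochner_Integration.integral_cong refl)
      fix \<xi>
      have "wave (e * \<xi>) ((x - y) / e) = nwave y \<xi> * wave x \<xi>"
      proof -
        have "(e * \<xi>) * ((x - y) / e) = \<xi> * (x - y)" using e by simp
        then have "\<i> * of_real (e * \<xi>) * of_real ((x - y) / e) = \<i> * of_real (\<xi> * (x - y))"
          by (metis mult.assoc of_real_mult)
        then have "wave (e * \<xi>) ((x - y) / e) = exp (- (\<i> * of_real y * of_real \<xi>) + \<i> * of_real x * of_real \<xi>)"
          by (simp only:) (simp add: algebra_simps)
        then show ?thesis by (simp only: exp_add)
      qed
      then show "?G \<xi> y = f y * (of_real (exp (- (e * \<xi>)\<^sup>2 / 2)) * wave (e * \<xi>) ((x - y) / e))"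
        by simp
    qed
    also have "(LINT \<xi>|lborel. of_real (exp (- (e * \<xi>)\<^sup>2 / 2)) * wave (e * \<xi>) ((x - y) / e))
      = of_real (sqrt (2 * pi)) / of_real e * of_real (exp (- ((x - y) / e)\<^sup>2 / 2))"
    proof -
      have "of_real (sqrt (2 * pi) * exp (- ((x - y) / e)\<^sup>2 / 2)) =
          e *\<^sub>R (LINT \<xi>|lborel. complex_of_real (exp (- (e * \<xi>)\<^sup>2 / 2)) * wave (e * \<xi>) ((x - y) / e))"
        unfolding gaussian_integral(1)[symmetric]
        using lborel_integral_real_affine[of e "\<lambda>\<xi>. of_real (exp (- \<xi>\<^sup>2 / 2)) * wave \<xi> ((x - y) / e)" 0] e
        by simp
      then show ?thesis using e by (simp add: scaleR_conv_of_real nonzero_eq_divide_eq mult_ac)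
    qed
    finally show "(LINT \<xi>|lborel. ?G \<xi> y) = f y * (of_real (sqrt (2 * pi)) / of_real e * of_real (exp (- ((x - y) / e)\<^sup>2 / 2)))" .
  qed
  also have "\<dots> = of_real (sqrt (2 * pi)) * (LINT u|lborel. f (x + e * u) * of_real (exp (- u\<^sup>2 / 2)))"
  proof -
    have "(LINT y|lborel. f y * (of_real (sqrt (2 * pi)) / of_real e * of_real (exp (- ((x - y) / e)\<^sup>2 / 2))))
      = e *\<^sub>R (LINT u|lborel. f (x + e * u) * (of_real (sqrt (2 * pi)) / of_real e * of_real (exp (- ((x - (x + e * u)) / e)\<^sup>2 / 2))))"
      using lborel_integral_real_affine[of e "\<lambda>y. f y * (of_real (sqrt (2 * pi)) / of_real e * of_real (exp (- ((x - y) / e)\<^sup>2 / 2)))" x] e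
      by simp
    also have "\<dots> = (LINT u|lborel. of_real (sqrt (2 * pi)) * (f (x + e * u) * of_real (exp (- u\<^sup>2 / 2))))"
      unfolding integral_scaleR_right[symmetric]
      by (intro Bochner_Integration.integral_cong refl) (use e in \<open>simp add: scaleR_conv_of_real del: of_real_exp\<close>)
    finally show ?thesis by simp
  qed
  finally show ?thesis .
qed

text \<open>Dominated convergence on both sides of \<open>gaussian_means\<close>: the majorant is
  \<open>cmod (fourier f \<xi>)\<close> on the left, and a bound of \<open>f\<close> times the
  Gaussian on the right. The two factors \<open>sqrt (2 * pi)\<close>, one from the lemma and one
  from the Gaussian mass, produce \<open>2 * pi\<close>.\<close>

lemma fourier_inversion:
  assumes "f \<in> schwartz" shows "inv_fourier (fourier f) x = f x"
proof -
  note int = schwartz_integrable[OF assms] schwartz_integrable[OF schwartz_fourier[OF assms]]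
  have [measurable]: "f \<in> borel_measurable borel" "fourier f \<in> borel_measurable borel"
    using int by auto
  let ?e = "\<lambda>n. 1 / (1 + real n)"
  have e: "?e \<longlonglongrightarrow> 0" by real_asymp
  obtain B where B: "\<And>x. cmod (f x) \<le> B"
    using schwartz_bound[OF assms, of 0 0] by auto
  have l1: "(\<lambda>n. (LINT \<xi>|lborel. fourier f \<xi> * wave x \<xi> * of_real (exp (- (?e n * \<xi>)\<^sup>2 / 2))))
    \<longlonglongrightarrow> (LINT \<xi>|lborel. fourier f \<xi> * wave x \<xi>)"
  proof (rule integral_dominated_convergence)
    show "AE \<xi> in lborel. (\<lambda>n. fourier f \<xi> * wave x \<xi> * of_real (exp (- (?e n * \<xi>)\<^sup>2 / 2))) \<longlonglongrightarrow> fourier f \<xi> * wave x \<xi>"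
    proof (intro AE_I2)
      fix \<xi> :: real
      have "(\<lambda>n. exp (- (?e n * \<xi>)\<^sup>2 / 2)) \<longlonglongrightarrow> exp (- (0 * \<xi>)\<^sup>2 / 2)"
        by (intro tendsto_intros e) auto
      then have "(\<lambda>n. complex_of_real (exp (- (?e n * \<xi>)\<^sup>2 / 2))) \<longlonglongrightarrow> of_real 1"
        by (intro tendsto_of_real) simp
      from tendsto_mult[OF tendsto_const this]
      show "(\<lambda>n. fourier f \<xi> * wave x \<xi> * of_real (exp (- (?e n * \<xi>)\<^sup>2 / 2))) \<longlonglongrightarrow> fourier f \<xi> * wave x \<xi>"
        by simp
    qed
    show "integrable lborel (\<lambda>\<xi>. cmod (fourier f \<xi>))" using int by simp
    show "AE \<xi> in lborel. norm (fourier f \<xi> * wave x \<xi> * of_real (exp (- (?e n * \<xi>)\<^sup>2 / 2))) \<le> cmod (fourier f \<xi>)" for n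
      by (intro AE_I2) (simp add: norm_mult mult_left_le)
  qed simp_all
  have l2: "(\<lambda>n. LINT u|lborel. f (x + ?e n * u) * of_real (exp (- u\<^sup>2 / 2))) \<longlonglongrightarrow> (LINT u|lborel. f x * of_real (exp (- u\<^sup>2 / 2)))"
  proof (rule integral_dominated_convergence)
    show "AE u in lborel. (\<lambda>n. f (x + ?e n * u) * of_real (exp (- u\<^sup>2 / 2))) \<longlonglongrightarrow> f x * of_real (exp (- u\<^sup>2 / 2))"
    proof (intro AE_I2 tendsto_intros)
      fix u
      have "isCont f x" using smooth_continuous[OF schwartz_smooth[OF assms], of UNIV 0]
        by (simp add: continuous_on_eq_continuous_at)
      moreover have "(\<lambda>n. x + ?e n * u) \<longlonglongrightarrow> x + 0 * u" by (intro tendsto_intros e)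
      ultimately show "(\<lambda>n. f (x + ?e n * u)) \<longlonglongrightarrow> f x"
        using isCont_tendsto_compose by fastforce
    qed
    show "integrable lborel (\<lambda>u::real. B * exp (- u\<^sup>2 / 2))" using gaussian_integral(2) by simp
    show "AE u in lborel. norm (f (x + ?e n * u) * of_real (exp (- u\<^sup>2 / 2))) \<le> B * exp (- u\<^sup>2 / 2)" for n
      by (intro AE_I2) (simp add: norm_mult B mult_right_mono)
  qed simp_all
  have "(LINT u|lborel. complex_of_real (exp (- u\<^sup>2 / 2))) = of_real (sqrt (2 * pi))"
    using gaussian_integral(1)[of 0] by simp
  then have "(LINT u|lborel. f x * of_real (exp (- u\<^sup>2 / 2))) = f x * of_real (sqrt (2 * pi))"
    by (simp only: integral_mult_right_zero)
  with l2 have "(\<lambda>n. of_real (sqrt (2 * pi)) * (LINT u|lborel. f (x + ?e n * u) * of_real (exp (- u\<^sup>2 / 2)))) \<longlonglongrightarrow> of_real (sqrt (2 * pi)) * (f x * of_real (sqrt (2 * pi)))"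
    by (intro tendsto_mult tendsto_const) (simp only:)
  moreover have "of_real (sqrt (2 * pi)) * (LINT u|lborel. f (x + ?e n * u) * of_real (exp (- u\<^sup>2 / 2))) =
     (LINT \<xi>|lborel. fourier f \<xi> * wave x \<xi> * of_real (exp (- (?e n * \<xi>)\<^sup>2 / 2)))" for n
    by (rule gaussian_means[OF int(1), symmetric]) simp
  ultimately have "(LINT \<xi>|lborel. fourier f \<xi> * wave x \<xi>) = of_real (sqrt (2 * pi)) * (f x * of_real (sqrt (2 * pi)))"
    using LIMSEQ_unique[OF l1] by (simp only:)
  also have "\<dots> = of_real (2 * pi) * f x"
    by (metis (no_types, lifting) mult.assoc mult.commute of_real_mult pi_ge_zero real_sqrt_mult_self
        abs_of_nonneg mult_nonneg_nonneg zero_le_numeral)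
  finally show ?thesis by (simp add: inv_fourier_def)
qed

text \<open>Reflecting the variable turns \<open>fourier (inv_fourier f)\<close> into
  \<open>inv_fourier (fourier f)\<close>, which is the case already known.\<close>

lemma fourier_inv_fourier:
  assumes "f \<in> schwartz" shows "fourier (inv_fourier f) x = f x"
proof -
  have "fourier (inv_fourier f) x = inv_fourier (fourier f) x"
  proof -
    have "fourier (inv_fourier f) x = (LINT \<xi>|lborel. fourier f (- \<xi>) / of_real (2 * pi) * nwave \<xi> x)"
      by (simp add: fourier_def[of "inv_fourier f"] inv_fourier_eq)
    also have "\<dots> = (LINT \<xi>|lborel. fourier f \<xi> / of_real (2 * pi) * wave x \<xi>)"
      using lborel_integral_real_affine[of "- 1" "\<lambda>\<xi>. fourier f (- \<xi>) / of_real (2 * pi) * nwave \<xi> x" 0]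
      by (simp add: mult_ac)
    finally show ?thesis by (simp add: inv_fourier_def)
  qed
  then show ?thesis by (simp add: fourier_inversion assms)
qed

section \<open>Mollifiers, Sobolev densities and their duality\<close>

text \<open>The classical flat function at the origin with a polynomial in \<open>1 / x\<close> as
  prefactor. Differentiation replaces \<open>p\<close> by \<open>X\<^sup>2 (p - p')\<close>, so the
  family is closed under it and \<open>smooth_closed\<close> applies.\<close>

definition exp_inverse_poly :: "real poly \<Rightarrow> real \<Rightarrow> real" where
  "exp_inverse_poly p x = (if x > 0 then poly p (1 / x) * exp (- (1 / x)) else 0)"

lemma power_poly_exp_tendsto_0:
  "((\<lambda>t::real. t ^ k * poly p t * exp (- t)) \<longlongrightarrow> 0) at_top"
proof (induction p arbitrary: k)
  case (pCons a p)
  have "((\<lambda>t::real. a * (t ^ k / exp t) + t ^ Suc k * poly p t * exp (- t)) \<longlongrightarrow> a * 0 + 0) at_top"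
    by (intro tendsto_intros tendsto_power_div_exp_0 pCons)
  then show ?case
    by (simp add: algebra_simps exp_minus divide_inverse)
qed simp

lemma exp_inverse_poly_derivative:
  "(exp_inverse_poly p has_real_derivative exp_inverse_poly (pCons 0 (pCons 0 (p - pderiv p))) x) (at x)"
proof (cases x "0::real" rule: linorder_cases)
  case less
  have "((\<lambda>_. 0) has_real_derivative 0) (at x)" by simp
  then show ?thesis using less
    by (subst DERIV_cong_ev[OF refl _ refl, of _ "\<lambda>_. 0"])
      (auto simp: exp_inverse_poly_def eventually_nhds intro!: exI[of _ "{..<0}"])
next
  case greater
  have "((\<lambda>x. poly p (1 / x) * exp (- (1 / x))) has_real_derivative
      exp_inverse_poly (pCons 0 (pCons 0 (p - pderiv p))) x) (at x)"
    using greater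
    by (auto intro!: derivative_eq_intros DERIV_chain2[OF poly_DERIV] simp: exp_inverse_poly_def field_simps power2_eq_square)
  then show ?thesis using greater
    by (subst DERIV_cong_ev[OF refl _ refl, of _ "\<lambda>x. poly p (1 / x) * exp (- (1 / x))"])
      (auto simp: exp_inverse_poly_def eventually_nhds intro!: exI[of _ "{0<..}"])
next
  case equal
  have "((\<lambda>h. exp_inverse_poly p h / h) \<longlongrightarrow> 0) (at 0)"
  proof (rule filterlim_split_at_real)
    show "((\<lambda>h. exp_inverse_poly p h / h) \<longlongrightarrow> 0) (at_left 0)"
      by (rule tendsto_eventually) (auto simp: exp_inverse_poly_def eventually_at_filter)
    \<comment> \<open>With \<open>t = inverse h\<close> the difference quotient at 0 becomes
      \<open>t * poly p t * exp (- t)\<close>, so differentiability at 0 is exponential decay at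
      infinity.\<close>
    have "((\<lambda>h. (inverse h) ^ 1 * poly p (inverse h) * exp (- inverse h)) \<longlongrightarrow> 0) (at_right (0::real))"
      by (rule filterlim_compose[OF power_poly_exp_tendsto_0 filterlim_inverse_at_top_right])
    then show "((\<lambda>h. exp_inverse_poly p h / h) \<longlongrightarrow> 0) (at_right 0)"
      by (rule Lim_transform_eventually)
        (auto simp: exp_inverse_poly_def eventually_at_filter divide_inverse)
  qed
  then show ?thesis using equal by (simp add: has_field_derivative_iff exp_inverse_poly_def)
qed

lemma smooth_exp_inverse_poly: "smooth (\<lambda>x. of_real (exp_inverse_poly p x))"
proof (rule smooth_closed)
  show "(\<lambda>x. of_real (exp_inverse_poly p x)) \<in> range (\<lambda>p x. complex_of_real (exp_inverse_poly p x))"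
    by blast
  fix f assume "f \<in> range (\<lambda>p x. complex_of_real (exp_inverse_poly p x))"
  then obtain p where f: "f = (\<lambda>x. of_real (exp_inverse_poly p x))" by blast
  show "\<exists>f'\<in>range (\<lambda>p x. complex_of_real (exp_inverse_poly p x)). \<forall>x. (f has_vector_derivative f' x) (at x)"
    unfolding f
    by (intro bexI[OF _ rangeI[of _ "pCons 0 (pCons 0 (p - pderiv p))"]] allI
        has_vector_derivative_of_real exp_inverse_poly_derivative)
qed

abbreviation step_fun :: "real \<Rightarrow> real" where
  "step_fun \<equiv> exp_inverse_poly 1"

lemma step_fun_bounds: "0 \<le> step_fun x" "step_fun x \<le> 1" "x \<le> 0 \<Longrightarrow> step_fun x = 0" "x > 0 \<Longrightarrow> step_fun x > 0"
  by (auto simp: exp_inverse_poly_def)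

definition bump :: "real \<Rightarrow> real" where
  "bump x = step_fun (1 + x) * step_fun (1 - x)"

lemma bump_bounds: "0 \<le> bump x" "bump x \<le> 1" "\<bar>x\<bar> \<ge> 1 \<Longrightarrow> bump x = 0" "\<bar>x\<bar> < 1 \<Longrightarrow> bump x > 0"
proof -
  show "0 \<le> bump x" "bump x \<le> 1"
    using mult_mono[of "step_fun (1 + x)" 1 "step_fun (1 - x)" 1] by (auto simp: bump_def step_fun_bounds)
  show "\<bar>x\<bar> \<ge> 1 \<Longrightarrow> bump x = 0" "\<bar>x\<bar> < 1 \<Longrightarrow> bump x > 0"
    by (auto simp: bump_def step_fun_bounds abs_if split: if_splits)
qed

lemma smooth_bump: "smooth (\<lambda>x. of_real (bump x))"
  using smooth_mult[OF smooth_affine[OF smooth_exp_inverse_poly[of 1], of 1 1]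
      smooth_affine[OF smooth_exp_inverse_poly[of 1], of "- 1" 1]]
  by (simp add: bump_def add.commute)

lemma test_functionsI:
  assumes "smooth f" "compact K" "K \<subseteq> U" "\<And>x. x \<notin> K \<Longrightarrow> f x = 0"
  shows "f \<in> test_functions U"
proof -
  have "{x. f x \<noteq> 0} \<subseteq> K" using assms by auto
  then have "closure {x. f x \<noteq> 0} \<subseteq> K"
    by (intro closure_minimal compact_imp_closed assms)
  then show ?thesis
    using assms compact_Int_closed[OF assms(2) closed_closure[of "{x. f x \<noteq> 0}"]]
    by (auto simp: test_functions_def Int_absorb1)
qed

lemma bump_schwartz: "(\<lambda>x. of_real (bump x)) \<in> schwartz"
proof -
  have "(\<lambda>x. complex_of_real (bump x)) \<in> test_functions UNIV"
    by (rule test_functionsI[OF smooth_bump, of "{-1..1}"]) (auto simp: bump_bounds)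
  then show ?thesis using test_functions_schwartz by blast
qed

lemma bump_integrable: "integrable lborel bump"
  using schwartz_integrable[OF bump_schwartz] integrable_Re[of lborel "\<lambda>x. of_real (bump x)"] by simp

definition bump_mass :: real where
  "bump_mass = (LINT x|lborel. bump x)"

lemma bump_mass_pos: "bump_mass > 0"
proof -
  have "bump_mass \<noteq> 0"
  proof
    assume "bump_mass = 0"
    then have "AE x in lborel. bump x = 0"
      using integral_nonneg_eq_0_iff_AE[OF bump_integrable] by (simp add: bump_mass_def bump_bounds)
    then have "AE x in lborel. x \<notin> {-1<..<1::real}"
      by eventually_elim (use bump_bounds(4) in \<open>force simp: abs_if split: if_splits\<close>)
    then have "{-1<..<1::real} \<in> null_sets lborel"
      by (subst (asm) AE_iff_null_sets[symmetric]) auto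
    then show False by (simp add: null_sets_def)
  qed
  moreover have "bump_mass \<ge> 0" by (simp add: bump_mass_def bump_bounds)
  ultimately show ?thesis by simp
qed

definition mollifier :: "real \<Rightarrow> real \<Rightarrow> real \<Rightarrow> real" where
  "mollifier c r x = bump ((x - c) / r) / (r * bump_mass)"

abbreviation cmollifier :: "real \<Rightarrow> real \<Rightarrow> real \<Rightarrow> complex" where
  "cmollifier c r \<equiv> (\<lambda>x. of_real (mollifier c r x))"

context
  fixes c r :: real
  assumes r: "r > 0"
begin

lemma mollifier_nonneg: "mollifier c r x \<ge> 0"
  using r bump_mass_pos by (simp add: mollifier_def bump_bounds)

lemma mollifier_zero: "\<bar>x - c\<bar> \<ge> r \<Longrightarrow> mollifier c r x = 0"
  using r by (simp add: mollifier_def bump_bounds abs_divide)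

lemma mollifier_test:
  assumes "cball c r \<subseteq> U"
  shows "(cmollifier c r) \<in> test_functions U"
proof (rule test_functionsI[of _ "cball c r"])
  have "(cmollifier c r) = (\<lambda>x. of_real (1 / (r * bump_mass)) * of_real (bump ((1 / r) * x + (- c / r))) :: complex)"
    by (auto simp: mollifier_def fun_eq_iff diff_divide_distrib)
  moreover have "smooth \<dots>" by (intro smooth_cmult smooth_affine[OF smooth_bump])
  ultimately show "smooth (cmollifier c r)" by simp
  fix x assume "x \<notin> cball c r"
  then show "complex_of_real (mollifier c r x) = 0"
    using mollifier_zero[of x] by (simp add: dist_real_def abs_minus_commute)
qed (use assms in auto)

lemma mollifier_schwartz: "(cmollifier c r) \<in> schwartz"
  using mollifier_test[of UNIV] test_functions_schwartz by auto

lemma mollifier_integrable: "integrable lborel (mollifier c r)"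
  using schwartz_integrable[OF mollifier_schwartz] integrable_Re[of lborel "\<lambda>x. of_real (mollifier c r x)"] by simp

lemma mollifier_integral: "(LINT x|lborel. mollifier c r x) = 1"
proof -
  have "(LINT x|lborel. mollifier c r (c + r * x)) = 1 / r"
    using r bump_mass_pos by (simp add: mollifier_def bump_mass_def[symmetric])
  then show ?thesis using lborel_integral_real_affine[of r "mollifier c r" c] r by simp
qed

text \<open>Translation becomes a factor of modulus 1 and dilation a rescaled frequency. All
  estimates for mollifiers thereby reduce to one fixed Schwartz function, the inverse transform of
  \<open>cmollifier 0 1\<close>.\<close>

lemma inv_fourier_mollifier:
  "inv_fourier (cmollifier c r) \<xi> =
    wave c \<xi> * inv_fourier (cmollifier 0 1) (r * \<xi>)"
proof -
  have "(LINT x|lborel. of_real (mollifier c r x) * wave \<xi> x)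
    = r *\<^sub>R (LINT x|lborel. of_real (mollifier c r (c + r * x)) * wave \<xi> (c + r * x))"
    using lborel_integral_real_affine[of r "\<lambda>x. of_real (mollifier c r x) * wave \<xi> x" c] r by simp
  also have "\<dots> = (LINT x|lborel. wave c \<xi> * (of_real (mollifier 0 1 x) * wave (r * \<xi>) x))"
    unfolding integral_scaleR_right[symmetric]
  proof (intro Bochner_Integration.integral_cong refl)
    fix x
    have "wave \<xi> (c + r * x) = wave c \<xi> * wave (r * \<xi>) x"
      by (simp flip: exp_add add: algebra_simps)
    moreover have "r * mollifier c r (c + r * x) = mollifier 0 1 x"
      using r by (simp add: mollifier_def)
    ultimately show "r *\<^sub>R (of_real (mollifier c r (c + r * x)) * wave \<xi> (c + r * x))
      = wave c \<xi> * (of_real (mollifier 0 1 x) * wave (r * \<xi>) x)"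
      by (simp only: scaleR_conv_of_real mult.assoc[symmetric] flip: of_real_mult) (simp add: mult_ac)
  qed
  finally show ?thesis
    by (simp add: inv_fourier_def)
qed

end

section \<open>Sobolev densities: duality and membership\<close>

lemma Cauchy_Schwarz_integral:
  fixes f g :: "'a \<Rightarrow> real"
  assumes [measurable]: "f \<in> borel_measurable M" "g \<in> borel_measurable M"
    and f: "integrable M (\<lambda>x. (f x)\<^sup>2)" and g: "integrable M (\<lambda>x. (g x)\<^sup>2)"
  shows "integrable M (\<lambda>x. f x * g x)"
    and "(LINT x|M. f x * g x) \<le> sqrt (LINT x|M. (f x)\<^sup>2) * sqrt (LINT x|M. (g x)\<^sup>2)"
proof -
  let ?A = "LINT x|M. (f x)\<^sup>2" and ?B = "LINT x|M. (g x)\<^sup>2" and ?X = "LINT x|M. f x * g x"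
  show i: "integrable M (\<lambda>x. f x * g x)"
  proof (rule integrable_dominated[OF _ Bochner_Integration.integrable_add[OF f g]])
    fix x
    have "2 * (\<bar>f x\<bar> * \<bar>g x\<bar>) \<le> \<bar>f x\<bar>\<^sup>2 + \<bar>g x\<bar>\<^sup>2" using sum_squares_bound[of "\<bar>f x\<bar>" "\<bar>g x\<bar>"] by simp
    moreover have "0 \<le> \<bar>f x\<bar> * \<bar>g x\<bar>" by simp
    ultimately show "norm (f x * g x) \<le> (f x)\<^sup>2 + (g x)\<^sup>2"
      unfolding real_norm_def abs_mult power2_abs by linarith
  qed simp
  have q: "0 \<le> ?A - 2 * t * ?X + t\<^sup>2 * ?B" for t
  proof -
    have "0 \<le> (LINT x|M. (f x - t * g x)\<^sup>2)" by simp
    also have "\<dots> = (LINT x|M. (f x)\<^sup>2 - 2 * t * (f x * g x) + t\<^sup>2 * (g x)\<^sup>2)"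
      by (simp add: power2_diff power_mult_distrib algebra_simps)
    also have "\<dots> = ?A - 2 * t * ?X + t\<^sup>2 * ?B" using i f g by simp
    finally show ?thesis .
  qed
  have AB: "?A \<ge> 0" "?B \<ge> 0" by simp_all
  have "?X\<^sup>2 \<le> ?A * ?B"
  proof (cases "?B = 0")
    case True
    have "?X = 0"
    proof (rule ccontr)
      assume "?X \<noteq> 0"
      \<comment> \<open>With \<open>?B = 0\<close> the quadratic in \<open>t\<close> degenerates to
        a linear function, and this choice of \<open>t\<close> gives it the value -1.\<close>
      then have "2 * ((?A + 1) / (2 * ?X)) * ?X = ?A + 1" by simp
      with q[of "(?A + 1) / (2 * ?X)"] True show False by simp
    qed
    with AB show ?thesis by simp
  next
    case False
    with AB(2) have B: "?B > 0" by (simp only: less_le) simp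
    have "0 \<le> ?A - ?X\<^sup>2 / ?B" using q[of "?X / ?B"] B by (simp add: power2_eq_square field_simps)
    with B show ?thesis by (simp add: field_simps)
  qed
  then have "\<bar>?X\<bar> \<le> sqrt (?A * ?B)" by (simp add: real_le_rsqrt)
  then show "?X \<le> sqrt ?A * sqrt ?B" by (simp add: real_sqrt_mult)
qed

text \<open>A density describes \<open>T\<close> only on Fourier transforms, but
  \<open>\<phi>\<close> is the transform of \<open>inv_fourier \<phi>\<close>. This formula is how
  an abstract extension is evaluated on a mollifier.\<close>

lemma fourier_density_test:
  assumes "fourier_density \<rho> T h" "\<phi> \<in> schwartz"
  shows "T \<phi> = (LINT \<xi>|lborel. h \<xi> * inv_fourier \<phi> \<xi>)"
proof -
  note \<psi> = schwartz_inv_fourier[OF assms(2)]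
  have "fourier_distribution T (inv_fourier \<phi>) = distribution_of h (inv_fourier \<phi>)"
    using assms(1) by (simp add: fourier_density_def)
  moreover have "fourier (inv_fourier \<phi>) = \<phi>" using fourier_inv_fourier[OF assms(2)] by (rule ext)
  ultimately show ?thesis using \<psi> by (simp add: fourier_distribution_def distribution_of_def)
qed

text \<open>The duality of the orders \<open>\<rho>\<close> and \<open>- \<rho>\<close>:
  Cauchy-Schwarz after giving the weight \<open>(1 + \<xi>\<^sup>2) powr (\<rho> / 2)\<close> to
  \<open>h\<close> and its reciprocal to \<open>\<psi>\<close>.\<close>

lemma fourier_density_pairing:
  assumes h: "fourier_density \<rho> T h" and [measurable]: "\<psi> \<in> borel_measurable borel"
    and int: "integrable lborel (\<lambda>\<xi>. (1 + \<xi>\<^sup>2) powr (- \<rho>) * (cmod (\<psi> \<xi>))\<^sup>2)"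
  shows "integrable lborel (\<lambda>\<xi>. h \<xi> * \<psi> \<xi>)"
    and "(LINT \<xi>|lborel. cmod (h \<xi> * \<psi> \<xi>)) \<le> l2_norm_on UNIV (sobolev_weighted \<rho> h)
        * sqrt (LINT \<xi>|lborel. (1 + \<xi>\<^sup>2) powr (- \<rho>) * (cmod (\<psi> \<xi>))\<^sup>2)"
proof -
  have [measurable]: "h \<in> borel_measurable borel" using h by (simp add: fourier_density_def)
  let ?w = "\<lambda>\<xi>. cmod (sobolev_weighted \<rho> h \<xi>)" and ?v = "\<lambda>\<xi>. (1 + \<xi>\<^sup>2) powr (- \<rho> / 2) * cmod (\<psi> \<xi>)"
  have p: "1 + \<xi>\<^sup>2 > 0" for \<xi> :: real by (simp add: add_pos_nonneg)
  have v2: "(?v \<xi>)\<^sup>2 = (1 + \<xi>\<^sup>2) powr (- \<rho>) * (cmod (\<psi> \<xi>))\<^sup>2" for \<xi>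
    by (simp add: power_mult_distrib power2_eq_square flip: powr_add)
  have eq: "?w \<xi> * ?v \<xi> = cmod (h \<xi> * \<psi> \<xi>)" for \<xi>
  proof -
    have "(1 + \<xi>\<^sup>2) powr (\<rho> / 2) * (1 + \<xi>\<^sup>2) powr (- \<rho> / 2) = 1"
      using p[of \<xi>] by (simp flip: powr_add)
    then show ?thesis by (simp add: sobolev_weighted_def norm_mult mult_ac)
  qed
  have [measurable]: "sobolev_weighted \<rho> h \<in> borel_measurable borel"
    unfolding sobolev_weighted_def[abs_def] by measurable
  have 1: "integrable lborel (\<lambda>\<xi>. (?w \<xi>)\<^sup>2)"
    using h by (simp add: fourier_density_def square_integrable_def)
  have 2: "integrable lborel (\<lambda>\<xi>. (?v \<xi>)\<^sup>2)" using int by (simp only: v2)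
  have "integrable lborel (\<lambda>\<xi>. cmod (h \<xi> * \<psi> \<xi>))"
    using Cauchy_Schwarz_integral(1)[OF _ _ 1 2] by (simp only: eq) simp
  then show "integrable lborel (\<lambda>\<xi>. h \<xi> * \<psi> \<xi>)" by (subst (asm) integrable_norm_iff) simp_all
  show "(LINT \<xi>|lborel. cmod (h \<xi> * \<psi> \<xi>)) \<le> l2_norm_on UNIV (sobolev_weighted \<rho> h)
        * sqrt (LINT \<xi>|lborel. (1 + \<xi>\<^sup>2) powr (- \<rho>) * (cmod (\<psi> \<xi>))\<^sup>2)"
    using Cauchy_Schwarz_integral(2)[OF _ _ 1 2]
    by (simp only: eq v2) (simp add: l2_norm_on_def set_lebesgue_integral_def)
qed

lemma sobolev_density:
  assumes "T \<in> sobolev \<rho>"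
  obtains h where "fourier_density \<rho> T h" "sobolev_norm \<rho> T = l2_norm_on UNIV (sobolev_weighted \<rho> h)"
proof -
  have "\<exists>h. fourier_density \<rho> T h" using assms by (simp add: sobolev_def)
  then have "fourier_density \<rho> T (SOME h. fourier_density \<rho> T h)" by (rule someI_ex)
  then show thesis using that by (simp add: sobolev_norm_def)
qed

lemma l2_norm_nonneg: "l2_norm_on A f \<ge> 0"
  by (simp add: l2_norm_on_def set_lebesgue_integral_def)

lemma sobolev_norm_nonneg: "sobolev_norm \<rho> T \<ge> 0"
  by (simp add: sobolev_norm_def l2_norm_nonneg)

lemma schwartz_seminorm_ge:
  assumes "f \<in> schwartz" shows "\<bar>x\<bar> ^ j * cmod (vderiv k f x) \<le> schwartz_seminorm j k f"
proof -
  have "bdd_above (range (\<lambda>x. norm (x ^ j *\<^sub>R vderiv k f x)))"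
  proof -
    obtain B where "\<And>x. \<bar>x\<bar> ^ j * cmod (vderiv k f x) \<le> B" using schwartz_bound[OF assms] by metis
    then show ?thesis by (intro bdd_aboveI2[of _ _ B]) (simp add: power_abs)
  qed
  from cSUP_upper[OF UNIV_I this, of x] show ?thesis
    by (simp add: schwartz_seminorm_def power_abs)
qed

lemma distribution_of_tempered:
  assumes [measurable]: "f \<in> borel_measurable borel" and B: "\<And>x. cmod (f x) \<le> B"
  shows "distribution_of f \<in> tempered"
proof -
  have i: "integrable lborel (\<lambda>x. f x * \<phi> x)" if "\<phi> \<in> schwartz" for \<phi>
  proof (rule integrable_dominated)
    show "integrable lborel (\<lambda>x. B * cmod (\<phi> x))" using schwartz_integrable[OF that] by simp
  qed (use schwartz_measurable[OF that] B in \<open>auto simp: norm_mult intro!: mult_right_mono\<close>)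
  have "B \<ge> 0" using B[of 0] norm_ge_zero[of "f 0"] by linarith
  let ?I = "LINT x|lborel. inverse (1 + x\<^sup>2) :: real"
  have bound: "cmod (distribution_of f \<phi>) \<le> (B * ?I) * (\<Sum>j\<le>2. \<Sum>k\<le>2. schwartz_seminorm j k \<phi>)"
    if \<phi>: "\<phi> \<in> schwartz" for \<phi>
  proof -
    let ?S = "\<Sum>j\<le>2. \<Sum>k\<le>2. schwartz_seminorm j k \<phi>"
    have pos: "0 \<le> schwartz_seminorm j k \<phi>" for j k
      by (rule order_trans[OF _ schwartz_seminorm_ge[OF \<phi>, of 0]]) simp
    have "schwartz_seminorm 0 0 \<phi> + schwartz_seminorm 2 0 \<phi> \<le> ?S"
      by (simp add: numeral_2_eq_2 pos add_increasing add_increasing2)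
    then have *: "cmod (\<phi> x) \<le> ?S * inverse (1 + x\<^sup>2)" for x
    proof -
      have "(1 + x\<^sup>2) * cmod (\<phi> x) \<le> ?S"
        using schwartz_seminorm_ge[OF \<phi>, of x 0 0] schwartz_seminorm_ge[OF \<phi>, of x 2 0]
          \<open>schwartz_seminorm 0 0 \<phi> + schwartz_seminorm 2 0 \<phi> \<le> ?S\<close> by (simp add: distrib_right)
      moreover have "1 + x\<^sup>2 > 0" by (simp add: add_pos_nonneg)
      ultimately show ?thesis by (simp add: field_simps)
    qed
    have "cmod (LINT x|lborel. f x * \<phi> x) \<le> (LINT x|lborel. (B * ?S) * inverse (1 + x\<^sup>2))"
    proof (rule Bochner_Integration.integral_norm_bound_integral[OF i[OF \<phi>]])
      show "integrable lborel (\<lambda>x. (B * ?S) * inverse (1 + x\<^sup>2))"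
        by (intro integrable_mult_right integrable_inverse_square)
      show "cmod (f x * \<phi> x) \<le> (B * ?S) * inverse (1 + x\<^sup>2)" for x
        unfolding norm_mult mult.assoc using B[of x] *[of x] \<open>B \<ge> 0\<close> by (intro mult_mono) auto
    qed
    also have "\<dots> = (B * ?I) * ?S" by (simp add: mult_ac)
    finally show ?thesis using \<phi> by (simp add: distribution_of_def)
  qed
  have "distribution_of f (\<lambda>x. a * \<phi> x + b * \<psi> x) = a * distribution_of f \<phi> + b * distribution_of f \<psi>"
    if "\<phi> \<in> schwartz" "\<psi> \<in> schwartz" for \<phi> \<psi> a b
  proof -
    have "(LINT x|lborel. f x * (a * \<phi> x + b * \<psi> x)) = (LINT x|lborel. a * (f x * \<phi> x) + b * (f x * \<psi> x))"
      by (simp add: algebra_simps)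
    also have "\<dots> = a * (LINT x|lborel. f x * \<phi> x) + b * (LINT x|lborel. f x * \<psi> x)"
      using i that by simp
    finally show ?thesis using that by (simp add: distribution_of_def schwartz_lincomb)
  qed
  moreover have "distribution_of f \<in> extensional schwartz" by (simp add: distribution_of_def)
  ultimately show ?thesis using bound unfolding tempered_def by blast
qed

lemma inv_fourier_measurable [measurable]:
  assumes [measurable]: "h \<in> borel_measurable borel"
  shows "inv_fourier h \<in> borel_measurable borel"
  unfolding inv_fourier_def[abs_def] by measurable

text \<open>Fubini moves the transform from the Schwartz function to \<open>h\<close> and leaves
  \<open>inv_fourier (fourier \<phi>)\<close>, so \<open>h\<close> itself is a density. Membership
  matters because the infimum in the quotient norm is informative only over a nonempty set of
  extensions.\<close>

lemma inv_fourier_in_sobolev: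
  assumes h: "integrable lborel h" and sq: "square_integrable (sobolev_weighted \<rho> h)"
  shows "distribution_of (inv_fourier h) \<in> sobolev \<rho>"
proof -
  have [measurable]: "h \<in> borel_measurable borel" using h by auto
  have "fourier_distribution (distribution_of (inv_fourier h)) \<phi> = distribution_of h \<phi>" if "\<phi> \<in> schwartz" for \<phi>
  proof -
    note f\<phi> = schwartz_fourier[OF that]
    have [measurable]: "fourier \<phi> \<in> borel_measurable borel" using schwartz_measurable[OF f\<phi>] .
    let ?G = "\<lambda>x \<xi>. h \<xi> * wave x \<xi> * fourier \<phi> x / of_real (2 * pi)"
    have int: "integrable (lborel \<Otimes>\<^sub>M lborel) (case_prod ?G)"
    proof (rule lborel_pair.Fubini_integrable)
      show "integrable lborel (\<lambda>x. LINT \<xi>|lborel. norm (case (x, \<xi>) of (x, \<xi>) \<Rightarrow> ?G x \<xi>))"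
        using schwartz_integrable[OF f\<phi>] by (simp add: norm_mult norm_divide)
      show "AE x in lborel. integrable lborel (\<lambda>\<xi>. case (x, \<xi>) of (x, \<xi>) \<Rightarrow> ?G x \<xi>)"
      proof (intro AE_I2)
        fix x
        have "integrable lborel (\<lambda>\<xi>. h \<xi> * wave x \<xi>)"
          using fourier_integrable(2)[OF h, of x] by (simp add: mult_ac)
        then show "integrable lborel (\<lambda>\<xi>. case (x, \<xi>) of (x, \<xi>) \<Rightarrow> ?G x \<xi>)"
          unfolding prod.case by (intro integrable_divide integrable_mult_left)
      qed
    qed (simp add: case_prod_beta')
    have "(LINT x|lborel. inv_fourier h x * fourier \<phi> x) = (LINT x|lborel. LINT \<xi>|lborel. ?G x \<xi>)"
      unfolding inv_fourier_def by simp
    also have "\<dots> = (LINT \<xi>|lborel. LINT x|lborel. ?G x \<xi>)"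
      by (rule lborel_pair.Fubini_integral[OF int, symmetric])
    also have "\<dots> = (LINT \<xi>|lborel. h \<xi> * inv_fourier (fourier \<phi>) \<xi>)"
      unfolding inv_fourier_def
      by (intro Bochner_Integration.integral_cong refl) (simp add: mult_ac flip: integral_mult_right_zero integral_divide_zero)
    finally show ?thesis using that f\<phi>
      by (simp add: fourier_distribution_def distribution_of_def fourier_inversion[OF that])
  qed
  then have "fourier_distribution (distribution_of (inv_fourier h)) = distribution_of h"
    by (intro ext) (metis distribution_of_def fourier_distribution_def restrict_apply)
  moreover have "distribution_of (inv_fourier h) \<in> tempered"
    by (rule distribution_of_tempered[OF _ inv_fourier_norm_le]) simp
  ultimately show ?thesis
    unfolding sobolev_def fourier_density_def using sq by (auto intro!: exI[of _ h])
qed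

section \<open>The kernel of the fractional Laplacian\<close>

text \<open>Restricted to the half-line because the symmetric second difference in
  \<open>abs_D_powr_eq\<close> already accounts for both signs of \<open>z\<close>.\<close>

definition riesz_kernel :: "real \<Rightarrow> real \<Rightarrow> real" where
  "riesz_kernel p z = indicator {0<..} z * z powr (- 1 - p)"

definition riesz_const :: "real \<Rightarrow> real" where
  "riesz_const p = (LINT z|lborel. (1 - cos z) * riesz_kernel p z)"

lemma riesz_kernel_nonneg: "riesz_kernel p z \<ge> 0"
  by (simp add: riesz_kernel_def)

lemma riesz_kernel_measurable [measurable]: "riesz_kernel p \<in> borel_measurable borel"
  unfolding riesz_kernel_def[abs_def] by measurable

lemma set_integrable_lborel_of_integrable_on:
  fixes f :: "real \<Rightarrow> real"
  assumes "f integrable_on S" "\<And>x. x \<in> S \<Longrightarrow> f x \<ge> 0" "f \<in> borel_measurable borel" "S \<in> sets borel"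
  shows "integrable lborel (\<lambda>x. indicator S x * f x)"
proof -
  have "integrable lebesgue (\<lambda>x. indicator S x *\<^sub>R f x)"
    using nonnegative_absolutely_integrable_1[OF assms(1,2)] by (simp add: set_integrable_def)
  moreover have "(\<lambda>x. indicator S x *\<^sub>R f x) \<in> borel_measurable lborel"
    using assms(3,4) by simp
  ultimately show ?thesis by (simp add: integrable_completion)
qed

lemma one_minus_cos_le: "1 - cos z \<le> z\<^sup>2 / (2::real)"
proof -
  have "1 - cos z = 2 * (sin (z / 2))\<^sup>2" using cos_double_sin[of "z / 2"] by simp
  moreover have "\<bar>sin (z / 2)\<bar>\<^sup>2 \<le> \<bar>z / 2\<bar>\<^sup>2"
    by (intro power_mono abs_sin_x_le_abs_x) simp
  ultimately show ?thesis by (simp add: power2_eq_square)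
qed

lemma powr_le_one_plus_square:
  fixes \<xi> p :: real
  assumes "0 < p" "p \<le> 2" shows "\<bar>\<xi>\<bar> powr p \<le> 1 + \<xi>\<^sup>2"
proof (cases "\<bar>\<xi>\<bar> \<le> 1")
  case True
  then have "\<bar>\<xi>\<bar> powr p \<le> 1" using assms by (simp add: powr_le1)
  then show ?thesis by (simp add: add_increasing2)
next
  case False
  then have "\<bar>\<xi>\<bar> powr p \<le> \<bar>\<xi>\<bar> powr 2" using assms by (intro powr_mono) auto
  then show ?thesis by simp
qed

context
  fixes p :: real
  assumes p: "0 < p" "p < 2"
begin

text \<open>Each bound on \<open>p\<close> serves one end of the half-line. Near 0 the cosine gains
  two powers and leaves \<open>z powr (1 - p)\<close>, integrable since \<open>p < 2\<close>; near
  infinity \<open>z powr (- 1 - p)\<close> is integrable since \<open>p > 0\<close>.\<close>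

lemma riesz_integrable: "integrable lborel (\<lambda>z. (1 - cos z) * riesz_kernel p z)"
proof (rule integrable_dominated)
  have 1: "integrable lborel (\<lambda>z. indicator {0..1} z * z powr (1 - p))"
    by (rule set_integrable_lborel_of_integrable_on) (use p in \<open>auto intro!: integrable_on_powr_from_0\<close>)
  have 2: "integrable lborel (\<lambda>z. indicator {1..} z * z powr (- 1 - p))"
    by (rule set_integrable_lborel_of_integrable_on)
      (use p has_integral_powr_to_inf[of "- 1 - p" 1] in \<open>auto simp: integrable_on_def\<close>)
  show "integrable lborel (\<lambda>z. indicator {0..1} z * z powr (1 - p) + 2 * (indicator {1..} z * z powr (- 1 - p)))"
    using 1 2 by simp
  fix z :: real
  consider "z \<le> 0" | "0 < z" "z < 1" | "z \<ge> 1" by linarith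
  then show "norm ((1 - cos z) * riesz_kernel p z)
    \<le> indicator {0..1} z * z powr (1 - p) + 2 * (indicator {1..} z * z powr (- 1 - p))"
  proof cases
    case 2
    have "(1 - cos z) * z powr (- 1 - p) \<le> z\<^sup>2 * z powr (- 1 - p)"
      using order_trans[OF one_minus_cos_le[of z], of "z\<^sup>2"] by (intro mult_right_mono) auto
    also have "\<dots> = z powr (1 - p)" using 2 by (simp flip: powr_numeral powr_add)
    finally show ?thesis using 2 by (simp add: riesz_kernel_def)
  next
    case 3
    have "(1 - cos z) * z powr (- 1 - p) \<le> 2 * z powr (- 1 - p)"
      using cos_ge_minus_one[of z] by (intro mult_right_mono powr_ge_zero) linarith
    moreover have "indicator {0..1} z * z powr (1 - p) \<ge> 0" by simp
    moreover have "norm ((1 - cos z) * riesz_kernel p z) = (1 - cos z) * z powr (- 1 - p)"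
      "indicator {1..} z * z powr (- 1 - p) = z powr (- 1 - p)"
      using 3 by (simp_all add: riesz_kernel_def abs_mult)
    ultimately show ?thesis by linarith
  qed (simp add: riesz_kernel_def)
qed simp

lemma riesz_const_pos: "riesz_const p > 0"
proof -
  have "riesz_const p \<noteq> 0"
  proof
    assume "riesz_const p = 0"
    then have "AE z in lborel. (1 - cos z) * riesz_kernel p z = 0"
      using integral_nonneg_eq_0_iff_AE[OF riesz_integrable] by (simp add: riesz_const_def riesz_kernel_nonneg)
    then have "AE z in lborel. z \<notin> {0<..<1::real}"
    proof eventually_elim
      case (elim z)
      then show ?case using cos_monotone_0_pi[of 0 z] pi_gt3 by (auto simp: riesz_kernel_def)
    qed
    then have "{0<..<1::real} \<in> null_sets lborel"
      by (subst (asm) AE_iff_null_sets[symmetric]) auto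
    then show False by (simp add: null_sets_def)
  qed
  moreover have "riesz_const p \<ge> 0" by (simp add: riesz_const_def riesz_kernel_nonneg)
  ultimately show ?thesis by simp
qed

text \<open>The substitution of \<open>\<bar>\<xi>\<bar> * z\<close> for \<open>z\<close> exhibits
  the symbol \<open>\<bar>\<xi>\<bar> powr p\<close> as a superposition of cosines, the form in
  which it can be inverted frequency by frequency.\<close>

lemma riesz_scaling:
  "integrable lborel (\<lambda>z. (1 - cos (\<xi> * z)) * riesz_kernel p z)"
  "(LINT z|lborel. (1 - cos (\<xi> * z)) * riesz_kernel p z) = \<bar>\<xi>\<bar> powr p * riesz_const p"
proof -
  have *: "(1 - cos (\<xi> * z)) * riesz_kernel p z =
      \<bar>\<xi>\<bar> powr (1 + p) * ((1 - cos (0 + \<bar>\<xi>\<bar> * z)) * riesz_kernel p (0 + \<bar>\<xi>\<bar> * z))" if "\<xi> \<noteq> 0" for z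
  proof -
    have "cos (\<xi> * z) = cos (\<bar>\<xi>\<bar> * z)" by (cases "\<xi> \<ge> 0") auto
    moreover have "riesz_kernel p z = \<bar>\<xi>\<bar> powr (1 + p) * riesz_kernel p (\<bar>\<xi>\<bar> * z)"
      using that by (auto simp: riesz_kernel_def indicator_def powr_mult zero_less_mult_iff simp flip: powr_add mult.assoc)
    ultimately show ?thesis by simp
  qed
  show "integrable lborel (\<lambda>z. (1 - cos (\<xi> * z)) * riesz_kernel p z)"
  proof (cases "\<xi> = 0")
    case False
    show ?thesis unfolding *[OF False]
      by (intro integrable_mult_right lborel_integrable_real_affine[OF riesz_integrable]) (use False in simp)
  qed simp
  show "(LINT z|lborel. (1 - cos (\<xi> * z)) * riesz_kernel p z) = \<bar>\<xi>\<bar> powr p * riesz_const p"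
  proof (cases "\<xi> = 0")
    case False
    have "riesz_const p = \<bar>\<xi>\<bar> * (LINT z|lborel. (1 - cos (0 + \<bar>\<xi>\<bar> * z)) * riesz_kernel p (0 + \<bar>\<xi>\<bar> * z))"
      unfolding riesz_const_def
      using lborel_integral_real_affine[of "\<bar>\<xi>\<bar>" "\<lambda>z. (1 - cos z) * riesz_kernel p z" 0] False by simp
    then show ?thesis unfolding *[OF False] integral_mult_right_zero
      using False by (simp add: powr_add)
  qed simp
qed

lemma integrable_powr_schwartz:
  assumes "\<phi> \<in> schwartz"
  shows "integrable lborel (\<lambda>\<xi>. of_real (\<bar>\<xi>\<bar> powr p) * \<phi> \<xi>)"
proof (rule integrable_dominated)
  show "integrable lborel (\<lambda>\<xi>. cmod (\<phi> \<xi>) + cmod (of_real \<xi> * (of_real \<xi> * \<phi> \<xi>)))"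
    by (intro Bochner_Integration.integrable_add integrable_norm schwartz_integrable schwartz_times assms)
  fix \<xi> :: real
  have "\<bar>\<xi>\<bar> powr p \<le> 1 + \<bar>\<xi>\<bar> * \<bar>\<xi>\<bar>"
    using powr_le_one_plus_square[of p \<xi>] p by (simp add: power2_eq_square)
  from mult_right_mono[OF this norm_ge_zero[of "\<phi> \<xi>"]]
  show "norm (of_real (\<bar>\<xi>\<bar> powr p) * \<phi> \<xi>) \<le> cmod (\<phi> \<xi>) + cmod (of_real \<xi> * (of_real \<xi> * \<phi> \<xi>))"
    by (simp add: norm_mult distrib_right mult.assoc)
qed (use schwartz_measurable[OF assms] in simp)

text \<open>The symbol is written as in \<open>riesz_scaling\<close> and the integrals are
  exchanged. The cosine is the mean of two waves, so inversion at \<open>x\<close>,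
  \<open>x + z\<close> and \<open>x - z\<close> gives the second difference of \<open>g\<close>;
  absolute convergence of the double integral comes from the positivity of
  \<open>1 - cos\<close>.\<close>

lemma abs_D_powr_eq:
  assumes g: "g \<in> schwartz"
  shows "of_real (riesz_const p) * abs_D_powr p g x =
    (LINT z|lborel. of_real (riesz_kernel p z) * (g x - (g (x + z) + g (x - z)) / 2))"
proof -
  note F = schwartz_fourier[OF g]
  have [measurable]: "fourier g \<in> borel_measurable borel" using schwartz_measurable[OF F] .
  let ?G = "\<lambda>\<xi> z. fourier g \<xi> * wave x \<xi> * of_real ((1 - cos (\<xi> * z)) * riesz_kernel p z)"
  have int: "integrable (lborel \<Otimes>\<^sub>M lborel) (case_prod ?G)"
  proof (rule lborel_pair.Fubini_integrable)
    have eq: "(LINT z|lborel. norm (case (\<xi>, z) of (\<xi>, z) \<Rightarrow> ?G \<xi> z)) =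
       riesz_const p * cmod (of_real (\<bar>\<xi>\<bar> powr p) * fourier g \<xi>)" for \<xi>
    proof -
      have "(LINT z|lborel. norm (case (\<xi>, z) of (\<xi>, z) \<Rightarrow> ?G \<xi> z)) =
        (LINT z|lborel. cmod (fourier g \<xi>) * ((1 - cos (\<xi> * z)) * riesz_kernel p z))"
        by (intro Bochner_Integration.integral_cong refl)
          (simp add: norm_mult abs_mult riesz_kernel_nonneg del: of_real_mult of_real_diff)
      also have "\<dots> = cmod (fourier g \<xi>) * (\<bar>\<xi>\<bar> powr p * riesz_const p)"
        by (simp only: integral_mult_right_zero riesz_scaling(2))
      also have "\<dots> = riesz_const p * cmod (of_real (\<bar>\<xi>\<bar> powr p) * fourier g \<xi>)"
        by (simp add: norm_mult)
      finally show ?thesis .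
    qed
    show "integrable lborel (\<lambda>\<xi>. LINT z|lborel. norm (case (\<xi>, z) of (\<xi>, z) \<Rightarrow> ?G \<xi> z))"
      unfolding eq by (intro integrable_mult_right integrable_norm integrable_powr_schwartz F)
    show "AE \<xi> in lborel. integrable lborel (\<lambda>z. case (\<xi>, z) of (\<xi>, z) \<Rightarrow> ?G \<xi> z)"
      unfolding prod.case
      by (intro AE_I2 integrable_mult_right integrable_of_real riesz_scaling(1))
  qed (simp add: case_prod_beta')
  have "of_real (riesz_const p) * abs_D_powr p g x =
      (LINT \<xi>|lborel. fourier g \<xi> * wave x \<xi> * of_real (\<bar>\<xi>\<bar> powr p * riesz_const p)) / of_real (2 * pi)"
    unfolding abs_D_powr_def inv_fourier_def
    by (simp add: mult_ac flip: integral_mult_right_zero)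
  also have "\<dots> = (LINT \<xi>|lborel. LINT z|lborel. ?G \<xi> z) / of_real (2 * pi)"
    unfolding riesz_scaling(2)[symmetric]
    by (simp only: integral_mult_right_zero integral_complex_of_real)
  also have "\<dots> = (LINT z|lborel. LINT \<xi>|lborel. ?G \<xi> z) / of_real (2 * pi)"
    by (simp only: lborel_pair.Fubini_integral[OF int])
  also have "\<dots> = (LINT z|lborel. of_real (riesz_kernel p z) * (g x - (g (x + z) + g (x - z)) / 2))"
  proof (subst integral_divide_zero[symmetric], intro Bochner_Integration.integral_cong refl)
    fix z
    let ?e = "\<lambda>y \<xi>. fourier g \<xi> * wave y \<xi>"
    have inv: "(LINT \<xi>|lborel. ?e y \<xi>) = of_real (2 * pi) * g y" for y
      using fourier_inversion[OF g, of y] by (simp add: inv_fourier_def field_simps)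
    have i: "integrable lborel (?e y)" for y
      using fourier_integrable(2)[OF schwartz_integrable[OF F], of y] by (simp add: mult_ac)
    have cos: "of_real (cos (\<xi> * z)) = (wave z \<xi> + nwave z \<xi>) / 2" for \<xi>
      using cos_exp_eq[of "of_real (\<xi> * z)"] by (simp add: mult_ac flip: cos_of_real)
    have "?G \<xi> z = of_real (riesz_kernel p z) * (?e x \<xi> - (?e (x + z) \<xi> + ?e (x - z) \<xi>) / 2)" for \<xi>
    proof -
      have "wave (x + z) \<xi> = wave x \<xi> * wave z \<xi>"
        "wave (x - z) \<xi> = wave x \<xi> * nwave z \<xi>"
        by (simp_all flip: exp_add add: algebra_simps)
      then show ?thesis
        unfolding of_real_mult of_real_diff cos by (simp only: of_real_1) (simp add: field_simps)
    qed
    then have "(LINT \<xi>|lborel. ?G \<xi> z) = of_real (riesz_kernel p z) *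
        ((LINT \<xi>|lborel. ?e x \<xi>) - ((LINT \<xi>|lborel. ?e (x + z) \<xi>) + (LINT \<xi>|lborel. ?e (x - z) \<xi>)) / 2)"
      by (simp only: integral_mult_right_zero integral_divide_zero Bochner_Integration.integral_add[OF i i]
          Bochner_Integration.integral_diff[OF i integrable_divide[OF Bochner_Integration.integrable_add[OF i i]]])
    also have "\<dots> = of_real (2 * pi) * (of_real (riesz_kernel p z) * (g x - (g (x + z) + g (x - z)) / 2))"
      unfolding inv by (simp add: field_simps)
    finally show "(LINT \<xi>|lborel. ?G \<xi> z) / of_real (2 * pi) = of_real (riesz_kernel p z) * (g x - (g (x + z) + g (x - z)) / 2)"
      by (simp only:) simp
  qed
  finally show ?thesis .
qed

text \<open>Of the second difference only \<open>g (x + z)\<close> survives, since \<open>g\<close>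
  vanishes at \<open>x\<close> and to its left. The remaining factor \<open>- 1 / 2\<close> accounts
  for the sign and the 2 in the constant.\<close>

lemma abs_D_powr_left:
  assumes g: "g \<in> schwartz" and x: "\<And>y. y \<le> x \<Longrightarrow> g y = 0"
  shows "abs_D_powr p g x = - (1 / (2 * of_real (riesz_const p))) * (LINT y|lborel. of_real ((y - x) powr (- 1 - p)) * g y)"
proof -
  have "of_real (riesz_const p) * abs_D_powr p g x =
    (LINT z|lborel. of_real (riesz_kernel p z) * (g x - (g (x + z) + g (x - z)) / 2))"
    by (rule abs_D_powr_eq[OF g])
  also have "\<dots> = (LINT z|lborel. - (1 / 2) * (of_real ((x + 1 * z - x) powr (- 1 - p)) * g (x + 1 * z)))"
    by (intro Bochner_Integration.integral_cong refl) (auto simp: riesz_kernel_def x indicator_def)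
  also have "\<dots> = - (1 / 2) * (LINT y|lborel. of_real ((y - x) powr (- 1 - p)) * g y)"
    unfolding integral_mult_right_zero
    using lborel_integral_real_affine[of 1 "\<lambda>y. of_real ((y - x) powr (- 1 - p)) * g y" x] by simp
  finally show ?thesis using riesz_const_pos by (simp add: field_simps)
qed

end

section \<open>Iterated difference quotients and Bernstein polynomials\<close>

text \<open>The values lie in an arbitrary real vector space because the operator is applied both to
  the complex potential and, under the integral, to the real kernel.\<close>

primrec diff_quotient :: "real \<Rightarrow> nat \<Rightarrow> (real \<Rightarrow> 'a::real_vector) \<Rightarrow> real \<Rightarrow> 'a" where
  "diff_quotient h 0 f x = f x"
| "diff_quotient h (Suc k) f x = (1 / h) *\<^sub>R (diff_quotient h k f (x + h) - diff_quotient h k f x)"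

lemma diff_quotient_bound:
  fixes f :: "real \<Rightarrow> 'a::real_normed_vector"
  assumes "h > 0" "\<And>x. x0 \<le> x \<Longrightarrow> x \<le> x1 \<Longrightarrow> norm (f x) \<le> S"
  shows "x0 \<le> x \<Longrightarrow> x + k * h \<le> x1 \<Longrightarrow> norm (diff_quotient h k f x) \<le> (2 / h) ^ k * S"
proof (induction k arbitrary: x)
  case (Suc k)
  have "norm (diff_quotient h k f (x + h)) \<le> (2 / h) ^ k * S" "norm (diff_quotient h k f x) \<le> (2 / h) ^ k * S"
    using Suc assms(1) by (simp_all add: algebra_simps)
  then have "norm (diff_quotient h k f (x + h) - diff_quotient h k f x) \<le> 2 * ((2 / h) ^ k * S)"
    by (intro order_trans[OF norm_triangle_ineq4]) linarith
  then have "(1 / h) * norm (diff_quotient h k f (x + h) - diff_quotient h k f x) \<le> (1 / h) * (2 * ((2 / h) ^ k * S))"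
    using assms(1) by (intro mult_left_mono) auto
  then show ?case using assms(1) by (simp only: diff_quotient.simps norm_scaleR) simp
qed (use assms in simp)

lemma diff_quotient_integral:
  fixes K :: "'b \<Rightarrow> real \<Rightarrow> real" and g :: "'b \<Rightarrow> complex"
  assumes "h > 0"
    and "\<And>x. x0 \<le> x \<Longrightarrow> x \<le> x1 \<Longrightarrow> integrable M (\<lambda>y. g y * of_real (K y x))"
    and "\<And>x. x0 \<le> x \<Longrightarrow> x \<le> x1 \<Longrightarrow> f x = (LINT y|M. g y * of_real (K y x))"
  shows "x0 \<le> x \<Longrightarrow> x + k * h \<le> x1 \<Longrightarrow>
    integrable M (\<lambda>y. g y * of_real (diff_quotient h k (K y) x)) \<and>
    diff_quotient h k f x = (LINT y|M. g y * of_real (diff_quotient h k (K y) x))"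
proof (induction k arbitrary: x)
  case (Suc k)
  have 1: "integrable M (\<lambda>y. g y * of_real (diff_quotient h k (K y) (x + h)))"
      "diff_quotient h k f (x + h) = (LINT y|M. g y * of_real (diff_quotient h k (K y) (x + h)))"
      "integrable M (\<lambda>y. g y * of_real (diff_quotient h k (K y) x))"
      "diff_quotient h k f x = (LINT y|M. g y * of_real (diff_quotient h k (K y) x))"
    using Suc.IH[of "x + h"] Suc.IH[of x] Suc.prems assms(1) by (simp_all add: algebra_simps)
  have eq: "(\<lambda>y. g y * of_real (diff_quotient h (Suc k) (K y) x)) = (\<lambda>y. (1 / h) *\<^sub>R
      (g y * of_real (diff_quotient h k (K y) (x + h)) - g y * of_real (diff_quotient h k (K y) x)))"
    by (simp add: fun_eq_iff scaleR_conv_of_real algebra_simps)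
  show ?case unfolding eq
    using 1 by simp
qed (use assms in simp)

text \<open>The error is linear in \<open>h\<close> and involves just one derivative beyond the
  approximated one. The induction keeps \<open>j\<close> arbitrary: the derivative of the error for
  \<open>F j\<close> is the error for \<open>F (Suc j)\<close>, to which the hypothesis of induction
  applies.\<close>

lemma diff_quotient_approx:
  assumes h: "h > 0"
    and F: "\<And>j x. x \<le> x1 \<Longrightarrow> (F j has_real_derivative F (Suc j) x) (at x)"
    and B: "\<And>j x. x \<le> x1 \<Longrightarrow> \<bar>F j x\<bar> \<le> B j"
  shows "x + k * h \<le> x1 \<Longrightarrow> \<bar>diff_quotient h k (F j) x - F (j + k) x\<bar> \<le> k * h * B (j + k + 1)"
proof (induction k arbitrary: j x)
  case (Suc k)
  have x: "x + h + k * h \<le> x1" using Suc.prems by (simp add: algebra_simps)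
  have xh: "x + h \<le> x1" using x h by (smt (verit) mult_nonneg_nonneg of_nat_0_le_iff)
  have "B j \<ge> 0" for j using B[of x1 j] by linarith
  \<comment> \<open>Difference quotients commute with differentiation.\<close>
  have dq: "(diff_quotient h k (F j) has_real_derivative diff_quotient h k (F (Suc j)) z) (at z)"
    if "z + k * h \<le> x1" for z
    using that
  proof (induction k arbitrary: z)
    case 0
    then show ?case using F by simp
  next
    case (Suc k)
    have 1: "(diff_quotient h k (F j) has_real_derivative diff_quotient h k (F (Suc j)) (z + h)) (at (z + h))"
      by (rule Suc.IH) (use Suc.prems in \<open>simp add: algebra_simps\<close>)
    have 2: "(diff_quotient h k (F j) has_real_derivative diff_quotient h k (F (Suc j)) z) (at z)"
      by (rule Suc.IH) (use Suc.prems h in \<open>simp add: algebra_simps\<close>)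
    have 3: "((\<lambda>x. diff_quotient h k (F j) (x + h)) has_real_derivative diff_quotient h k (F (Suc j)) (z + h)) (at z)"
      using DERIV_shift[of "diff_quotient h k (F j)" _ z h] 1 by simp
    show ?case
      using DERIV_cmult[OF DERIV_diff[OF 3 2], of "1 / h"] by (simp add: fun_eq_iff)
  qed
  let ?b = "B (j + k + 2)"
  \<comment> \<open>The error of order \<open>k\<close>. Its difference quotient is small by the
    mean value theorem; what is left is the first-order error for the exact derivative
    \<open>F (j + k)\<close>.\<close>
  define w where "w z = diff_quotient h k (F j) z - F (j + k) z" for z
  have w: "(w has_real_derivative diff_quotient h k (F (Suc j)) z - F (Suc (j + k)) z) (at z)"
    if "z \<le> x + h" for z
  proof -
    have "z + k * h \<le> x1" using that x by simp
    moreover from this have "z \<le> x1" using h by (smt (verit) mult_nonneg_nonneg of_nat_0_le_iff)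
    ultimately show ?thesis unfolding w_def[abs_def] by (intro DERIV_diff dq F)
  qed
  have "norm (w (x + h) - w x) \<le> (k * h * ?b) * norm (x + h - x)"
  proof (rule field_differentiable_bound[of "{x..x + h}"])
    fix z assume z: "z \<in> {x..x + h}"
    show "(w has_real_derivative diff_quotient h k (F (Suc j)) z - F (Suc (j + k)) z) (at z within {x..x + h})"
      using w[of z] z by (auto intro: has_field_derivative_at_within)
    show "norm (diff_quotient h k (F (Suc j)) z - F (Suc (j + k)) z) \<le> k * h * ?b"
      using Suc.IH[of z "Suc j"] z x by simp
  qed (use h in auto)
  then have 1: "\<bar>(w (x + h) - w x) / h\<bar> \<le> k * h * ?b" using h by (simp add: abs_divide field_simps)
  have "norm (F (j + k) (x + h) - F (j + k) x - F (Suc (j + k)) x * ((x + h) - x)) \<le> (h * ?b) * norm (x + h - x)"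
  proof -
    \<comment> \<open>Subtracting the linear part leaves a function whose derivative is a difference
      of values of \<open>F (Suc (j + k))\<close>, itself at most \<open>h * ?b\<close>. This is a
      Taylor bound by two mean value estimates.\<close>
    define u where "u z = F (j + k) z - F (Suc (j + k)) x * z" for z
    have "norm (u (x + h) - u x) \<le> (h * ?b) * norm (x + h - x)"
    proof (rule field_differentiable_bound[of "{x..x + h}"])
      fix z assume z: "z \<in> {x..x + h}"
      have "(u has_real_derivative F (Suc (j + k)) z - F (Suc (j + k)) x * 1) (at z)"
        unfolding u_def[abs_def] using z xh by (intro DERIV_diff F DERIV_cmult DERIV_ident) auto
      then show "(u has_real_derivative F (Suc (j + k)) z - F (Suc (j + k)) x) (at z within {x..x + h})"
        by (auto intro: has_field_derivative_at_within)
      have "norm (F (Suc (j + k)) z - F (Suc (j + k)) x) \<le> ?b * norm (z - x)"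
      proof (rule field_differentiable_bound[of "{x..z}"])
        fix y assume y: "y \<in> {x..z}"
        then have "y \<le> x1" using z xh by simp
        then show "(F (Suc (j + k)) has_real_derivative F (j + k + 2) y) (at y within {x..z})"
          using F[of y "Suc (j + k)"] by (auto intro: has_field_derivative_at_within)
        show "norm (F (j + k + 2) y) \<le> ?b" using B[OF \<open>y \<le> x1\<close>] by simp
      qed (use z in auto)
      also have "\<dots> \<le> ?b * h" using z \<open>B (j + k + 2) \<ge> 0\<close> by (intro mult_left_mono) auto
      finally show "norm (F (Suc (j + k)) z - F (Suc (j + k)) x) \<le> h * ?b" by (simp add: mult.commute)
    qed (use h in auto)
    then show ?thesis by (simp add: u_def algebra_simps)
  qed
  then have 2: "\<bar>(F (j + k) (x + h) - F (j + k) x) / h - F (Suc (j + k)) x\<bar> \<le> h * ?b"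
  proof -
    have "(F (j + k) (x + h) - F (j + k) x) / h - F (Suc (j + k)) x =
      (F (j + k) (x + h) - F (j + k) x - F (Suc (j + k)) x * ((x + h) - x)) / h" using h by (simp add: field_simps)
    also have "\<bar>\<dots>\<bar> \<le> h * ?b"
      using \<open>norm _ \<le> (h * ?b) * norm (x + h - x)\<close> h unfolding abs_divide
      by (subst pos_divide_le_eq) auto
    finally show ?thesis .
  qed
  have "diff_quotient h (Suc k) (F j) x - F (j + Suc k) x =
     (w (x + h) - w x) / h + ((F (j + k) (x + h) - F (j + k) x) / h - F (Suc (j + k)) x)"
    using h by (simp add: w_def field_simps)
  then have "\<bar>diff_quotient h (Suc k) (F j) x - F (j + Suc k) x\<bar> \<le> k * h * ?b + h * ?b" using 1 2 by linarith
  then show ?case by (simp add: algebra_simps)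
qed simp

text \<open>The successive derivatives in \<open>x\<close> of the kernel are Pochhammer multiples of
  decreasing powers of \<open>y - x\<close>. They are positive and increase with \<open>x\<close>,
  so their values at \<open>x1\<close> bound them on the whole half-line.\<close>

lemma powr_kernel_diff_quotient:
  fixes p :: real
  assumes p: "p > 0" and h: "h > 0" and x1: "x1 < y" and x: "x + k * h \<le> x1"
  shows "\<bar>diff_quotient h k (\<lambda>x. (y - x) powr (- 1 - p)) x - pochhammer (1 + p) k * (y - x) powr (- 1 - p - k)\<bar>
    \<le> k * h * (pochhammer (1 + p) (Suc k) * (y - x1) powr (- 2 - p - k))"
proof -
  define F where "F j x = pochhammer (1 + p) j * (y - x) powr (- 1 - p - real j)" for j x
  define B where "B j = pochhammer (1 + p) j * (y - x1) powr (- 1 - p - real j)" for j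
  have P: "pochhammer (1 + p) j > 0" for j using p by (intro pochhammer_pos) simp
  have F: "(F j has_real_derivative F (Suc j) x) (at x)" if "x \<le> x1" for j x
  proof -
    have "((\<lambda>x. (y - x) powr (- 1 - p - real j)) has_real_derivative
        (- 1 - p - real j) * (y - x) powr (- 1 - p - real j - of_nat 1) * (0 - 1)) (at x)"
      by (rule DERIV_fun_powr[OF DERIV_diff[OF DERIV_const DERIV_ident]]) (use that x1 in simp)
    from DERIV_cmult[OF this, of "pochhammer (1 + p) j"]
    have "(F j has_real_derivative pochhammer (1 + p) j * ((- 1 - p - real j) * (y - x) powr (- 1 - p - real j - of_nat 1) * (0 - 1))) (at x)"
      by (simp only: F_def[abs_def])
    moreover have "pochhammer (1 + p) j * ((- 1 - p - real j) * (y - x) powr (- 1 - p - real j - of_nat 1) * (0 - 1)) = F (Suc j) x"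
      by (simp add: F_def pochhammer_rec' algebra_simps)
    ultimately show ?thesis by simp
  qed
  have B: "\<bar>F j x\<bar> \<le> B j" if "x \<le> x1" for j x
  proof -
    have "(y - x) powr (- 1 - p - real j) \<le> (y - x1) powr (- 1 - p - real j)"
      using that x1 p by (intro powr_mono2') auto
    then show ?thesis using P[of j] by (simp add: F_def B_def abs_mult)
  qed
  have "F 0 = (\<lambda>x. (y - x) powr (- 1 - p))" by (simp add: F_def fun_eq_iff)
  moreover have "B (Suc k) = pochhammer (1 + p) (Suc k) * (y - x1) powr (- 2 - p - k)"
  proof -
    have "- 1 - p - real (Suc k) = - 2 - p - real k" by simp
    then show ?thesis by (simp only: B_def)
  qed
  ultimately show ?thesis
    using diff_quotient_approx[of h x1 F B, OF h F B x, of 0] by (simp add: F_def)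
qed

section \<open>Quantitative Bernstein approximation and moments\<close>

lemma sum_square_diff_Bernstein:
  assumes "n > 0"
  shows "(\<Sum>k\<le>n. (x - k / n)\<^sup>2 * Bernstein n k x) = x * (1 - x) / n"
proof -
  have "(x - k / n)\<^sup>2 * Bernstein n k x = x\<^sup>2 * Bernstein n k x + (1 / n - 2 * x) / n * (k * Bernstein n k x)
      + 1 / (real n)\<^sup>2 * (k * (real k - 1) * Bernstein n k x)" for k
    using assms by (simp add: field_simps power2_eq_square)
  then have "(\<Sum>k\<le>n. (x - k / n)\<^sup>2 * Bernstein n k x) =
      x\<^sup>2 * (\<Sum>k\<le>n. Bernstein n k x) + (1 / n - 2 * x) / n * (\<Sum>k\<le>n. k * Bernstein n k x)
      + 1 / (real n)\<^sup>2 * (\<Sum>k\<le>n. k * (real k - 1) * Bernstein n k x)"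
    by (simp only: sum.distrib sum_distrib_left)
  also have "\<dots> = x * (1 - x) / n"
    unfolding sum_Bernstein sum_k_Bernstein sum_kk_Bernstein
    using assms by (simp add: field_simps power2_eq_square)
  finally show ?thesis .
qed

text \<open>When \<open>sqrt d\<close> exceeds \<open>1 / n\<close>, multiplying it by the cube of
  \<open>n * sqrt d \<ge> 1\<close> gives \<open>n ^ 3 * d\<^sup>2\<close>. The square root is thus
  traded for a square, whose Bernstein average is the binomial variance.\<close>

lemma sqrt_le_square:
  assumes "d \<ge> 0" "n > 0"
  shows "sqrt d \<le> 1 / n + n ^ 3 * d\<^sup>2"
proof (cases "sqrt d \<le> 1 / n")
  case True
  then show ?thesis using assms by (simp add: add_increasing2)
next
  case False
  let ?u = "sqrt d"
  have "1 \<le> n * ?u" using False assms by (simp add: field_simps)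
  then have "1 ^ 3 \<le> (n * ?u) ^ 3" by (intro power_mono) auto
  then have "?u * 1 \<le> ?u * (n * ?u) ^ 3" using assms by (intro mult_left_mono) auto
  also have "\<dots> = n ^ 3 * ((?u * ?u) * (?u * ?u))" by (simp add: power_mult_distrib power3_eq_cube mult_ac)
  also have "\<dots> = n ^ 3 * d\<^sup>2" using assms by (simp add: power2_eq_square)
  finally show ?thesis using assms by (simp add: add_increasing)
qed

text \<open>The degree \<open>n ^ 4\<close> balances the two terms of \<open>sqrt_le_square\<close>:
  the variance is \<open>t * (1 - t) / n ^ 4\<close>, which times \<open>n ^ 3\<close> is at most
  \<open>1 / n\<close>, the size of the other term.\<close>

lemma Bernstein_holder_approx:
  fixes H :: "real \<Rightarrow> complex"
  assumes n: "n > 0" and t: "0 \<le> t" "t \<le> 1" and "L \<ge> 0"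
    and H: "\<And>s. 0 \<le> s \<Longrightarrow> s \<le> 1 \<Longrightarrow> cmod (H t - H s) \<le> L * sqrt \<bar>t - s\<bar>"
  shows "cmod (H t - (\<Sum>k\<le>n^4. H (k / real (n^4)) * of_real (Bernstein (n^4) k t))) \<le> 2 * L / n"
proof -
  let ?N = "n^4"
  have N: "?N > 0" using n by simp
  have "of_real (\<Sum>k\<le>?N. Bernstein ?N k t) = (1::complex)" by (simp only: sum_Bernstein) simp
  then have "H t = (\<Sum>k\<le>?N. H t * of_real (Bernstein ?N k t))" by (simp flip: sum_distrib_left of_real_sum)
  then have "H t - (\<Sum>k\<le>?N. H (k / real ?N) * of_real (Bernstein ?N k t)) =
     (\<Sum>k\<le>?N. (H t - H (k / real ?N)) * of_real (Bernstein ?N k t))"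
    by (simp add: left_diff_distrib sum_subtractf)
  also have "cmod \<dots> \<le> (\<Sum>k\<le>?N. L * (1 / n + n ^ 3 * (t - k / real ?N)\<^sup>2) * Bernstein ?N k t)"
  proof (rule sum_norm_le)
    fix k assume k: "k \<in> {..?N}"
    then have "0 \<le> k / real ?N" "k / real ?N \<le> 1" using N by (auto simp: divide_simps simp flip: of_nat_power)
    from H[OF this] have "cmod (H t - H (k / real ?N)) \<le> L * sqrt \<bar>t - k / real ?N\<bar>" .
    also have "\<dots> \<le> L * (1 / n + n ^ 3 * (t - k / real ?N)\<^sup>2)"
      using sqrt_le_square[of "\<bar>t - k / real ?N\<bar>" n] n \<open>L \<ge> 0\<close> by (intro mult_left_mono) auto
    finally have "cmod (H t - H (k / real ?N)) \<le> L * (1 / n + n ^ 3 * (t - k / real ?N)\<^sup>2)" .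
    from mult_right_mono[OF this Bernstein_nonneg[OF t, of ?N k]]
    show "cmod ((H t - H (k / real ?N)) * of_real (Bernstein ?N k t))
      \<le> L * (1 / n + n ^ 3 * (t - k / real ?N)\<^sup>2) * Bernstein ?N k t"
      using Bernstein_nonneg[OF t, of ?N k] by (simp add: norm_mult)
  qed
  also have "\<dots> = L * (1 / n * (\<Sum>k\<le>?N. Bernstein ?N k t) + n ^ 3 * (\<Sum>k\<le>?N. (t - k / real ?N)\<^sup>2 * Bernstein ?N k t))"
    by (simp add: sum_distrib_left sum.distrib[symmetric] algebra_simps del: sum_Bernstein)
  also have "\<dots> = L * (1 / n + n ^ 3 * (t * (1 - t) / real ?N))"
    by (simp only: sum_square_diff_Bernstein[OF N] sum_Bernstein) simp
  also have "n ^ 3 * (t * (1 - t) / real ?N) = t * (1 - t) / n"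
    using n by (simp add: field_simps eval_nat_numeral)
  also have "L * (1 / n + t * (1 - t) / n) \<le> L * (1 / n + 1 / n)"
    using t n \<open>L \<ge> 0\<close> by (intro mult_left_mono add_left_mono divide_right_mono mult_le_one) auto
  finally show ?thesis by (simp add: mult.commute)
qed

text \<open>Expanding the power of \<open>1 - \<tau> y\<close> turns the integral into moments of
  order at most \<open>N\<close>; the absolute values of the binomial coefficients sum to
  \<open>2 ^ (N - k)\<close>.\<close>

lemma Bernstein_integral_bound:
  fixes w :: "'a \<Rightarrow> complex" and \<tau> :: "'a \<Rightarrow> real" and E :: real
  assumes int: "\<And>m. integrable M (\<lambda>y. w y * of_real (\<tau> y ^ m))"
    and E: "\<And>m. m \<le> N \<Longrightarrow> cmod (LINT y|M. w y * of_real (\<tau> y ^ m)) \<le> E"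
    and k: "k \<le> N"
  shows "integrable M (\<lambda>y. w y * of_real (Bernstein N k (\<tau> y)))"
    and "cmod (LINT y|M. w y * of_real (Bernstein N k (\<tau> y))) \<le> real (N choose k) * 2 ^ (N - k) * E"
proof -
  define c :: "nat \<Rightarrow> real" where "c j = real (N choose k) * real ((N - k) choose j) * (- 1) ^ j" for j
  have eq: "w y * of_real (Bernstein N k (\<tau> y)) = (\<Sum>j\<le>N - k. of_real (c j) * (w y * of_real (\<tau> y ^ (k + j))))" for y
  proof -
    have "(1 - \<tau> y) ^ (N - k) = (\<Sum>j\<le>N - k. of_nat ((N - k) choose j) * (- \<tau> y) ^ j * 1 ^ (N - k - j))"
      using binomial_ring[of "- \<tau> y" 1 "N - k"] by simp
    then have "Bernstein N k (\<tau> y) = (\<Sum>j\<le>N - k. c j * \<tau> y ^ (k + j))"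
      by (simp add: c_def Bernstein_def sum_distrib_left power_add power_minus[of "\<tau> y"] mult_ac)
    then show ?thesis
      by (simp only: of_real_sum of_real_mult sum_distrib_left mult_ac)
  qed
  show "integrable M (\<lambda>y. w y * of_real (Bernstein N k (\<tau> y)))"
    unfolding eq by (intro Bochner_Integration.integrable_sum integrable_mult_right int)
  have "(LINT y|M. w y * of_real (Bernstein N k (\<tau> y))) =
    (\<Sum>j\<le>N - k. of_real (c j) * (LINT y|M. w y * of_real (\<tau> y ^ (k + j))))"
    unfolding eq
    by (subst Bochner_Integration.integral_sum) (auto intro!: integrable_mult_right int simp del: of_real_mult of_real_power)
  also have "cmod \<dots> \<le> (\<Sum>j\<le>N - k. real (N choose k) * real ((N - k) choose j) * E)"
  proof (rule sum_norm_le)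
    fix j assume "j \<in> {..N - k}"
    then have "cmod (LINT y|M. w y * of_real (\<tau> y ^ (k + j))) \<le> E" using k by (intro E) auto
    moreover have "cmod (of_real (c j)) = real (N choose k) * real ((N - k) choose j)"
      by (simp only: norm_of_real c_def abs_mult power_abs) simp
    ultimately show "cmod (of_real (c j) * (LINT y|M. w y * of_real (\<tau> y ^ (k + j))))
      \<le> real (N choose k) * real ((N - k) choose j) * E"
      by (simp only: norm_mult) (intro mult_left_mono, auto)
  qed
  also have "\<dots> = real (N choose k) * E * (\<Sum>j\<le>N - k. real ((N - k) choose j))"
    by (simp add: sum_distrib_left mult_ac)
  also have "(\<Sum>j\<le>N - k. real ((N - k) choose j)) = 2 ^ (N - k)"
    by (simp only: of_nat_sum[symmetric] choose_row_sum) simp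
  finally show "cmod (LINT y|M. w y * of_real (Bernstein N k (\<tau> y))) \<le> real (N choose k) * 2 ^ (N - k) * E"
    by (simp add: mult_ac)
qed

text \<open>The factor \<open>3 ^ N\<close> is the binomial sum of
  \<open>(N choose k) * 2 ^ (N - k)\<close>. It measures the instability of recovering a polynomial
  integral from moments.\<close>

lemma Bernstein_sum_integral_bound:
  fixes w :: "'a \<Rightarrow> complex" and \<tau> :: "'a \<Rightarrow> real" and E :: real
  assumes int: "\<And>m. integrable M (\<lambda>y. w y * of_real (\<tau> y ^ m))"
    and E: "\<And>m. m \<le> N \<Longrightarrow> cmod (LINT y|M. w y * of_real (\<tau> y ^ m)) \<le> E"
    and A: "\<And>k. k \<le> N \<Longrightarrow> cmod (c k) \<le> A" and "E \<ge> 0"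
  shows "integrable M (\<lambda>y. w y * (\<Sum>k\<le>N. c k * of_real (Bernstein N k (\<tau> y))))"
    and "cmod (LINT y|M. w y * (\<Sum>k\<le>N. c k * of_real (Bernstein N k (\<tau> y)))) \<le> A * 3 ^ N * E"
proof -
  note B = Bernstein_integral_bound[OF int E]
  have eq: "w y * (\<Sum>k\<le>N. c k * of_real (Bernstein N k (\<tau> y))) = (\<Sum>k\<le>N. c k * (w y * of_real (Bernstein N k (\<tau> y))))" for y
    by (simp add: sum_distrib_left mult_ac)
  show "integrable M (\<lambda>y. w y * (\<Sum>k\<le>N. c k * of_real (Bernstein N k (\<tau> y))))"
    unfolding eq by (intro Bochner_Integration.integrable_sum integrable_mult_right B) auto
  have "(LINT y|M. w y * (\<Sum>k\<le>N. c k * of_real (Bernstein N k (\<tau> y)))) =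
     (\<Sum>k\<le>N. c k * (LINT y|M. w y * of_real (Bernstein N k (\<tau> y))))"
    unfolding eq by (subst Bochner_Integration.integral_sum) (auto intro!: integrable_mult_right B)
  also have "cmod \<dots> \<le> (\<Sum>k\<le>N. A * (real (N choose k) * 2 ^ (N - k) * E))"
    by (rule sum_norm_le) (auto simp: norm_mult intro!: mult_mono A B order_trans[OF norm_ge_zero A])
  also have "\<dots> = A * E * (\<Sum>k\<le>N. of_nat (N choose k) * 1 ^ k * 2 ^ (N - k))"
    by (simp add: sum_distrib_left mult_ac)
  also have "(\<Sum>k\<le>N. real (N choose k) * 1 ^ k * 2 ^ (N - k)) = 3 ^ N"
    by (simp only: binomial_ring[symmetric]) simp
  finally show "cmod (LINT y|M. w y * (\<Sum>k\<le>N. c k * of_real (Bernstein N k (\<tau> y)))) \<le> A * 3 ^ N * E"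
    by (simp add: mult_ac)
qed

section \<open>Recovering a function from its exterior potential\<close>

lemma integrable_square:
  fixes g :: "real \<Rightarrow> complex"
  assumes g: "integrable lborel g" and Q: "\<And>y. cmod (g y) \<le> Q"
  shows "integrable lborel (\<lambda>y. (cmod (g y))\<^sup>2)"
proof (rule integrable_dominated)
  show "integrable lborel (\<lambda>y. Q * cmod (g y))" using g by simp
  show "norm ((cmod (g y))\<^sup>2) \<le> Q * cmod (g y)" for y
    by (simp add: power2_eq_square Q mult_right_mono)
qed (use g in auto)

abbreviation l1_norm :: "(real \<Rightarrow> complex) \<Rightarrow> real" where
  "l1_norm g \<equiv> (LINT y|lborel. cmod (g y))"

abbreviation potential :: "real \<Rightarrow> (real \<Rightarrow> complex) \<Rightarrow> real \<Rightarrow> complex" where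
  "potential p g x \<equiv> (LINT y|lborel. g y * of_real ((y - x) powr (- 1 - p)))"

context
  fixes a b x0 x1 p :: real
  assumes ab: "a < b" and x01: "x0 < x1" and x1a: "x1 < a" and p: "0 < p" "p < 2"
begin

lemma weighted_integrable:
  assumes g: "integrable lborel g" and g0: "\<And>y. y < a \<Longrightarrow> g y = 0" and x: "x \<le> x1"
  shows "integrable lborel (\<lambda>y. g y * of_real ((y - x) powr (- 1 - p)))"
    and "cmod (g y * of_real ((y - x) powr (- 1 - p))) \<le> (a - x1) powr (- 1 - p) * cmod (g y)"
proof -
  have [measurable]: "g \<in> borel_measurable borel" using g by auto
  show le: "cmod (g y * of_real ((y - x) powr (- 1 - p))) \<le> (a - x1) powr (- 1 - p) * cmod (g y)" for y
  proof (cases "y < a")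
    case False
    then have "(y - x) powr (- 1 - p) \<le> (a - x1) powr (- 1 - p)"
      using x x1a p by (intro powr_mono2') auto
    from mult_left_mono[OF this norm_ge_zero[of "g y"]]
    show ?thesis by (simp add: norm_mult mult.commute)
  qed (simp add: g0)
  show "integrable lborel (\<lambda>y. g y * of_real ((y - x) powr (- 1 - p)))"
    by (rule integrable_dominated[OF _ _ le]) (use g in auto)
qed

text \<open>With \<open>d = a - x1\<close> and \<open>P\<close> the Pochhammer factor, the moment is
  \<open>d ^ k / P\<close> times the derivative of order \<open>k\<close> of the potential at
  \<open>x0\<close>. The first term bounds the difference quotient that replaces this derivative,
  the second the error of the replacement.\<close>

lemma moment_bound:
  assumes g: "integrable lborel g" and g0: "\<And>y. y < a \<Longrightarrow> g y = 0"
    and S: "\<And>x. x0 \<le> x \<Longrightarrow> x \<le> x1 \<Longrightarrow> cmod (potential p g x) \<le> S"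
    and h: "h > 0" "k * h \<le> x1 - x0"
  shows "cmod (LINT y|lborel. g y * of_real ((y - x0) powr (- 1 - p)) * of_real (((a - x1) / (y - x0)) ^ k))
    \<le> (2 * (a - x1) / h) ^ k * S + k * (k + 3) * h * (a - x1) powr (- 2 - p) * l1_norm g"
proof -
  define d where "d = a - x1"
  have d: "d > 0" using x1a by (simp add: d_def)
  define G where "G = l1_norm g"
  define K where "K y x = (y - x) powr (- 1 - p)" for y x
  define f where "f x = (LINT y|lborel. g y * of_real (K y x))" for x
  define P where "P = pochhammer (1 + p) k"
  have P1: "P \<ge> 1"
  proof -
    have "(1::real) \<le> fact k" by (simp add: fact_ge_1)
    also have "fact k = pochhammer (1::real) k" by (simp add: pochhammer_fact)
    also have "\<dots> \<le> pochhammer (1 + p) k"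
      unfolding pochhammer_prod using p by (intro prod_mono) auto
    finally show ?thesis by (simp add: P_def)
  qed
  have [measurable]: "g \<in> borel_measurable borel" using g by auto
  note dq = diff_quotient_integral[of h x0 x1 lborel g K f x0 k, OF h(1)]
  have dqi: "integrable lborel (\<lambda>y. g y * of_real (diff_quotient h k (K y) x0))"
    "diff_quotient h k f x0 = (LINT y|lborel. g y * of_real (diff_quotient h k (K y) x0))"
    using dq weighted_integrable(1)[OF g g0] h by (auto simp: f_def K_def)
  have dqb: "cmod (diff_quotient h k f x0) \<le> (2 / h) ^ k * S"
    by (rule diff_quotient_bound[of h x0 x1]) (use h S in \<open>auto simp: f_def K_def\<close>)
  let ?t = "\<lambda>y. g y * of_real (P * (y - x0) powr (- 1 - p - k))"
  have pw: "g y * of_real ((y - x0) powr (- 1 - p)) * of_real ((d / (y - x0)) ^ k) = of_real (d ^ k / P) * ?t y" for y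
  proof (cases "y < a")
    case False
    then have y: "y - x0 > 0" using x1a x01 by simp
    have "(y - x0) powr (- 1 - p - k) = (y - x0) powr (- 1 - p) / (y - x0) ^ k"
      using y by (simp add: powr_diff powr_realpow)
    then have "(y - x0) powr (- 1 - p) * (d / (y - x0)) ^ k = d ^ k / P * (P * (y - x0) powr (- 1 - p - k))"
      using P1 by (simp add: power_divide)
    then have "complex_of_real ((y - x0) powr (- 1 - p)) * of_real ((d / (y - x0)) ^ k)
        = of_real (d ^ k / P) * of_real (P * (y - x0) powr (- 1 - p - k))"
      by (simp only: of_real_mult[symmetric])
    then show ?thesis by (simp only: mult.assoc) (simp only: mult.left_commute)
  qed (simp add: g0)
  have ti: "integrable lborel ?t"
  proof (rule integrable_dominated)
    show "integrable lborel (\<lambda>y. (P * d powr (- 1 - p - k)) * cmod (g y))" using g by simp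
    show "cmod (?t y) \<le> (P * d powr (- 1 - p - k)) * cmod (g y)" for y
    proof (cases "y < a")
      case False
      then have "(y - x0) powr (- 1 - p - k) \<le> d powr (- 1 - p - k)"
        using x01 d p by (intro powr_mono2') (auto simp: d_def)
      then have "cmod (of_real (P * (y - x0) powr (- 1 - p - k))) \<le> P * d powr (- 1 - p - k)"
        using P1 by (simp only: norm_of_real) (simp add: abs_mult)
      then show ?thesis unfolding norm_mult[of "g y"] by (subst mult.commute) (rule mult_right_mono, auto)
    qed (simp add: g0)
  qed simp
  \<comment> \<open>The Pochhammer factor of order \<open>Suc k\<close> is
    \<open>(1 + p + k) * P\<close>. The later division by \<open>P\<close> leaves only
    \<open>1 + p + k\<close>, which is at most \<open>k + 3\<close> as \<open>p < 2\<close>.\<close>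
  let ?c = "k * h * ((1 + p + k) * P * d powr (- 2 - p - k))"
  have "cmod (diff_quotient h k f x0 - (LINT y|lborel. ?t y)) \<le> ?c * G"
  proof -
    have eq: "diff_quotient h k f x0 - (LINT y|lborel. ?t y) = (LINT y|lborel. g y * of_real (diff_quotient h k (K y) x0) - ?t y)"
      using dqi ti by simp
    have "cmod (diff_quotient h k f x0 - (LINT y|lborel. ?t y)) \<le> (LINT y|lborel. ?c * cmod (g y))"
      unfolding eq
    proof (rule Bochner_Integration.integral_norm_bound_integral)
      show "integrable lborel (\<lambda>y. g y * of_real (diff_quotient h k (K y) x0) - ?t y)"
        using dqi(1) ti by (intro Bochner_Integration.integrable_diff)
      show "integrable lborel (\<lambda>y. ?c * cmod (g y))" using g by simp
      fix y
      show "cmod (g y * of_real (diff_quotient h k (K y) x0) - ?t y) \<le> ?c * cmod (g y)"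
      proof (cases "y < a")
        case False
        then have y: "x1 < y" using x1a by simp
        have "\<bar>diff_quotient h k (K y) x0 - P * (y - x0) powr (- 1 - p - k)\<bar>
            \<le> k * h * (pochhammer (1 + p) (Suc k) * (y - x1) powr (- 2 - p - k))"
          unfolding K_def P_def using powr_kernel_diff_quotient[OF p(1) h(1) y, of x0 k] h(2) by simp
        also have "\<dots> \<le> k * h * (pochhammer (1 + p) (Suc k) * d powr (- 2 - p - k))"
          using False d p h by (intro mult_left_mono powr_mono2' mult_nonneg_nonneg pochhammer_nonneg) (auto simp: d_def)
        also have "\<dots> = ?c" by (simp add: pochhammer_rec' P_def)
        finally have le: "\<bar>diff_quotient h k (K y) x0 - P * (y - x0) powr (- 1 - p - k)\<bar> \<le> ?c" .
        have "g y * of_real (diff_quotient h k (K y) x0) - ?t y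
          = g y * of_real (diff_quotient h k (K y) x0 - P * (y - x0) powr (- 1 - p - k))"
          by (simp add: algebra_simps)
        then have "cmod (g y * of_real (diff_quotient h k (K y) x0) - ?t y)
          = cmod (g y) * \<bar>diff_quotient h k (K y) x0 - P * (y - x0) powr (- 1 - p - k)\<bar>"
          by (simp only: norm_mult norm_of_real)
        also have "\<dots> \<le> cmod (g y) * ?c" by (intro mult_left_mono le) simp
        finally show ?thesis by (simp only: mult.commute)
      qed (simp add: g0)
    qed
    also have "\<dots> = ?c * G" unfolding G_def by (rule integral_mult_right_zero)
    finally show ?thesis .
  qed
  then have t: "cmod (LINT y|lborel. ?t y) \<le> (2 / h) ^ k * S + ?c * G"
    using dqb norm_triangle_ineq3[of "diff_quotient h k f x0" "LINT y|lborel. ?t y"] by linarith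
  have S0: "S \<ge> 0" using S[of x0] x01 by (smt (verit) norm_ge_zero)
  have G0: "G \<ge> 0" by (simp add: G_def)
  have "cmod (LINT y|lborel. g y * of_real ((y - x0) powr (- 1 - p)) * of_real ((d / (y - x0)) ^ k))
     = d ^ k / P * cmod (LINT y|lborel. ?t y)"
    unfolding pw integral_mult_right_zero norm_mult norm_of_real using d P1 by (simp del: of_real_mult)
  also have "\<dots> \<le> d ^ k / P * ((2 / h) ^ k * S + ?c * G)"
    using d P1 by (intro mult_left_mono t) auto
  also have "\<dots> = (2 * d / h) ^ k * S / P + k * (1 + p + k) * h * (d ^ k * d powr (- 2 - p - k)) * G"
  proof -
    have alg: "u / P * (v * S + X * P) = (u * v) * S / P + u * X" for u v X
      using P1 by (simp add: distrib_left)
    have "?c * G = (k * (1 + p + k) * h * d powr (- 2 - p - k) * G) * P" by (simp only: mult_ac)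
    moreover have "(2 * d / h) ^ k = d ^ k * (2 / h) ^ k"
      by (simp add: power_mult_distrib[symmetric] mult.commute)
    ultimately show ?thesis by (simp only: alg) (simp only: mult_ac)
  qed
  \<comment> \<open>The powers of \<open>d\<close> that depend on \<open>k\<close> cancel, so apart
    from \<open>h\<close> the error grows only polynomially in \<open>k\<close>. This is why the
    moments are scaled by \<open>a - x1\<close>.\<close>
  also have "d ^ k * d powr (- 2 - p - k) = d powr (- 2 - p)"
    using d by (simp add: powr_realpow powr_diff)
  also have "(2 * d / h) ^ k * S / P + k * (1 + p + k) * h * d powr (- 2 - p) * G
    \<le> (2 * d / h) ^ k * S + k * (k + 3) * h * d powr (- 2 - p) * G"
  proof (intro add_mono mult_right_mono mult_left_mono)
    have "(2 * d / h) ^ k * S \<ge> 0" using d h S0 by simp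
    then show "(2 * d / h) ^ k * S / P \<le> (2 * d / h) ^ k * S"
      using P1 by (simp add: divide_le_eq mult_left_le_one_le) (metis mult.commute mult_left_mono mult.right_neutral)
  qed (use p h G0 in \<open>auto intro!: mult_left_mono\<close>)
  finally show ?thesis by (simp add: d_def G_def)
qed

text \<open>With weight \<open>w\<close> and variable \<open>\<tau> y = d / (y - x0)\<close>, a
  function \<open>H\<close> is built such that \<open>w y * H (\<tau> y)\<close> is the square of
  \<open>cmod (g y)\<close>. Replacing \<open>H\<close> by its Bernstein polynomial costs the first
  term; the integral of the polynomial is a combination of moments and costs the second.
  \<open>C\<close> depends on the geometry and \<open>p\<close> only, which keeps \<open>n\<close>
  and \<open>h\<close> free for the final optimisation.\<close>

lemma l2_norm_le_exterior_potential:
  obtains C where "C > 0" "\<And>g Q S n h. integrable lborel g \<Longrightarrow> (\<And>y. y \<notin> {a..b} \<Longrightarrow> g y = 0) \<Longrightarrow> (\<And>y. cmod (g y) \<le> Q) \<Longrightarrow>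
    (\<And>y z. cmod (g y - g z) \<le> Q * sqrt \<bar>y - z\<bar>) \<Longrightarrow>
    (\<And>x. x0 \<le> x \<Longrightarrow> x \<le> x1 \<Longrightarrow> cmod (potential p g x) \<le> S) \<Longrightarrow>
    n > 0 \<Longrightarrow> h > 0 \<Longrightarrow> real (n ^ 4) * h \<le> x1 - x0 \<Longrightarrow>
    (LINT y|lborel. (cmod (g y))\<^sup>2) \<le> C * Q / real n * l1_norm g +
      C * Q * 3 ^ (n ^ 4) * ((1 + C / h) ^ (n ^ 4) * S + C * real (n ^ 8) * h * l1_norm g)"
proof -
  define d where "d = a - x1"
  define Z where "Z = b - x0"
  \<comment> \<open>On \<open>{a..b}\<close> the distance \<open>y - x0\<close> lies between
    \<open>d\<close> and \<open>Z\<close>, so \<open>\<tau>\<close> takes values in the interval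
    from \<open>t1\<close> to 1.\<close>
  define t1 where "t1 = d / Z"
  have d: "d > 0" using x1a by (simp add: d_def)
  have dZ: "d < Z" using ab x01 by (simp add: d_def Z_def)
  have t1: "0 < t1" "t1 < 1" using d dZ by (auto simp: t1_def)
  define \<Lambda> where "\<Lambda> = d / t1\<^sup>2"
  have \<Lambda>: "\<Lambda> > 0" using d t1 by (simp add: \<Lambda>_def)
  define V where "V = Z powr (1 + p)"
  define V' where "V' = (1 + p) * Z powr p"
  have V: "V > 0" "V' > 0" using d dZ p by (auto simp: V_def V'_def)
  define L where "L = V * sqrt \<Lambda> + V' * \<Lambda>"
  have L: "L > 0" unfolding L_def using V \<Lambda> by (intro add_pos_pos mult_pos_pos) auto
  define C where "C = 2 * d + 2 * L * d powr (- 1 - p) + V + 4 * d powr (- 2 - p)"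
  have C0: "2 * d \<le> C" "2 * L * d powr (- 1 - p) \<le> C" "V \<le> C" "4 * d powr (- 2 - p) \<le> C" "C > 0"
    unfolding C_def using d L V by (auto intro!: add_nonneg_nonneg add_pos_nonneg simp: add_increasing add_increasing2)
  show ?thesis
  proof (rule that)
    show "C > 0" by (rule C0)
    fix g :: "real \<Rightarrow> complex" and Q S :: real and n :: nat and h :: real
    assume g: "integrable lborel g" and g0: "\<And>y. y \<notin> {a..b} \<Longrightarrow> g y = 0" and gQ: "\<And>y. cmod (g y) \<le> Q"
      and gH: "\<And>y z. cmod (g y - g z) \<le> Q * sqrt \<bar>y - z\<bar>"
      and S: "\<And>x. x0 \<le> x \<Longrightarrow> x \<le> x1 \<Longrightarrow> cmod (potential p g x) \<le> S"
      and n: "n > 0" and h: "h > 0" and nh: "real (n ^ 4) * h \<le> x1 - x0"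
    define N where "N = n ^ 4"
    define G where "G = l1_norm g"
    have G: "G \<ge> 0" by (simp add: G_def)
    have Q: "Q \<ge> 0" by (rule order_trans[OF norm_ge_zero gQ])
    have S0: "S \<ge> 0" using order_trans[OF norm_ge_zero S[of x0]] x01 by simp
    have [measurable]: "g \<in> borel_measurable borel" using g by auto
    have g0': "\<And>y. y < a \<Longrightarrow> g y = 0" using g0 by auto
    \<comment> \<open>The inverse of \<open>y - x0 \<mapsto> d / (y - x0)\<close>, frozen below
      \<open>t1\<close>. Bernstein polynomials sample \<open>H\<close> on all of the unit interval,
      so it must be bounded and Hoelder continuous there too; \<open>\<Lambda>\<close> is the
      Lipschitz constant of \<open>z\<close>.\<close>
    define z where "z t = d / max t t1" for t
    define H where "H t = cnj (g (x0 + z t)) * of_real (z t powr (1 + p))" for t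
    have z: "d \<le> z t" "z t \<le> Z" if "t \<le> 1" for t
    proof -
      have m: "t1 \<le> max t t1" "max t t1 \<le> 1" "max t t1 > 0" using that t1 by auto
      show "d \<le> z t" unfolding z_def using m d by (subst pos_le_divide_eq) auto
      have "d / max t t1 \<le> d / t1" using m d t1 by (intro divide_left_mono) auto
      also have "d / t1 = Z" using d dZ by (simp add: t1_def)
      finally show "z t \<le> Z" by (simp add: z_def)
    qed
    have zL: "\<bar>z t - z s\<bar> \<le> \<Lambda> * \<bar>t - s\<bar>" for t s
    proof -
      let ?u = "max t t1" and ?v = "max s t1"
      have uv: "?u \<ge> t1" "?v \<ge> t1" "?u > 0" "?v > 0" using t1 by auto
      have "z t - z s = d * (?v - ?u) / (?u * ?v)" using uv by (simp add: z_def field_simps)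
      then have "\<bar>z t - z s\<bar> = d * \<bar>?v - ?u\<bar> / (?u * ?v)" using d uv by (simp add: abs_mult)
      also have "\<dots> \<le> d * \<bar>?v - ?u\<bar> / (t1 * t1)"
        using d t1 uv by (intro divide_left_mono mult_mono mult_pos_pos) auto
      also have "\<dots> \<le> d * \<bar>t - s\<bar> / (t1 * t1)"
        using d t1 by (intro divide_right_mono mult_left_mono) auto
      finally show ?thesis by (simp add: \<Lambda>_def power2_eq_square)
    qed
    have pL: "\<bar>u powr (1 + p) - v powr (1 + p)\<bar> \<le> V' * \<bar>u - v\<bar>" if "d \<le> u" "u \<le> Z" "d \<le> v" "v \<le> Z" for u v
    proof -
      have "norm (u powr (1 + p) - v powr (1 + p)) \<le> V' * norm (u - v)"
      proof (rule field_differentiable_bound[of "{d..Z}"])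
        fix y assume y: "y \<in> {d..Z}"
        have "((\<lambda>x. x powr (1 + p)) has_real_derivative (1 + p) * y powr (1 + p - 1)) (at y)"
          using y d by (intro has_real_derivative_powr) auto
        then show "((\<lambda>x. x powr (1 + p)) has_real_derivative (1 + p) * y powr p) (at y within {d..Z})"
          by (auto intro: has_field_derivative_at_within)
        have "y powr p \<le> Z powr p" using y d p by (intro powr_mono2) auto
        then show "norm ((1 + p) * y powr p) \<le> V'" using p by (simp add: V'_def abs_mult)
      qed (use that in auto)
      then show ?thesis by simp
    qed
    have HQ: "cmod (H t) \<le> Q * V" if "t \<le> 1" for t
    proof -
      have "z t powr (1 + p) \<le> V" unfolding V_def using z[OF that] d p by (intro powr_mono2) auto
      then show ?thesis using gQ Q by (simp add: H_def norm_mult mult_mono)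
    qed
    have HL: "cmod (H t - H s) \<le> Q * L * sqrt \<bar>t - s\<bar>" if "0 \<le> t" "t \<le> 1" "0 \<le> s" "s \<le> 1" for t s
    proof -
      have "H t - H s = cnj (g (x0 + z t) - g (x0 + z s)) * of_real (z t powr (1 + p))
         + cnj (g (x0 + z s)) * of_real (z t powr (1 + p) - z s powr (1 + p))"
        by (simp add: H_def algebra_simps)
      then have "cmod (H t - H s) \<le> cmod (g (x0 + z t) - g (x0 + z s)) * z t powr (1 + p)
         + cmod (g (x0 + z s)) * \<bar>z t powr (1 + p) - z s powr (1 + p)\<bar>"
        by (metis (no_types, opaque_lifting) complex_mod_cnj norm_mult norm_of_real norm_triangle_ineq powr_ge_zero abs_of_nonneg)
      also have "\<dots> \<le> (Q * (sqrt \<Lambda> * sqrt \<bar>t - s\<bar>)) * V + Q * (V' * (\<Lambda> * sqrt \<bar>t - s\<bar>))"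
      proof (intro add_mono mult_mono)
        have "cmod (g (x0 + z t) - g (x0 + z s)) \<le> Q * sqrt \<bar>x0 + z t - (x0 + z s)\<bar>" by (rule gH)
        also have "\<dots> \<le> Q * sqrt (\<Lambda> * \<bar>t - s\<bar>)" using zL[of t s] Q by (intro mult_left_mono) auto
        finally show "cmod (g (x0 + z t) - g (x0 + z s)) \<le> Q * (sqrt \<Lambda> * sqrt \<bar>t - s\<bar>)"
          by (simp add: real_sqrt_mult)
        show "z t powr (1 + p) \<le> V" unfolding V_def using z[of t] that d p by (intro powr_mono2) auto
        \<comment> \<open>On the unit interval a Lipschitz bound implies the Hoelder bound of order
          one half, which lets the smooth factor of \<open>H\<close> be treated like
          \<open>g\<close>.\<close>
        have "\<bar>t - s\<bar> \<le> sqrt \<bar>t - s\<bar>"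
        proof (rule real_le_rsqrt)
          have "\<bar>t - s\<bar> * \<bar>t - s\<bar> \<le> \<bar>t - s\<bar>" using that by (intro mult_left_le) auto
          then show "\<bar>t - s\<bar>\<^sup>2 \<le> \<bar>t - s\<bar>" by (simp only: power2_eq_square)
        qed
        then have "\<bar>z t - z s\<bar> \<le> \<Lambda> * sqrt \<bar>t - s\<bar>"
          using zL[of t s] \<Lambda> by (meson mult_left_mono order_trans less_imp_le)
        then show "\<bar>z t powr (1 + p) - z s powr (1 + p)\<bar> \<le> V' * (\<Lambda> * sqrt \<bar>t - s\<bar>)"
          using pL[of "z t" "z s"] z[of t] z[of s] that V by (meson mult_left_mono order_trans less_imp_le)
      qed (use gQ Q \<Lambda> in auto)
      also have "\<dots> = Q * L * sqrt \<bar>t - s\<bar>" by (simp add: L_def algebra_simps)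
      finally show ?thesis .
    qed
    define w where "w y = g y * of_real ((y - x0) powr (- 1 - p))" for y
    define \<tau> where "\<tau> y = d / (y - x0)" for y
    define B where "B t = (\<Sum>k\<le>N. H (k / real N) * of_real (Bernstein N k t))" for t
    have \<tau>: "0 \<le> \<tau> y" "\<tau> y \<le> 1" "w y * H (\<tau> y) = of_real ((cmod (g y))\<^sup>2)" if "y \<in> {a..b}" for y
    proof -
      have y: "d \<le> y - x0" "y - x0 \<le> Z" "y - x0 > 0" using that x1a x01 by (auto simp: d_def Z_def)
      show "0 \<le> \<tau> y" "\<tau> y \<le> 1" using y d by (auto simp: \<tau>_def)
      have "t1 \<le> \<tau> y" unfolding t1_def \<tau>_def using y d by (intro divide_left_mono mult_pos_pos) auto
      then have "z (\<tau> y) = y - x0" using y d by (simp add: z_def max_absorb1 \<tau>_def)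
      then have "w y * H (\<tau> y) = g y * cnj (g y) * of_real ((y - x0) powr (- 1 - p) * (y - x0) powr (1 + p))"
        by (simp add: w_def H_def)
      also have "(y - x0) powr (- 1 - p) * (y - x0) powr (1 + p) = 1"
        using y by (simp flip: powr_add)
      finally show "w y * H (\<tau> y) = of_real ((cmod (g y))\<^sup>2)"
        by (simp only: of_real_1 mult_1_right complex_norm_square)
    qed
    have w0: "y \<notin> {a..b} \<Longrightarrow> w y = 0" for y using g0 by (simp add: w_def)
    have wH: "w y * H (\<tau> y) = of_real ((cmod (g y))\<^sup>2)" for y
      by (cases "y \<in> {a..b}") (use \<tau>(3) w0 g0 in auto)
    have wi: "integrable lborel w" and wle: "cmod (w y) \<le> d powr (- 1 - p) * cmod (g y)" for y
      using weighted_integrable[OF g g0', of x0] x01 by (auto simp: w_def[abs_def] d_def)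
    have [measurable]: "w \<in> borel_measurable borel" using wi by auto
    have \<tau>m [measurable]: "\<tau> \<in> borel_measurable borel" unfolding \<tau>_def[abs_def] by measurable
    have wm: "integrable lborel (\<lambda>y. w y * of_real (\<tau> y ^ m))" for m
    proof (rule integrable_dominated[OF _ integrable_norm[OF wi]])
      show "cmod (w y * of_real (\<tau> y ^ m)) \<le> cmod (w y)" for y
      proof (cases "y \<in> {a..b}")
        case True
        then have "\<bar>\<tau> y ^ m\<bar> \<le> 1" using \<tau>[of y] by (simp add: power_abs power_le_one)
        then show ?thesis by (simp only: norm_mult norm_of_real mult_left_le norm_ge_zero)
      qed (simp add: w0)
    qed simp
    define E where "E = (1 + C / h) ^ N * S + C * real (n ^ 8) * h * G"
    have E0: "E \<ge> 0" unfolding E_def using C0 h S0 G by (intro add_nonneg_nonneg mult_nonneg_nonneg zero_le_power) auto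
    have E: "cmod (LINT y|lborel. w y * of_real (\<tau> y ^ m)) \<le> E" if "m \<le> N" for m
    proof -
      have mN: "real m \<le> real N" using that by simp
      have "real m * h \<le> x1 - x0"
      proof -
        have "real m * h \<le> real N * h" by (rule mult_right_mono[OF mN]) (use h in simp)
        then show ?thesis using nh by (simp only: N_def)
      qed
      then have "cmod (LINT y|lborel. w y * of_real (\<tau> y ^ m))
        \<le> (2 * d / h) ^ m * S + m * (m + 3) * h * d powr (- 2 - p) * G"
        using moment_bound[OF g g0' _ h, of S m] S by (simp add: w_def \<tau>_def d_def G_def)
      also have "\<dots> \<le> (1 + C / h) ^ N * S + 4 * d powr (- 2 - p) * real (n ^ 8) * h * G"
      proof (rule add_mono)
        \<comment> \<open>The base is enlarged by 1 so that it is at least 1 and the exponent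
          \<open>m\<close> can be raised to \<open>N\<close>.\<close>
        have "(2 * d / h) ^ m \<le> (1 + C / h) ^ m"
          using d h C0(1) by (intro power_mono add_increasing divide_right_mono) auto
        also have "\<dots> \<le> (1 + C / h) ^ N"
          using C0 h that by (intro power_increasing) auto
        finally show "(2 * d / h) ^ m * S \<le> (1 + C / h) ^ N * S" using S0 by (rule mult_right_mono)
        \<comment> \<open>For \<open>m = 0\<close> the left side vanishes; otherwise
          \<open>m + 3 \<le> 4 * m\<close>.\<close>
        have "m * (m + 3) \<le> N * (4 * N)"
        proof (cases "m = 0")
          case False
          then show ?thesis using that by (intro mult_mono) auto
        qed simp
        also have "N * (4 * N) = 4 * n ^ 8" by (simp add: N_def flip: power_add)
        finally have "real (m * (m + 3)) \<le> 4 * real (n ^ 8)" by (metis of_nat_le_iff of_nat_mult of_nat_numeral)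
        then have "real (m * (m + 3)) * (h * d powr (- 2 - p) * G) \<le> (4 * real (n ^ 8)) * (h * d powr (- 2 - p) * G)"
          using h G by (intro mult_right_mono) auto
        then show "m * (m + 3) * h * d powr (- 2 - p) * G \<le> 4 * d powr (- 2 - p) * real (n ^ 8) * h * G"
          by (simp add: mult_ac)
      qed
      also have "4 * d powr (- 2 - p) * real (n ^ 8) * h * G \<le> C * real (n ^ 8) * h * G"
        using C0(4) h G by (intro mult_right_mono) auto
      finally show ?thesis by (simp add: E_def)
    qed
    have Hk: "cmod (H (k / real N)) \<le> Q * V" if "k \<le> N" for k
      by (rule HQ) (use that in \<open>auto simp: divide_le_eq\<close>)
    note BI = Bernstein_sum_integral_bound[OF wm E Hk E0]
    have BI1: "integrable lborel (\<lambda>y. w y * B (\<tau> y))"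
      and BI2: "cmod (LINT y|lborel. w y * B (\<tau> y)) \<le> Q * V * 3 ^ N * E"
      using BI by (simp_all add: B_def)
    have g2: "integrable lborel (\<lambda>y. (cmod (g y))\<^sup>2)"
      by (rule integrable_square[OF g gQ])
    have wHi: "integrable lborel (\<lambda>y. w y * H (\<tau> y))" unfolding wH using g2 by (rule integrable_of_real)
    have diff: "cmod ((LINT y|lborel. w y * H (\<tau> y)) - (LINT y|lborel. w y * B (\<tau> y))) \<le> C * Q / n * G"
    proof -
      have eq: "(LINT y|lborel. w y * H (\<tau> y)) - (LINT y|lborel. w y * B (\<tau> y)) = (LINT y|lborel. w y * H (\<tau> y) - w y * B (\<tau> y))"
        using wHi BI1 by simp
      have "cmod ((LINT y|lborel. w y * H (\<tau> y)) - (LINT y|lborel. w y * B (\<tau> y))) \<le> (LINT y|lborel. (C * Q / n) * cmod (g y))"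
        unfolding eq
      proof (rule Bochner_Integration.integral_norm_bound_integral)
        show "integrable lborel (\<lambda>y. w y * H (\<tau> y) - w y * B (\<tau> y))"
          using wHi BI1 by (intro Bochner_Integration.integrable_diff)
        show "integrable lborel (\<lambda>y. (C * Q / n) * cmod (g y))" using g by simp
        fix y
        show "cmod (w y * H (\<tau> y) - w y * B (\<tau> y)) \<le> (C * Q / n) * cmod (g y)"
        proof (cases "y \<in> {a..b}")
          case True
          have "cmod (H (\<tau> y) - B (\<tau> y)) \<le> 2 * (Q * L) / n"
            unfolding B_def N_def using \<tau>[OF True] n Q L by (intro Bernstein_holder_approx HL) auto
          then have "cmod (w y) * cmod (H (\<tau> y) - B (\<tau> y)) \<le> (d powr (- 1 - p) * cmod (g y)) * (2 * (Q * L) / n)"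
            by (intro mult_mono wle) auto
          also have "\<dots> = (2 * L * d powr (- 1 - p)) * (Q / n * cmod (g y))" by (simp add: mult_ac)
          also have "\<dots> \<le> C * (Q / n * cmod (g y))" using Q by (intro mult_right_mono C0) auto
          finally show ?thesis by (simp add: norm_mult flip: right_diff_distrib)
        qed (use w0 g0 in auto)
      qed
      also have "\<dots> = C * Q / n * G" unfolding G_def by (rule integral_mult_right_zero)
      finally show ?thesis .
    qed
    have "(LINT y|lborel. (cmod (g y))\<^sup>2) = cmod (LINT y|lborel. w y * H (\<tau> y))"
      unfolding wH integral_complex_of_real norm_of_real by simp
    also have "\<dots> \<le> C * Q / n * G + Q * V * 3 ^ N * E"
      using diff BI2 norm_triangle_ineq2[of "LINT y|lborel. w y * H (\<tau> y)" "LINT y|lborel. w y * B (\<tau> y)"] by linarith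
    also have "\<dots> \<le> C * Q / n * G + C * Q * 3 ^ N * E"
    proof -
      have "V * (Q * 3 ^ N * E) \<le> C * (Q * 3 ^ N * E)" using Q E0 by (intro mult_right_mono C0) auto
      then show ?thesis by (simp add: mult_ac)
    qed
    finally show "(LINT y|lborel. (cmod (g y))\<^sup>2) \<le> C * Q / real n * l1_norm g +
      C * Q * 3 ^ (n ^ 4) * ((1 + C / h) ^ (n ^ 4) * S + C * real (n ^ 8) * h * l1_norm g)"
      by (simp only: G_def N_def E_def)
  qed
qed

end

section \<open>Membership in Sobolev spaces and mollified distributions\<close>

text \<open>A Dynkin argument: open intervals are stable under intersection and generate the Borel
  sets. The total integral is a separate hypothesis because complements require it and the line is
  not a bounded interval.\<close>

lemma AE_zero_of_interval_integrals:
  fixes f :: "real \<Rightarrow> complex"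
  assumes f: "integrable lborel f" and total: "(LINT x|lborel. f x) = 0"
    and int: "\<And>a b. (LINT x|lborel. indicator {a<..<b} x *\<^sub>R f x) = 0"
  shows "AE x in lborel. f x = 0"
proof (rule sigma_finite_measure.density_zero[OF lborel.sigma_finite_measure_axioms f])
  fix A :: "real set" assume "A \<in> sets lborel"
  let ?E = "range (\<lambda>(a, b). {a<..<b::real})"
  have "Int_stable ?E"
  proof (rule Int_stableI)
    fix S T assume "S \<in> ?E" "T \<in> ?E"
    then obtain a b c d where "S = {a<..<b}" "T = {c<..<d}" by auto
    then have "S \<inter> T = {max a c<..<min b d}" by auto
    then show "S \<inter> T \<in> ?E" by auto
  qed
  moreover have "?E \<subseteq> Pow UNIV" by simp
  moreover have "A \<in> sigma_sets UNIV ?E"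
    using \<open>A \<in> sets lborel\<close> by (simp add: borel_eq_box box_real)
  ultimately have "A \<in> sets borel \<and> (LINT x|lborel. indicator A x *\<^sub>R f x) = 0"
  proof (induction rule: sigma_sets_induct_disjoint)
    case (basic S)
    then show ?case using int by auto
  next
    case empty
    then show ?case by simp
  next
    case (compl S)
    have "(LINT x|lborel. indicator (- S) x *\<^sub>R f x) = (LINT x|lborel. f x - indicator S x *\<^sub>R f x)"
      by (intro Bochner_Integration.integral_cong refl) (auto simp: indicator_def)
    also have "\<dots> = 0"
      using compl f total by (subst Bochner_Integration.integral_diff) (auto intro!: integrable_mult_indicator)
    finally show ?case using compl borel_comp[of S] by (auto simp: Compl_eq_Diff_UNIV)
  next
    case (union S)
    have "set_integrable lborel (\<Union>i. S i) f"
      unfolding set_integrable_def by (rule integrable_mult_indicator) (use f union in auto)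
    moreover have "S i \<in> sets lborel" for i using union by auto
    moreover have "S i \<inter> S j = {}" if "i \<noteq> j" for i j
      using union(1) that by (auto simp: disjoint_family_on_def)
    ultimately have "set_lebesgue_integral lborel (\<Union>i. S i) f = (\<Sum>i. set_lebesgue_integral lborel (S i) f)"
      by (intro lebesgue_integral_countable_add) auto
    then show ?case using union by (auto simp: set_lebesgue_integral_def)
  qed
  then show "set_lebesgue_integral lborel A f = 0" by (simp add: set_lebesgue_integral_def)
qed

text \<open>For growing \<open>k\<close> these cutoffs vanish outside the open interval and tend to
  1 inside it, staying below 1. They approximate its indicator by Schwartz functions.\<close>

lemma smooth_interval_cutoff:
  "(\<lambda>x. of_real (step_fun (real k * (x - a)) * step_fun (real k * (b - x)))) \<in> schwartz"
proof -
  have "smooth (\<lambda>x. complex_of_real (step_fun (real k * (x - a)) * step_fun (real k * (b - x))))"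
    using smooth_mult[OF smooth_affine[OF smooth_exp_inverse_poly[of 1], of "real k" "- real k * a"]
        smooth_affine[OF smooth_exp_inverse_poly[of 1], of "- real k" "real k * b"]]
    by (simp add: algebra_simps)
  moreover have "step_fun (real k * (x - a)) * step_fun (real k * (b - x)) = 0" if "x \<notin> {a..b}" for x
  proof -
    have "real k * (x - a) \<le> 0 \<or> real k * (b - x) \<le> 0" using that by (auto simp: mult_le_0_iff)
    then show ?thesis by (auto simp: step_fun_bounds)
  qed
  ultimately have "(\<lambda>x. complex_of_real (step_fun (real k * (x - a)) * step_fun (real k * (b - x)))) \<in> test_functions UNIV"
    by (intro test_functionsI[of _ "{a..b}"]) auto
  then show ?thesis using test_functions_schwartz by blast
qed

lemma step_fun_tendsto: "t > 0 \<Longrightarrow> (\<lambda>k. step_fun (real k * t)) \<longlonglongrightarrow> 1"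
proof -
  assume t: "t > 0"
  have "(\<lambda>k. exp (- (1 / (real k * t)))) \<longlonglongrightarrow> 1" using t by real_asymp
  moreover have "\<forall>\<^sub>F k in sequentially. exp (- (1 / (real k * t))) = step_fun (real k * t)"
    using t by (intro eventually_sequentiallyI[of 1]) (auto simp: exp_inverse_poly_def)
  ultimately show ?thesis by (rule Lim_transform_eventually)
qed

lemma step_fun_measurable [measurable]: "step_fun \<in> borel_measurable borel"
  by (intro borel_measurable_continuous_onI continuous_at_imp_continuous_on ballI
      DERIV_isCont[OF exp_inverse_poly_derivative])

text \<open>Square integrability gives integrability on bounded intervals only, through
  \<open>cmod (h x) \<le> 1 + (cmod (h x))\<^sup>2\<close>. Hence the argument runs on each interval
  from \<open>- real n\<close> to \<open>real n\<close> before the countable union is taken.\<close>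

lemma AE_zero_of_schwartz_pairing:
  assumes [measurable]: "h \<in> borel_measurable borel" and h2: "integrable lborel (\<lambda>x. (cmod (h x))\<^sup>2)"
    and 0: "\<And>\<phi>. \<phi> \<in> schwartz \<Longrightarrow> (LINT x|lborel. h x * \<phi> x) = 0"
  shows "AE x in lborel. h x = 0"
proof -
  have loc: "integrable lborel (\<lambda>x. indicator {a<..<b} x *\<^sub>R h x)" for a b
  proof (rule integrable_dominated)
    show "integrable lborel (\<lambda>x. indicator {a<..<b} x + (cmod (h x))\<^sup>2)"
      using h2 emeasure_bounded_finite[of "{a<..<b}"]
      by (intro Bochner_Integration.integrable_add) auto
    have "cmod (h x) \<le> 1 + (cmod (h x))\<^sup>2" for x
      using sum_squares_bound[of 1 "cmod (h x)"] norm_ge_zero[of "h x"] unfolding one_power2 mult_1_right by linarith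
    then show "norm (indicator {a<..<b} x *\<^sub>R h x) \<le> indicator {a<..<b} x + (cmod (h x))\<^sup>2" for x
      by (auto simp: indicator_def)
  qed simp
  have int: "(LINT x|lborel. indicator {a<..<b} x *\<^sub>R h x) = 0" for a b
  proof -
    let ?\<phi> = "\<lambda>k x. complex_of_real (step_fun (real k * (x - a)) * step_fun (real k * (b - x)))"
    have "(\<lambda>k. LINT x|lborel. h x * ?\<phi> k x) \<longlonglongrightarrow> (LINT x|lborel. indicator {a<..<b} x *\<^sub>R h x)"
    proof (rule integral_dominated_convergence)
      show "integrable lborel (\<lambda>x. cmod (indicator {a<..<b} x *\<^sub>R h x))" using loc by (rule integrable_norm)
      have z: "?\<phi> k x = 0" if "x \<notin> {a<..<b}" for k x
      proof -
        have "real k * (x - a) \<le> 0 \<or> real k * (b - x) \<le> 0" using that by (auto simp: mult_le_0_iff not_less)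
        then show ?thesis by (auto simp: step_fun_bounds)
      qed
      show "AE x in lborel. (\<lambda>k. h x * ?\<phi> k x) \<longlonglongrightarrow> indicator {a<..<b} x *\<^sub>R h x"
      proof (rule AE_I2)
        fix x
        show "(\<lambda>k. h x * ?\<phi> k x) \<longlonglongrightarrow> indicator {a<..<b} x *\<^sub>R h x"
        proof (cases "x \<in> {a<..<b}")
          case True
          then have "(\<lambda>k. h x * ?\<phi> k x) \<longlonglongrightarrow> h x * of_real (1 * 1)"
            by (intro tendsto_intros step_fun_tendsto) auto
          then show ?thesis using True by simp
        qed (simp add: z del: of_real_mult)
      qed
      show "AE x in lborel. norm (h x * ?\<phi> k x) \<le> cmod (indicator {a<..<b} x *\<^sub>R h x)" for k
      proof (rule AE_I2)
        fix x
        have "norm (?\<phi> k x) \<le> 1"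
          unfolding norm_of_real abs_mult using step_fun_bounds by (intro mult_le_one) auto
        then show "norm (h x * ?\<phi> k x) \<le> cmod (indicator {a<..<b} x *\<^sub>R h x)"
          using z[of x k] by (cases "x \<in> {a<..<b}") (auto simp: norm_mult mult_left_le simp del: of_real_mult)
      qed
    qed simp_all
    moreover have "(LINT x|lborel. h x * ?\<phi> k x) = 0" for k by (rule 0[OF smooth_interval_cutoff])
    ultimately have "(\<lambda>k. 0) \<longlonglongrightarrow> (LINT x|lborel. indicator {a<..<b} x *\<^sub>R h x)" by (simp only:)
    then show ?thesis unfolding LIMSEQ_const_iff by (rule sym)
  qed
  have "AE x in lborel. indicator {- real n<..<real n} x *\<^sub>R h x = 0" for n
  proof (rule AE_zero_of_interval_integrals[OF loc int])
    fix a b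
    have "indicator {a<..<b} x *\<^sub>R indicator {- real n<..<real n} x *\<^sub>R h x = indicator {max a (- real n)<..<min b (real n)} x *\<^sub>R h x" for x
      by (auto simp: indicator_def)
    then show "(LINT x|lborel. indicator {a<..<b} x *\<^sub>R indicator {- real n<..<real n} x *\<^sub>R h x) = 0"
      by (simp only: int)
  qed
  then have "AE x in lborel. \<forall>n. indicator {- real n<..<real n} x *\<^sub>R h x = 0"
    by (simp only: AE_all_countable) simp
  then show ?thesis
  proof eventually_elim
    case (elim x)
    obtain n where "\<bar>x\<bar> < real n" using reals_Archimedean2 by blast
    then have "x \<in> {- real n<..<real n}" by auto
    then show ?case using elim[rule_format, of n] by simp
  qed
qed

text \<open>\<open>sobolev_norm\<close> uses a density picked by \<open>SOME\<close>, so even for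
  the zero distribution that density must be shown to vanish almost everywhere. The case
  \<open>g = 0\<close> of the theorem rests on this.\<close>

lemma sobolev_norm_zero:
  assumes \<rho>: "\<rho> \<ge> 0" and T: "distribution_of (\<lambda>_. 0) \<in> sobolev \<rho>"
  shows "sobolev_norm \<rho> (distribution_of (\<lambda>_. 0)) = 0"
proof -
  obtain h where h: "fourier_density \<rho> (distribution_of (\<lambda>_. 0)) h"
    and norm: "sobolev_norm \<rho> (distribution_of (\<lambda>_. 0)) = l2_norm_on UNIV (sobolev_weighted \<rho> h)"
    using sobolev_density[OF T] by blast
  have [measurable]: "h \<in> borel_measurable borel" using h by (simp add: fourier_density_def)
  have "AE x in lborel. h x = 0"
  proof (rule AE_zero_of_schwartz_pairing)
    show "(LINT x|lborel. h x * \<phi> x) = 0" if "\<phi> \<in> schwartz" for \<phi>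
    proof -
      have "fourier_distribution (distribution_of (\<lambda>_. 0)) \<phi> = distribution_of h \<phi>"
        using h by (simp add: fourier_density_def)
      then show ?thesis using that schwartz_fourier[OF that]
        by (simp add: fourier_distribution_def distribution_of_def)
    qed
    have i: "integrable lborel (\<lambda>x. (cmod (sobolev_weighted \<rho> h x))\<^sup>2)"
      using h by (simp add: fourier_density_def square_integrable_def)
    show "integrable lborel (\<lambda>x. (cmod (h x))\<^sup>2)"
    proof (rule integrable_dominated[OF _ i])
      fix x
      have "1 \<le> (1 + x\<^sup>2) powr (\<rho> / 2)" using \<rho> by (intro ge_one_powr_ge_zero) auto
      from mult_right_mono[OF this norm_ge_zero[of "h x"]]
      have "cmod (h x) \<le> cmod (sobolev_weighted \<rho> h x)" by (simp add: sobolev_weighted_def norm_mult)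
      then show "norm ((cmod (h x))\<^sup>2) \<le> (cmod (sobolev_weighted \<rho> h x))\<^sup>2" by (simp add: power_mono)
    qed simp
  qed simp
  then have "AE x in lborel. (cmod (sobolev_weighted \<rho> h x))\<^sup>2 = 0"
    by eventually_elim (simp add: sobolev_weighted_def)
  then have "(LINT x|lborel. (cmod (sobolev_weighted \<rho> h x))\<^sup>2) = 0"
    by (rule integral_eq_zero_AE)
  then show ?thesis by (simp add: norm l2_norm_on_def set_lebesgue_integral_def)
qed

lemma square_integrable_of_schwartz:
  assumes [measurable]: "f \<in> borel_measurable borel" and \<psi>: "\<psi> \<in> schwartz"
    and le: "\<And>\<xi>. cmod (f \<xi>) \<le> (1 + \<xi>\<^sup>2) * cmod (\<psi> \<xi>)"
  shows "square_integrable f"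
proof -
  have S: "(\<lambda>x. 1 * \<psi> x + 1 * (of_real x * (of_real x * \<psi> x))) \<in> schwartz"
    by (intro schwartz_lincomb schwartz_times \<psi>)
  obtain B where B: "B \<ge> 0"
    "\<And>x. cmod (1 * \<psi> x + 1 * (of_real x * (of_real x * \<psi> x))) \<le> B * inverse (1 + x\<^sup>2)"
    using schwartz_inverse_square_bound[OF S] by blast
  have f: "cmod (f x) \<le> B * inverse (1 + x\<^sup>2)" for x
  proof -
    have "1 * \<psi> x + 1 * (of_real x * (of_real x * \<psi> x)) = of_real (1 + x\<^sup>2) * \<psi> x"
      by (simp add: algebra_simps power2_eq_square)
    then have "(1 + x\<^sup>2) * cmod (\<psi> x) \<le> B * inverse (1 + x\<^sup>2)"
      using B(2)[of x] by (simp only: norm_mult norm_of_real) (simp add: abs_of_nonneg)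
    then show ?thesis using le[of x] by linarith
  qed
  have "integrable lborel (\<lambda>x. (cmod (f x))\<^sup>2)"
  proof (rule integrable_dominated)
    show "integrable lborel (\<lambda>x::real. B\<^sup>2 * inverse (1 + x\<^sup>2))"
      by (intro integrable_mult_right integrable_inverse_square)
    fix x
    have "(cmod (f x))\<^sup>2 \<le> (B * inverse (1 + x\<^sup>2))\<^sup>2" by (intro power_mono f) simp
    also have "\<dots> = B\<^sup>2 * (inverse (1 + x\<^sup>2) * inverse (1 + x\<^sup>2))" by (simp add: power2_eq_square mult_ac)
    also have "\<dots> \<le> B\<^sup>2 * (inverse (1 + x\<^sup>2) * 1)"
      by (intro mult_left_mono) (auto simp: inverse_le_1_iff add_nonneg_nonneg)
    finally show "norm ((cmod (f x))\<^sup>2) \<le> B\<^sup>2 * inverse (1 + x\<^sup>2)" by simp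
  qed simp
  then show ?thesis by (simp add: square_integrable_def)
qed

lemma schwartz_in_sobolev:
  assumes g: "g \<in> schwartz" and \<rho>: "\<rho> \<le> 2"
  shows "distribution_of g \<in> sobolev \<rho>"
proof -
  note F = schwartz_fourier[OF g]
  have [measurable]: "fourier g \<in> borel_measurable borel" using schwartz_measurable[OF F] .
  have "square_integrable (sobolev_weighted \<rho> (fourier g))"
  proof (rule square_integrable_of_schwartz[OF _ F])
    show "sobolev_weighted \<rho> (fourier g) \<in> borel_measurable borel"
      unfolding sobolev_weighted_def[abs_def] by measurable
    fix \<xi> :: real
    have "(1 + \<xi>\<^sup>2) powr (\<rho> / 2) \<le> (1 + \<xi>\<^sup>2) powr 1" using \<rho> by (intro powr_mono) auto
    from mult_right_mono[OF this norm_ge_zero[of "fourier g \<xi>"]]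
    show "cmod (sobolev_weighted \<rho> (fourier g) \<xi>) \<le> (1 + \<xi>\<^sup>2) * cmod (fourier g \<xi>)"
      by (simp add: sobolev_weighted_def norm_mult abs_of_nonneg)
  qed
  then have "distribution_of (inv_fourier (fourier g)) \<in> sobolev \<rho>"
    by (intro inv_fourier_in_sobolev schwartz_integrable F)
  moreover have "inv_fourier (fourier g) = g" using fourier_inversion[OF g] by (rule ext)
  ultimately show ?thesis by simp
qed

text \<open>The symbol is not smooth at the origin, so the function need not be Schwartz and its
  density is exhibited directly. Symbol and weight together stay below
  \<open>1 + \<xi>\<^sup>2\<close>, which the Schwartz transform absorbs.\<close>

lemma abs_D_powr_in_sobolev:
  assumes g: "g \<in> schwartz" and p: "0 < p" "p < 2" and \<rho>: "\<rho> \<le> 0"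
  shows "distribution_of (abs_D_powr p g) \<in> sobolev \<rho>"
proof -
  note F = schwartz_fourier[OF g]
  have [measurable]: "fourier g \<in> borel_measurable borel" using schwartz_measurable[OF F] .
  have "square_integrable (sobolev_weighted \<rho> (\<lambda>\<xi>. of_real (\<bar>\<xi>\<bar> powr p) * fourier g \<xi>))"
  proof (rule square_integrable_of_schwartz[OF _ F])
    show "sobolev_weighted \<rho> (\<lambda>\<xi>. of_real (\<bar>\<xi>\<bar> powr p) * fourier g \<xi>) \<in> borel_measurable borel"
      unfolding sobolev_weighted_def[abs_def] by measurable
    fix \<xi> :: real
    have "(1 + \<xi>\<^sup>2) powr (\<rho> / 2) \<le> (1 + \<xi>\<^sup>2) powr 0" using \<rho> by (intro powr_mono) auto
    then have "(1 + \<xi>\<^sup>2) powr (\<rho> / 2) \<le> 1" by (simp add: add_nonneg_eq_0_iff split: if_splits)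
    then have "(1 + \<xi>\<^sup>2) powr (\<rho> / 2) * \<bar>\<xi>\<bar> powr p \<le> 1 * (1 + \<xi>\<^sup>2)"
      using p powr_le_one_plus_square[of p \<xi>] by (intro mult_mono) auto
    from mult_right_mono[OF this norm_ge_zero[of "fourier g \<xi>"]]
    show "cmod (sobolev_weighted \<rho> (\<lambda>\<xi>. of_real (\<bar>\<xi>\<bar> powr p) * fourier g \<xi>) \<xi>) \<le> (1 + \<xi>\<^sup>2) * cmod (fourier g \<xi>)"
      by (simp add: sobolev_weighted_def norm_mult mult_ac)
  qed
  then show ?thesis unfolding abs_D_powr_def
    by (intro inv_fourier_in_sobolev integrable_powr_schwartz F p)
qed

section \<open>Mollified values of Sobolev distributions\<close>

lemma mollifier_approx:
  fixes f :: "real \<Rightarrow> complex"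
  assumes r: "r > 0" and [measurable]: "f \<in> borel_measurable borel"
    and e: "\<And>y. \<bar>y - c\<bar> \<le> r \<Longrightarrow> cmod (f y - v) \<le> e"
  shows "cmod ((LINT y|lborel. f y * of_real (mollifier c r y)) - v) \<le> e"
proof -
  note m = mollifier_integrable[OF r, of c]
  have [measurable]: "mollifier c r \<in> borel_measurable borel" using m by auto
  have le: "cmod ((f y - v) * of_real (mollifier c r y)) \<le> e * mollifier c r y" for y
  proof (cases "\<bar>y - c\<bar> \<le> r")
    case True
    then show ?thesis using e[OF True] mollifier_nonneg[OF r, of c y] by (simp add: norm_mult mult_right_mono)
  next
    case False
    then show ?thesis using mollifier_zero[OF r, of y c] by simp
  qed
  have i: "integrable lborel (\<lambda>y. (f y - v) * of_real (mollifier c r y))"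
    by (rule integrable_dominated[OF _ _ le]) (use m in auto)
  have iv: "integrable lborel (\<lambda>y. v * of_real (mollifier c r y))" using m by simp
  have "(LINT y|lborel. f y * of_real (mollifier c r y))
    = (LINT y|lborel. (f y - v) * of_real (mollifier c r y) + v * of_real (mollifier c r y))"
    by (simp add: algebra_simps)
  also have "\<dots> = (LINT y|lborel. (f y - v) * of_real (mollifier c r y)) + v"
    using i iv mollifier_integral[OF r, of c] by simp
  finally have eq: "(LINT y|lborel. f y * of_real (mollifier c r y)) - v = (LINT y|lborel. (f y - v) * of_real (mollifier c r y))"
    by simp
  have "cmod ((LINT y|lborel. f y * of_real (mollifier c r y)) - v) \<le> (LINT y|lborel. e * mollifier c r y)"
    unfolding eq
    by (rule Bochner_Integration.integral_norm_bound_integral) (use i m le in auto)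
  also have "\<dots> = e" using mollifier_integral[OF r, of c] by simp
  finally show ?thesis .
qed

definition cauchy_mass :: real where
  "cauchy_mass = (LINT x|lborel. inverse (1 + x\<^sup>2))"

lemma cauchy_mass_nonneg: "cauchy_mass \<ge> 0"
  by (simp add: cauchy_mass_def)

lemma sobolev_pairing_bound:
  assumes h: "fourier_density \<rho> T h" and norm: "sobolev_norm \<rho> T = l2_norm_on UNIV (sobolev_weighted \<rho> h)"
    and [measurable]: "\<psi> \<in> borel_measurable borel"
    and k: "integrable lborel k" and le: "\<And>\<xi>. (1 + \<xi>\<^sup>2) powr (- \<rho>) * (cmod (\<psi> \<xi>))\<^sup>2 \<le> k \<xi>"
  shows "integrable lborel (\<lambda>\<xi>. h \<xi> * \<psi> \<xi>)"
    and "cmod (LINT \<xi>|lborel. h \<xi> * \<psi> \<xi>) \<le> sobolev_norm \<rho> T * sqrt (LINT \<xi>|lborel. k \<xi>)"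
proof -
  have i: "integrable lborel (\<lambda>\<xi>. (1 + \<xi>\<^sup>2) powr (- \<rho>) * (cmod (\<psi> \<xi>))\<^sup>2)"
    by (rule integrable_dominated[OF _ k]) (use le in simp_all)
  note P = fourier_density_pairing[OF h, of \<psi>, OF _ i]
  show "integrable lborel (\<lambda>\<xi>. h \<xi> * \<psi> \<xi>)" by (rule P) simp
  have "cmod (LINT \<xi>|lborel. h \<xi> * \<psi> \<xi>) \<le> (LINT \<xi>|lborel. cmod (h \<xi> * \<psi> \<xi>))"
    by (rule integral_norm_bound)
  also have "\<dots> \<le> sobolev_norm \<rho> T * sqrt (LINT \<xi>|lborel. (1 + \<xi>\<^sup>2) powr (- \<rho>) * (cmod (\<psi> \<xi>))\<^sup>2)"
    using P(2) by (simp add: norm)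
  also have "\<dots> \<le> sobolev_norm \<rho> T * sqrt (LINT \<xi>|lborel. k \<xi>)"
    by (intro mult_left_mono real_sqrt_le_mono integral_mono i k le sobolev_norm_nonneg)
  finally show "cmod (LINT \<xi>|lborel. h \<xi> * \<psi> \<xi>) \<le> sobolev_norm \<rho> T * sqrt (LINT \<xi>|lborel. k \<xi>)" .
qed

text \<open>The transform of the mollifier decays like the inverse of
  \<open>1 + (r * \<xi>)\<^sup>2\<close>, which is at least
  \<open>r\<^sup>2 * (1 + \<xi>\<^sup>2)\<close> for \<open>r \<le> 1\<close>. Its square beats the
  weight of order \<open>s \<le> 1\<close>, at the price of \<open>1 / r\<^sup>2\<close>. The
  constant is uniform in the centre and in the extension.\<close>

lemma sobolev_mollifier_negative:
  "\<exists>C\<ge>0. \<forall>s T c r. 0 \<le> s \<longrightarrow> s \<le> 1 \<longrightarrow> T \<in> sobolev (- s) \<longrightarrow> 0 < r \<longrightarrow> r \<le> 1 \<longrightarrow>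
    cmod (T (cmollifier c r)) \<le> C / r\<^sup>2 * sobolev_norm (- s) T"
proof -
  have s0: "inv_fourier (cmollifier 0 1) \<in> schwartz"
    by (intro schwartz_inv_fourier mollifier_schwartz) simp
  define \<psi>0 where "\<psi>0 = inv_fourier (cmollifier 0 1)"
  obtain B where B: "B \<ge> 0" "\<And>x. cmod (\<psi>0 x) \<le> B * inverse (1 + x\<^sup>2)"
    using schwartz_inverse_square_bound[OF s0] unfolding \<psi>0_def by metis
  show ?thesis
  proof (intro exI[of _ "B * sqrt cauchy_mass"] conjI allI impI)
    show "B * sqrt cauchy_mass \<ge> 0" using B cauchy_mass_nonneg by simp
    fix s T c and r :: real
    assume s: "0 \<le> s" "s \<le> 1" and T: "T \<in> sobolev (- s)" and r: "0 < r" "r \<le> 1"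
    define \<psi> where "\<psi> = inv_fourier (cmollifier c r)"
    have \<psi>S: "\<psi> \<in> schwartz" unfolding \<psi>_def by (intro schwartz_inv_fourier mollifier_schwartz r)
    have [measurable]: "\<psi> \<in> borel_measurable borel" using schwartz_measurable[OF \<psi>S] .
    obtain h where h: "fourier_density (- s) T h" and norm: "sobolev_norm (- s) T = l2_norm_on UNIV (sobolev_weighted (- s) h)"
      using sobolev_density[OF T] by blast
    have le: "(1 + \<xi>\<^sup>2) powr s * (cmod (\<psi> \<xi>))\<^sup>2 \<le> (B / r\<^sup>2)\<^sup>2 * inverse (1 + \<xi>\<^sup>2)" for \<xi>
    proof -
      let ?u = "1 + \<xi>\<^sup>2"
      have u: "?u > 0" "?u \<ge> 1" by (auto simp: add_pos_nonneg)
      have "r\<^sup>2 \<le> 1" using r by (simp add: power_le_one)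
      then have "r\<^sup>2 * ?u \<le> 1 + (r * \<xi>)\<^sup>2" by (simp add: power_mult_distrib distrib_left)
      then have "inverse (1 + (r * \<xi>)\<^sup>2) \<le> inverse (r\<^sup>2 * ?u)" using r u(1) by (intro le_imp_inverse_le mult_pos_pos) simp_all
      then have "B * inverse (1 + (r * \<xi>)\<^sup>2) \<le> B * inverse (r\<^sup>2 * ?u)" using B by (intro mult_left_mono) auto
      moreover have "cmod (\<psi> \<xi>) = cmod (\<psi>0 (r * \<xi>))"
        using inv_fourier_mollifier[OF r(1), of c \<xi>] by (simp add: \<psi>_def \<psi>0_def norm_mult)
      ultimately have "cmod (\<psi> \<xi>) \<le> B * inverse (r\<^sup>2 * ?u)" using B(2)[of "r * \<xi>"] by linarith
      then have "(cmod (\<psi> \<xi>))\<^sup>2 \<le> (B / r\<^sup>2 * inverse ?u)\<^sup>2"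
        by (intro power_mono) (simp_all add: field_simps)
      moreover have "?u powr s \<le> ?u" using powr_mono[of s 1 ?u] s u by simp
      ultimately have "?u powr s * (cmod (\<psi> \<xi>))\<^sup>2 \<le> ?u * (B / r\<^sup>2 * inverse ?u)\<^sup>2"
        using u by (intro mult_mono) auto
      also have "\<dots> = (B / r\<^sup>2)\<^sup>2 * inverse ?u * (?u * inverse ?u)"
        by (simp only: power2_eq_square mult_ac)
      also have "?u * inverse ?u = 1" using u(1) by (intro right_inverse) linarith
      finally show ?thesis by simp
    qed
    have ci: "integrable lborel (\<lambda>\<xi>::real. (B / r\<^sup>2)\<^sup>2 * inverse (1 + \<xi>\<^sup>2))"
      by (intro integrable_mult_right integrable_inverse_square)
    have "T (cmollifier c r) = (LINT \<xi>|lborel. h \<xi> * \<psi> \<xi>)"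
      unfolding \<psi>_def by (rule fourier_density_test[OF h mollifier_schwartz[OF r(1)]])
    then have "cmod (T (cmollifier c r)) \<le> sobolev_norm (- s) T * sqrt (LINT \<xi>|lborel. (B / r\<^sup>2)\<^sup>2 * inverse (1 + \<xi>\<^sup>2))"
      using sobolev_pairing_bound(2)[OF h norm _ ci, of \<psi>] le by simp
    also have "(LINT \<xi>|lborel. (B / r\<^sup>2)\<^sup>2 * inverse (1 + \<xi>\<^sup>2)) = (B / r\<^sup>2)\<^sup>2 * cauchy_mass" by (simp add: cauchy_mass_def)
    also have "sqrt \<dots> = B / r\<^sup>2 * sqrt cauchy_mass" using B by (simp add: real_sqrt_mult)
    finally show "cmod (T (cmollifier c r)) \<le> B * sqrt cauchy_mass / r\<^sup>2 * sobolev_norm (- s) T"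
      by (simp add: mult_ac)
  qed
qed

lemma cmod_exp_i_diff_le:
  fixes x y \<xi> :: real
  defines "D \<equiv> cmod (wave x \<xi> - wave y \<xi>)"
  shows "D \<le> 2" "D \<le> \<bar>x - y\<bar> * \<bar>\<xi>\<bar>"
proof -
  show "D \<le> 2" unfolding D_def
    by (rule order_trans[OF norm_triangle_ineq4]) simp
  have "wave x \<xi> - wave y \<xi>
    = wave y \<xi> * (iexp ((x - y) * \<xi>) - 1)"
    by (simp add: right_diff_distrib algebra_simps flip: exp_add)
  then have "D = cmod (iexp ((x - y) * \<xi>) - 1)" unfolding D_def by (simp only: norm_mult) simp
  also have "\<dots> \<le> \<bar>(x - y) * \<xi>\<bar>" using iexp_approx1[of "(x - y) * \<xi>" 0] by simp
  finally show "D \<le> \<bar>x - y\<bar> * \<bar>\<xi>\<bar>" by (simp add: abs_mult)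
qed

text \<open>For \<open>\<rho> \<ge> 1\<close> the dual weight is integrable by itself and the
  transform of a mollifier has modulus at most 1, so both bounds are independent of \<open>r\<close>
  and survive its limit at 0. This is the embedding into Hoelder functions of order one half,
  phrased for an arbitrary extension.\<close>

lemma sobolev_mollifier_positive:
  assumes T: "T \<in> sobolev \<rho>" and \<rho>: "\<rho> \<ge> 1" and r: "r > 0"
  shows "cmod (T (cmollifier x r)) \<le> 2 * sqrt cauchy_mass * sobolev_norm \<rho> T"
    and "cmod (T (cmollifier x r) - T (cmollifier y r))
      \<le> 2 * sqrt cauchy_mass * sobolev_norm \<rho> T * sqrt \<bar>x - y\<bar>"
proof -
  obtain h where h: "fourier_density \<rho> T h" and norm: "sobolev_norm \<rho> T = l2_norm_on UNIV (sobolev_weighted \<rho> h)"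
    using sobolev_density[OF T] by blast
  define \<psi> where "\<psi> c = inv_fourier (cmollifier c r)" for c
  define \<psi>0 where "\<psi>0 = inv_fourier (cmollifier 0 1)"
  have \<psi>S: "\<psi> c \<in> schwartz" for c unfolding \<psi>_def by (intro schwartz_inv_fourier mollifier_schwartz r)
  have [measurable]: "\<psi> c \<in> borel_measurable borel" for c using schwartz_measurable[OF \<psi>S] .
  have \<psi>: "\<psi> c \<xi> = wave c \<xi> * \<psi>0 (r * \<xi>)" for c \<xi>
    unfolding \<psi>_def \<psi>0_def by (rule inv_fourier_mollifier[OF r])
  have "cmod (\<psi>0 \<xi>) \<le> (LINT t|lborel. cmod (of_real (mollifier 0 1 t)))" for \<xi>
    unfolding \<psi>0_def by (rule inv_fourier_norm_le)
  then have \<psi>01: "cmod (\<psi>0 \<xi>) \<le> 1" for \<xi>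
    using mollifier_integral[of 1 0] mollifier_nonneg[of 1 0] by simp
  have Tm: "T (cmollifier c r) = (LINT \<xi>|lborel. h \<xi> * \<psi> c \<xi>)" for c
    unfolding \<psi>_def by (rule fourier_density_test[OF h mollifier_schwartz[OF r]])
  have weight: "(1 + \<xi>\<^sup>2) powr (- \<rho>) \<le> inverse (1 + \<xi>\<^sup>2)" for \<xi>
    using powr_mono[of "- \<rho>" "- 1" "1 + \<xi>\<^sup>2"] \<rho> by (simp add: powr_minus add_nonneg_nonneg)
  have le0: "inverse (1 + \<xi>\<^sup>2) * (cmod (\<psi> c \<xi>))\<^sup>2 \<le> inverse (1 + \<xi>\<^sup>2)" for c \<xi>
    using \<psi>01[of "r * \<xi>"] by (simp add: \<psi> norm_mult mult_left_le power_le_one add_nonneg_nonneg)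
  have le1: "(1 + \<xi>\<^sup>2) powr (- \<rho>) * (cmod (\<psi> c \<xi>))\<^sup>2 \<le> inverse (1 + \<xi>\<^sup>2)" for c \<xi>
    by (rule order_trans[OF mult_right_mono[OF weight zero_le_power2] le0])
  note P1 = sobolev_pairing_bound[OF h norm _ integrable_inverse_square le1]
  show "cmod (T (cmollifier x r)) \<le> 2 * sqrt cauchy_mass * sobolev_norm \<rho> T"
  proof -
    have "cmod (T (cmollifier x r)) \<le> sobolev_norm \<rho> T * sqrt cauchy_mass"
      unfolding Tm cauchy_mass_def by (rule P1) simp
    also have "\<dots> \<le> 2 * (sobolev_norm \<rho> T * sqrt cauchy_mass)"
      using sobolev_norm_nonneg[of \<rho> T] cauchy_mass_nonneg by simp
    finally show ?thesis by (simp add: mult_ac)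
  qed
  show "cmod (T (cmollifier x r) - T (cmollifier y r))
      \<le> 2 * sqrt cauchy_mass * sobolev_norm \<rho> T * sqrt \<bar>x - y\<bar>"
  proof (cases "x = y")
    case False
    define d where "d = \<bar>x - y\<bar>"
    have d: "d > 0" using False by (simp add: d_def)
    \<comment> \<open>The frequency at which the two bounds 2 and
      \<open>d * \<bar>\<xi>\<bar>\<close> for the difference of waves coincide. The majorant
      \<open>8 / (\<xi>\<^sup>2 + R\<^sup>2)\<close> combines them, and its integral is proportional
      to \<open>1 / R\<close>, hence to \<open>d\<close>; the square root yields the Hoelder
      exponent.\<close>
    define R where "R = 2 / d"
    have R: "R > 0" using d by (simp add: R_def)
    have keq: "8 / (\<xi>\<^sup>2 + R\<^sup>2) = 8 / R\<^sup>2 * inverse (1 + (0 + (1 / R) * \<xi>)\<^sup>2)" for \<xi>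
      using R by (simp add: field_simps)
    have ki: "integrable lborel (\<lambda>\<xi>. 8 / (\<xi>\<^sup>2 + R\<^sup>2))"
      unfolding keq
      by (intro integrable_mult_right lborel_integrable_real_affine[OF integrable_inverse_square]) (use R in simp)
    have "cauchy_mass = (1 / R) * (LINT \<xi>|lborel. inverse (1 + (0 + (1 / R) * \<xi>)\<^sup>2))"
      unfolding cauchy_mass_def
      using lborel_integral_real_affine[of "1 / R" "\<lambda>\<xi>. inverse (1 + \<xi>\<^sup>2)" 0] R by simp
    then have "R * cauchy_mass = (R * (1 / R)) * (LINT \<xi>|lborel. inverse (1 + (0 + (1 / R) * \<xi>)\<^sup>2))"
      by (simp only: mult.assoc)
    then have "R * cauchy_mass = (LINT \<xi>|lborel. inverse (1 + (0 + (1 / R) * \<xi>)\<^sup>2))"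
      using R by simp
    then have "(LINT \<xi>|lborel. 8 / (\<xi>\<^sup>2 + R\<^sup>2)) = 8 / R\<^sup>2 * (R * cauchy_mass)"
      unfolding keq integral_mult_right_zero by (simp only:)
    then have kI: "(LINT \<xi>|lborel. 8 / (\<xi>\<^sup>2 + R\<^sup>2)) = 4 * d * cauchy_mass"
      using R d by (simp add: R_def power2_eq_square)
    have le2: "(1 + \<xi>\<^sup>2) powr (- \<rho>) * (cmod (\<psi> x \<xi> - \<psi> y \<xi>))\<^sup>2 \<le> 8 / (\<xi>\<^sup>2 + R\<^sup>2)" for \<xi>
    proof -
      define D where "D = cmod (wave x \<xi> - wave y \<xi>)"
      have D: "0 \<le> D" "D \<le> 2" "D \<le> d * \<bar>\<xi>\<bar>" unfolding D_def d_def by (simp, (rule cmod_exp_i_diff_le)+)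
      have "\<psi> x \<xi> - \<psi> y \<xi> = (wave x \<xi> - wave y \<xi>) * \<psi>0 (r * \<xi>)"
        by (simp add: \<psi> left_diff_distrib)
      then have "cmod (\<psi> x \<xi> - \<psi> y \<xi>) \<le> D"
        using \<psi>01[of "r * \<xi>"] D(1) by (simp only: norm_mult D_def[symmetric] mult_left_le)
      then have 1: "(cmod (\<psi> x \<xi> - \<psi> y \<xi>))\<^sup>2 \<le> D\<^sup>2" by (intro power_mono) auto
      have "D\<^sup>2 \<le> 2\<^sup>2" using D by (intro power_mono) auto
      then have D4: "D\<^sup>2 \<le> 4" by simp
      have "D\<^sup>2 \<le> (d * \<bar>\<xi>\<bar>)\<^sup>2" using D by (intro power_mono) auto
      then have "D\<^sup>2 * R\<^sup>2 \<le> (d * \<bar>\<xi>\<bar>)\<^sup>2 * R\<^sup>2" by (intro mult_right_mono) auto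
      also have "(d * \<bar>\<xi>\<bar>)\<^sup>2 * R\<^sup>2 = 4 * \<xi>\<^sup>2" using d by (simp add: R_def power_mult_distrib power_divide)
      finally have D5: "D\<^sup>2 * R\<^sup>2 \<le> 4 * \<xi>\<^sup>2" .
      have "D\<^sup>2 * \<xi>\<^sup>2 \<le> 4 * \<xi>\<^sup>2" using D4 by (intro mult_right_mono) auto
      then have "D\<^sup>2 * (\<xi>\<^sup>2 + R\<^sup>2) \<le> 8 * (1 + \<xi>\<^sup>2)" using D5 by (simp add: distrib_left)
      moreover have pos: "\<xi>\<^sup>2 + R\<^sup>2 > 0" "1 + \<xi>\<^sup>2 > 0" using R by (auto simp: add_nonneg_pos add_pos_nonneg)
      ultimately have "inverse (1 + \<xi>\<^sup>2) * D\<^sup>2 \<le> 8 / (\<xi>\<^sup>2 + R\<^sup>2)" by (simp add: field_simps)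
      moreover have "(1 + \<xi>\<^sup>2) powr (- \<rho>) * (cmod (\<psi> x \<xi> - \<psi> y \<xi>))\<^sup>2 \<le> inverse (1 + \<xi>\<^sup>2) * D\<^sup>2"
        using 1 pos by (intro mult_mono weight) auto
      ultimately show ?thesis by linarith
    qed
    have "T (cmollifier x r) - T (cmollifier y r)
      = (LINT \<xi>|lborel. h \<xi> * (\<psi> x \<xi> - \<psi> y \<xi>))"
      unfolding Tm by (simp add: right_diff_distrib P1(1))
    then have "cmod (T (cmollifier x r) - T (cmollifier y r))
      \<le> sobolev_norm \<rho> T * sqrt (4 * d * cauchy_mass)"
      using sobolev_pairing_bound(2)[OF h norm _ ki le2] by (simp add: kI)
    also have "\<dots> = 2 * sqrt cauchy_mass * sobolev_norm \<rho> T * sqrt d"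
      by (simp add: real_sqrt_mult)
    finally show ?thesis by (simp add: d_def)
  qed simp
qed

section \<open>Quotient norms and exterior data\<close>

text \<open>Here \<open>q\<close> stands for the quotient of the norms of \<open>g\<close> and
  \<open>\<delta>\<close> for the exterior norm divided by the \<open>L\<^sup>2\<close> norm. The
  parameters are chosen so that the terms without \<open>\<delta>\<close> use up at most half of the
  left side 1; the term with \<open>\<delta>\<close> must supply the other half.\<close>

lemma parameter_choice:
  fixes K l r0 :: real
  assumes K: "K \<ge> 1" and l: "l > 0" and r0: "r0 > 0"
  obtains C where "C > 0" "\<And>q \<delta>. q \<ge> 0 \<Longrightarrow> \<delta> \<ge> 0 \<Longrightarrow>
    (\<And>n h r. n > 0 \<Longrightarrow> h > 0 \<Longrightarrow> real (n ^ 4) * h \<le> l \<Longrightarrow> 0 < r \<Longrightarrow> r \<le> r0 \<Longrightarrow>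
      1 \<le> K * q / real n + K * q * 3 ^ (n ^ 4) * ((1 + K / h) ^ (n ^ 4) * (K * (\<delta> / r\<^sup>2 + r)) + K * real (n ^ 8) * h)) \<Longrightarrow>
    q \<le> C * exp (C * q ^ 8) * \<delta>"
proof -
  \<comment> \<open>The factor \<open>1 / (6 * K\<^sup>2)\<close> limits the term with
    \<open>h\<close> to \<open>1 / 6\<close>, and likewise in \<open>\<kappa>'\<close> the term with
    \<open>r\<close>. The remaining sixth is secured by \<open>n \<ge> 6 * K * q\<close>.\<close>
  define \<kappa> where "\<kappa> = min l (1 / (6 * K\<^sup>2))"
  define \<kappa>' where "\<kappa>' = min r0 (1 / (6 * K\<^sup>2))"
  define D where "D = 1 + K / \<kappa>"
  \<comment> \<open>\<open>288 = 6 * 48\<close>: the 6 absorbs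
    \<open>q * 3 ^ N \<le> 2 ^ N * 3 ^ N\<close>, and \<open>48 * D\<close> absorbs
    \<open>1 + K / h\<close> for the step \<open>h\<close> chosen below.\<close>
  define W where "W = 288 * D"
  have \<kappa>: "\<kappa> > 0" "\<kappa> \<le> l" "\<kappa> \<le> 1 / (6 * K\<^sup>2)" using l K by (auto simp: \<kappa>_def)
  have \<kappa>': "\<kappa>' > 0" "\<kappa>' \<le> r0" "\<kappa>' \<le> 1 / (6 * K\<^sup>2)" using r0 K by (auto simp: \<kappa>'_def)
  have D: "D \<ge> 1" using K \<kappa> by (simp add: D_def)
  have W: "W \<ge> 1" using D by (simp add: W_def)
  define c1 where "c1 = 2 * K\<^sup>2 / \<kappa>'\<^sup>2 * exp (4 * ln W * 4 ^ 8)"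
  define c2 where "c2 = 4 * ln W * (12 * K) ^ 8"
  have c: "c1 > 0" "c2 \<ge> 0" using K \<kappa>' W by (auto simp: c1_def c2_def)
  have K6: "K\<^sup>2 * x \<le> 1 / 6" if "x \<le> 1 / (6 * K\<^sup>2)" for x
  proof -
    have "K\<^sup>2 * x \<le> K\<^sup>2 * (1 / (6 * K\<^sup>2))" using that by (intro mult_left_mono) auto
    then show ?thesis using K by simp
  qed
  show ?thesis
  proof (rule that)
    show "c1 + c2 > 0" using c by simp
    fix q \<delta> :: real
    assume q: "q \<ge> 0" and \<delta>: "\<delta> \<ge> 0"
      and ineq: "\<And>n h r. n > 0 \<Longrightarrow> h > 0 \<Longrightarrow> real (n ^ 4) * h \<le> l \<Longrightarrow> 0 < r \<Longrightarrow> r \<le> r0 \<Longrightarrow>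
      1 \<le> K * q / real n + K * q * 3 ^ (n ^ 4) * ((1 + K / h) ^ (n ^ 4) * (K * (\<delta> / r\<^sup>2 + r)) + K * real (n ^ 8) * h)"
    define n where "n = nat \<lceil>6 * K * q\<rceil> + 1"
    define N where "N = n ^ 4"
    have n: "n > 0" by (simp add: n_def)
    have nq: "6 * K * q \<le> real n" "real n \<le> 6 * K * q + 2"
      using K q by (auto simp: n_def) linarith+
    have "1 * q \<le> 6 * K * q" using K q by (intro mult_right_mono) auto
    then have qn: "q \<le> real n" using nq by simp
    have nN: "n \<le> N" unfolding N_def using n by (intro self_le_power) auto
    have N: "N \<ge> 1" using n nN by simp
    have N2: "N < 2 ^ N" by (rule less_exp)
    have Nr: "real N \<le> 2 ^ N"
    proof -
      have "real N \<le> real (2 ^ N)" using N2 by (intro of_nat_mono) simp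
      then show ?thesis by simp
    qed
    have NN: "N \<le> N * N" using N by simp
    define E where "E = W ^ (N * N)"
    have E: "E \<ge> 1" unfolding E_def by (rule one_le_power[OF W])
    \<comment> \<open>The step must compensate \<open>q * N\<^sup>2 * 3 ^ N\<close>, which is at
      most \<open>24 ^ N\<close>; the base 48 does so with room to spare. The radius chosen next
      compensates \<open>E\<close>, which bounds the amplification of the exterior data.\<close>
    define h where "h = \<kappa> / 48 ^ N"
    define r where "r = \<kappa>' / E"
    have h: "h > 0" using \<kappa> by (simp add: h_def)
    have r: "r > 0" using \<kappa>' E by (simp add: r_def)
    have "r \<le> \<kappa>'" using \<kappa>' E by (simp add: r_def divide_le_eq)
    then have rr0: "r \<le> r0" using \<kappa>' by simp
    have "real N \<le> 48 ^ N"
      by (rule order_trans[OF Nr]) (simp add: power_mono)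
    then have "real N * h \<le> 48 ^ N * h" using h by (intro mult_right_mono) auto
    also have "\<dots> = \<kappa>" by (simp add: h_def)
    finally have Nh: "real (n ^ 4) * h \<le> l" using \<kappa> by (simp add: N_def)
    have "1 \<le> K * q / real n + K * q * 3 ^ N * ((1 + K / h) ^ N * (K * (\<delta> / r\<^sup>2 + r)) + K * real (n ^ 8) * h)"
      using ineq[OF n h Nh r rr0] by (simp only: N_def)
    also have "\<dots> = K * q / real n + K\<^sup>2 * (q * 3 ^ N * (1 + K / h) ^ N) * (\<delta> / r\<^sup>2 + r)
        + K\<^sup>2 * (q * 3 ^ N * real (n ^ 8) * h)"
    proof -
      have "K * q * 3 ^ N * ((1 + K / h) ^ N * (K * V) + K * real (n ^ 8) * h)
        = K\<^sup>2 * (q * 3 ^ N * (1 + K / h) ^ N) * V + K\<^sup>2 * (q * 3 ^ N * real (n ^ 8) * h)" for V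
        by (simp only: distrib_left power2_eq_square mult_ac)
      then show ?thesis by (simp only: add.assoc)
    qed
    also have "\<dots> \<le> 1 / 6 + K\<^sup>2 * E * (\<delta> / r\<^sup>2 + r) + 1 / 6"
    proof (intro add_mono)
      show "K * q / real n \<le> 1 / 6" using nq n by (simp add: divide_le_eq)
      have "q * 3 ^ N * real (n ^ 8) * h \<le> \<kappa>"
      proof -
        have "real (n ^ 8) = real N * real N" by (simp add: N_def flip: power_add)
        then have "q * 3 ^ N * real (n ^ 8) * h = (q * real N * real N) * 3 ^ N * h" by (simp add: mult_ac)
        also have "\<dots> \<le> (2 ^ N * 2 ^ N * 2 ^ N) * 3 ^ N * h"
        proof (intro mult_right_mono mult_mono Nr)
          have "real n \<le> real N" using nN by simp
          then show "q \<le> 2 ^ N" using qn Nr by linarith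
        qed (use h q in auto)
        also have "\<dots> = 24 ^ N * h" by (simp flip: power_mult_distrib)
        also have "\<dots> \<le> 48 ^ N * h" using h by (intro mult_right_mono power_mono) auto
        also have "\<dots> = \<kappa>" by (simp add: h_def)
        finally show ?thesis .
      qed
      then show "K\<^sup>2 * (q * 3 ^ N * real (n ^ 8) * h) \<le> 1 / 6" using \<kappa> by (intro K6) linarith
      have "q * 3 ^ N * (1 + K / h) ^ N \<le> E"
      proof -
        have "1 + K / h = 1 + (K / \<kappa>) * 48 ^ N" by (simp add: h_def)
        also have "\<dots> \<le> 48 ^ N + (K / \<kappa>) * 48 ^ N" by simp
        also have "\<dots> = D * 48 ^ N" by (simp add: D_def algebra_simps)
        finally have "(1 + K / h) ^ N \<le> (D * 48 ^ N) ^ N" using K h by (intro power_mono) auto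
        also have "\<dots> = D ^ N * 48 ^ (N * N)" by (simp add: power_mult_distrib power_mult)
        also have "\<dots> \<le> D ^ (N * N) * 48 ^ (N * N)" using D NN by (intro mult_right_mono power_increasing) auto
        also have "\<dots> = (48 * D) ^ (N * N)" by (simp add: power_mult_distrib)
        finally have 1: "(1 + K / h) ^ N \<le> (48 * D) ^ (N * N)" .
        have "real n \<le> real N" using nN by simp
        then have "q \<le> 2 ^ N" using qn Nr by linarith
        then have "q * 3 ^ N \<le> 2 ^ N * 3 ^ N" by (intro mult_right_mono) auto
        also have "\<dots> = 6 ^ N" by (simp flip: power_mult_distrib)
        also have "\<dots> \<le> 6 ^ (N * N)" using NN by (intro power_increasing) auto
        finally have "q * 3 ^ N * (1 + K / h) ^ N \<le> 6 ^ (N * N) * (48 * D) ^ (N * N)"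
          using 1 K h by (intro mult_mono) auto
        also have "\<dots> = (6 * (48 * D)) ^ (N * N)" by (simp only: power_mult_distrib)
        also have "6 * (48 * D) = W" by (simp add: W_def)
        also have "W ^ (N * N) = E" by (simp only: E_def)
        finally show ?thesis .
      qed
      then show "K\<^sup>2 * (q * 3 ^ N * (1 + K / h) ^ N) * (\<delta> / r\<^sup>2 + r) \<le> K\<^sup>2 * E * (\<delta> / r\<^sup>2 + r)"
        using \<delta> r by (intro mult_right_mono mult_left_mono) auto
    qed
    also have "K\<^sup>2 * E * (\<delta> / r\<^sup>2 + r) = K\<^sup>2 * E * (\<delta> / r\<^sup>2) + K\<^sup>2 * \<kappa>'"
      using E by (simp add: r_def algebra_simps)
    also have "1 / 6 + (K\<^sup>2 * E * (\<delta> / r\<^sup>2) + K\<^sup>2 * \<kappa>') + 1 / 6 \<le> 1 / 6 + (K\<^sup>2 * E * (\<delta> / r\<^sup>2) + 1 / 6) + 1 / 6"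
      using K6[OF \<kappa>'(3)] by simp
    finally have "1 \<le> 2 * (K\<^sup>2 * E * (\<delta> / r\<^sup>2))" by simp
    also have "\<dots> = 2 * K\<^sup>2 / \<kappa>'\<^sup>2 * E ^ 3 * \<delta>"
      using \<kappa>' E by (simp add: r_def power_divide power2_eq_square power3_eq_cube)
    finally have one: "1 \<le> 2 * K\<^sup>2 / \<kappa>'\<^sup>2 * E ^ 3 * \<delta>" .
    \<comment> \<open>Multiplying the lower bound for \<open>\<delta>\<close> by \<open>q\<close>
      turns it into an upper bound for \<open>q\<close>. The radius contributed
      \<open>E\<^sup>2\<close>, the amplification \<open>E\<close>, and \<open>q\<close> the last
      factor of \<open>E ^ 4\<close>.\<close>
    have "q \<le> E"
    proof -
      have "real n \<le> real N" using nN by simp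
      then have "q \<le> 2 ^ N" using qn Nr by linarith
      also have "\<dots> \<le> W ^ N" using D by (intro power_mono) (auto simp: W_def)
      also have "\<dots> \<le> E" unfolding E_def using W NN by (intro power_increasing) auto
      finally show ?thesis .
    qed
    then have "q * 1 \<le> E * (2 * K\<^sup>2 / \<kappa>'\<^sup>2 * E ^ 3 * \<delta>)" using one q E by (intro mult_mono) auto
    then have "q \<le> 2 * K\<^sup>2 / \<kappa>'\<^sup>2 * E ^ 4 * \<delta>" by (simp add: eval_nat_numeral mult_ac)
    also have "E ^ 4 \<le> exp (4 * ln W * 4 ^ 8) * exp (c2 * q ^ 8)"
    proof -
      \<comment> \<open>From \<open>real n \<le> 6 * K * q + 2\<close>: the larger summand at most
        doubles. The separation detaches a constant from the power of \<open>q\<close> in the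
        exponent.\<close>
      have "real n \<le> max (12 * K * q) 4" using nq by auto
      then have "real n ^ 8 \<le> (max (12 * K * q) 4) ^ 8" by (intro power_mono) auto
      also have "\<dots> \<le> (12 * K * q) ^ 8 + 4 ^ 8" using K q by (auto simp: max_def)
      finally have n8: "real n ^ 8 \<le> (12 * K * q) ^ 8 + 4 ^ 8" .
      have "E = exp (real (N * N) * ln W)" unfolding E_def using W by (simp only: exp_of_nat_mult) simp
      then have "E ^ 4 = exp (4 * ln W * real (N * N))" by (simp add: exp_of_nat_mult[symmetric] mult_ac)
      also have "real (N * N) = real n ^ 8" by (simp add: N_def flip: power_add)
      also have "exp (4 * ln W * real n ^ 8) \<le> exp (4 * ln W * ((12 * K * q) ^ 8 + 4 ^ 8))"
        using W n8 by (intro exp_le_cancel_iff[THEN iffD2] mult_left_mono) auto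
      also have "\<dots> = exp (4 * ln W * 4 ^ 8) * exp (c2 * q ^ 8)"
        by (simp add: c2_def power_mult_distrib distrib_left mult_ac flip: exp_add)
      finally show ?thesis .
    qed
    then have "2 * K\<^sup>2 / \<kappa>'\<^sup>2 * E ^ 4 * \<delta> \<le> 2 * K\<^sup>2 / \<kappa>'\<^sup>2 * (exp (4 * ln W * 4 ^ 8) * exp (c2 * q ^ 8)) * \<delta>"
      using \<delta> by (intro mult_right_mono mult_left_mono) auto
    also have "\<dots> = c1 * exp (c2 * q ^ 8) * \<delta>" by (simp add: c1_def)
    also have "\<dots> \<le> (c1 + c2) * exp ((c1 + c2) * q ^ 8) * \<delta>"
      using c q \<delta> by (intro mult_right_mono mult_mono exp_le_cancel_iff[THEN iffD2]) auto
    finally show "q \<le> (c1 + c2) * exp ((c1 + c2) * q ^ 8) * \<delta>" .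
  qed
qed

section \<open>Estimates by quotient norms\<close>

lemma le_scaled_INF:
  fixes f :: "'a \<Rightarrow> real"
  assumes "A \<noteq> {}" "c \<ge> 0" "\<And>x. x \<in> A \<Longrightarrow> v \<le> c * f x"
  shows "v \<le> c * (INF x\<in>A. f x)"
proof (cases "c = 0")
  case True
  then show ?thesis using assms by auto
next
  case False
  have "v / c \<le> (INF x\<in>A. f x)"
    by (rule cINF_greatest[OF assms(1)]) (use assms False in \<open>auto simp: divide_le_eq mult.commute\<close>)
  then show ?thesis using False assms(2) by (simp add: divide_le_eq mult.commute)
qed

text \<open>The only route by which a quotient norm appears on the right of an estimate: the bound
  is proved for every extension \<open>T\<close>, about which nothing is known but its values on
  test functions of \<open>U\<close>.\<close>

lemma le_fun_sobolev_norm_on: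
  assumes "distribution_of f \<in> sobolev \<rho>" "c \<ge> 0"
    and "\<And>T. T \<in> sobolev \<rho> \<Longrightarrow> (\<And>\<phi>. \<phi> \<in> test_functions U \<Longrightarrow> T \<phi> = (LINT x|lborel. f x * \<phi> x)) \<Longrightarrow>
      v \<le> c * sobolev_norm \<rho> T"
  shows "v \<le> c * fun_sobolev_norm_on \<rho> U f"
  unfolding fun_sobolev_norm_on_def sobolev_norm_on_def
proof (rule le_scaled_INF[OF _ assms(2)])
  show "{T \<in> sobolev \<rho>. restrict_distribution U T = restrict_distribution U (distribution_of f)} \<noteq> {}"
    using assms(1) by blast
  fix T assume T: "T \<in> {T \<in> sobolev \<rho>. restrict_distribution U T = restrict_distribution U (distribution_of f)}"
  show "v \<le> c * sobolev_norm \<rho> T"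
  proof (rule assms(3))
    fix \<phi> assume \<phi>: "\<phi> \<in> test_functions U"
    have "restrict_distribution U T \<phi> = restrict_distribution U (distribution_of f) \<phi>" using T by simp
    then show "T \<phi> = (LINT x|lborel. f x * \<phi> x)"
      using \<phi> test_functions_schwartz by (auto simp: restrict_distribution_def distribution_of_def)
  qed (use T in simp)
qed

lemma fun_sobolev_norm_on_nonneg:
  assumes "distribution_of f \<in> sobolev \<rho>" shows "fun_sobolev_norm_on \<rho> U f \<ge> 0"
  using le_fun_sobolev_norm_on[OF assms, of 1 U 0] by (simp add: sobolev_norm_nonneg)

lemma fun_sobolev_norm_on_zero:
  assumes "0 \<le> \<rho>" "distribution_of (\<lambda>_. 0) \<in> sobolev \<rho>"
  shows "fun_sobolev_norm_on \<rho> U (\<lambda>_. 0) \<le> 0"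
proof -
  have "fun_sobolev_norm_on \<rho> U (\<lambda>_. 0) \<le> sobolev_norm \<rho> (distribution_of (\<lambda>_. 0))"
    unfolding fun_sobolev_norm_on_def sobolev_norm_on_def
    by (rule cINF_lower) (use assms in \<open>auto intro!: bdd_belowI2[of _ 0] sobolev_norm_nonneg\<close>)
  then show ?thesis using sobolev_norm_zero[OF assms] by simp
qed

lemma small_radius:
  fixes g :: "real \<Rightarrow> complex"
  assumes "open U" "x \<in> U" "isCont g x" "e > 0"
  obtains r where "r > 0" "\<And>r'. r' \<le> r \<Longrightarrow> cball x r' \<subseteq> U" "\<And>y. \<bar>y - x\<bar> \<le> r \<Longrightarrow> cmod (g y - g x) \<le> e"
proof -
  obtain r1 where r1: "r1 > 0" "cball x r1 \<subseteq> U" using assms open_contains_cball by blast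
  obtain r2 where r2: "r2 > 0" "\<And>y. dist y x < r2 \<Longrightarrow> dist (g y) (g x) < e"
    using assms(3,4) unfolding continuous_at_eps_delta by blast
  show thesis
  proof (rule that[of "min r1 (r2 / 2)"])
    show "min r1 (r2 / 2) > 0" using r1 r2 by simp
    show "cball x r' \<subseteq> U" if "r' \<le> min r1 (r2 / 2)" for r'
      using that r1(2) by (auto intro: order_trans)
    show "cmod (g y - g x) \<le> e" if "\<bar>y - x\<bar> \<le> min r1 (r2 / 2)" for y
    proof -
      have "dist y x < r2" using that r2(1) by (simp add: dist_real_def)
      then show ?thesis using r2(2)[of y] by (simp add: dist_norm)
    qed
  qed
qed

lemma test_function_isCont: "g \<in> test_functions U \<Longrightarrow> isCont g x"
  using smooth_continuous[of g UNIV 0] by (simp add: test_functions_def continuous_on_eq_continuous_at)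

text \<open>For a fixed extension, mollified values tend to the values of the continuous
  \<open>g\<close>, while their bounds do not depend on the radius. The infimum over extensions is
  taken after the radius has disappeared.\<close>

lemma test_function_sobolev_bounds:
  assumes U: "open U" and g: "g \<in> test_functions U" and \<rho>: "1 \<le> \<rho>" "\<rho> \<le> 2" and x: "x \<in> U" and y: "y \<in> U"
  shows "cmod (g x) \<le> 2 * sqrt cauchy_mass * fun_sobolev_norm_on \<rho> U g"
    and "cmod (g x - g y) \<le> 2 * sqrt cauchy_mass * sqrt \<bar>x - y\<bar> * fun_sobolev_norm_on \<rho> U g"
proof -
  have gS: "g \<in> schwartz" using g test_functions_schwartz by blast
  have [measurable]: "g \<in> borel_measurable borel" using schwartz_measurable[OF gS] .
  note mem = schwartz_in_sobolev[OF gS \<rho>(2)]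
  have T: "cmod (g x) \<le> 2 * sqrt cauchy_mass * sobolev_norm \<rho> T \<and>
      cmod (g x - g y) \<le> 2 * sqrt cauchy_mass * sqrt \<bar>x - y\<bar> * sobolev_norm \<rho> T"
    if T: "T \<in> sobolev \<rho>" and Tg: "\<And>\<phi>. \<phi> \<in> test_functions U \<Longrightarrow> T \<phi> = (LINT x|lborel. g x * \<phi> x)" for T
  proof -
    have "cmod (g x) \<le> 2 * sqrt cauchy_mass * sobolev_norm \<rho> T + e \<and>
      cmod (g x - g y) \<le> 2 * sqrt cauchy_mass * sqrt \<bar>x - y\<bar> * sobolev_norm \<rho> T + e" if e: "e > 0" for e
    proof -
      obtain rx where rx: "rx > 0" "\<And>r'. r' \<le> rx \<Longrightarrow> cball x r' \<subseteq> U" "\<And>y. \<bar>y - x\<bar> \<le> rx \<Longrightarrow> cmod (g y - g x) \<le> e / 2"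
        using small_radius[OF U x test_function_isCont[OF g], of "e / 2"] e by auto
      obtain ry where ry: "ry > 0" "\<And>r'. r' \<le> ry \<Longrightarrow> cball y r' \<subseteq> U" "\<And>z. \<bar>z - y\<bar> \<le> ry \<Longrightarrow> cmod (g z - g y) \<le> e / 2"
        using small_radius[OF U y test_function_isCont[OF g], of "e / 2"] e by auto
      \<comment> \<open>One radius for both points, because the Hoelder estimate compares mollifiers
        of equal radius.\<close>
      define r where "r = min rx ry"
      have r: "r > 0" using rx ry by (simp add: r_def)
      let ?Tx = "T (cmollifier x r)" and ?Ty = "T (cmollifier y r)"
      have Tx: "?Tx = (LINT t|lborel. g t * of_real (mollifier x r t))"
        by (intro Tg mollifier_test r rx(2)) (simp add: r_def)
      have Ty: "?Ty = (LINT t|lborel. g t * of_real (mollifier y r t))"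
        by (intro Tg mollifier_test r ry(2)) (simp add: r_def)
      have dx: "cmod (?Tx - g x) \<le> e / 2" unfolding Tx
        by (rule mollifier_approx[OF r]) (use rx(3) in \<open>auto simp: r_def\<close>)
      have dy: "cmod (?Ty - g y) \<le> e / 2" unfolding Ty
        by (rule mollifier_approx[OF r]) (use ry(3) in \<open>auto simp: r_def\<close>)
      have "cmod (g x) \<le> cmod ?Tx + cmod (?Tx - g x)"
        by (metis norm_minus_commute norm_triangle_sub)
      moreover have "cmod ?Tx \<le> 2 * sqrt cauchy_mass * sobolev_norm \<rho> T"
        by (rule sobolev_mollifier_positive(1)[OF T \<rho>(1) r])
      moreover have "cmod (g x - g y) \<le> cmod (?Tx - ?Ty) + (cmod (?Tx - g x) + cmod (?Ty - g y))"
      proof -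
        have "g x - g y = (?Tx - ?Ty) - ((?Tx - g x) - (?Ty - g y))" by simp
        then show ?thesis by (metis norm_triangle_ineq4 norm_triangle_le_diff order_trans add_left_mono)
      qed
      moreover have "cmod (?Tx - ?Ty) \<le> 2 * sqrt cauchy_mass * sobolev_norm \<rho> T * sqrt \<bar>x - y\<bar>"
        by (rule sobolev_mollifier_positive(2)[OF T \<rho>(1) r])
      ultimately show ?thesis using dx dy e by (simp add: mult_ac)
    qed
    then show ?thesis by (meson field_le_epsilon)
  qed
  show "cmod (g x) \<le> 2 * sqrt cauchy_mass * fun_sobolev_norm_on \<rho> U g"
    by (rule le_fun_sobolev_norm_on[OF mem]) (use T cauchy_mass_nonneg in auto)
  show "cmod (g x - g y) \<le> 2 * sqrt cauchy_mass * sqrt \<bar>x - y\<bar> * fun_sobolev_norm_on \<rho> U g"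
    by (rule le_fun_sobolev_norm_on[OF mem]) (use T cauchy_mass_nonneg in auto)
qed

lemma test_function_zero: "g \<in> test_functions U \<Longrightarrow> x \<notin> U \<Longrightarrow> g x = 0"
  using closure_subset[of "{x. g x \<noteq> 0}"] by (auto simp: test_functions_def)

text \<open>The constant survives the extension to the line: between a point of the interval and one
  outside there is a zero of \<open>g\<close> still inside the interval. Otherwise the closed
  support would reach an endpoint.\<close>

lemma test_function_holder:
  fixes g :: "real \<Rightarrow> complex"
  assumes g: "g \<in> test_functions {a<..<b}" and L: "L \<ge> 0"
    and H: "\<And>x y. x \<in> {a<..<b} \<Longrightarrow> y \<in> {a<..<b} \<Longrightarrow> cmod (g x - g y) \<le> L * sqrt \<bar>x - y\<bar>"
  shows "cmod (g x - g y) \<le> L * sqrt \<bar>x - y\<bar>"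
proof -
  let ?K = "closure {x. g x \<noteq> 0}"
  have K: "?K \<subseteq> {a<..<b}" using g by (simp add: test_functions_def)
  have one: "cmod (g x) \<le> L * sqrt \<bar>x - y\<bar>" if x: "x \<in> {a<..<b}" and y: "y \<notin> {a<..<b}" for x y
  proof -
    have "\<exists>z\<in>{a<..<b}. g z = 0 \<and> \<bar>x - z\<bar> \<le> \<bar>x - y\<bar>"
    proof (rule ccontr)
      assume contra: "\<not> (\<exists>z\<in>{a<..<b}. g z = 0 \<and> \<bar>x - z\<bar> \<le> \<bar>x - y\<bar>)"
      show False
      proof (cases "y \<le> a")
        case True
        have "{a<..x} \<subseteq> {x. g x \<noteq> 0}" using contra x True by force
        then have "closure {a<..x} \<subseteq> ?K" by (rule closure_mono)
        then have "a \<in> ?K" using x by auto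
        then show False using K by auto
      next
        case False
        then have yb: "b \<le> y" using y by auto
        have "{x..<b} \<subseteq> {x. g x \<noteq> 0}" using contra x yb by force
        then have "closure {x..<b} \<subseteq> ?K" by (rule closure_mono)
        then have "b \<in> ?K" using x by auto
        then show False using K by auto
      qed
    qed
    then obtain z where z: "z \<in> {a<..<b}" "g z = 0" "\<bar>x - z\<bar> \<le> \<bar>x - y\<bar>" by blast
    have "cmod (g x) \<le> L * sqrt \<bar>x - z\<bar>" using H[OF x z(1)] z(2) by simp
    also have "\<dots> \<le> L * sqrt \<bar>x - y\<bar>" using z(3) L by (intro mult_left_mono) auto
    finally show ?thesis .
  qed
  show ?thesis
  proof (cases "x \<in> {a<..<b}"; cases "y \<in> {a<..<b}")
    assume "x \<in> {a<..<b}" "y \<notin> {a<..<b}"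
    then show ?thesis using one[of x y] test_function_zero[OF g, of y] by simp
  next
    assume "x \<notin> {a<..<b}" "y \<in> {a<..<b}"
    then show ?thesis using one[of y x] test_function_zero[OF g, of x] by (simp add: abs_minus_commute)
  next
    assume "x \<notin> {a<..<b}" "y \<notin> {a<..<b}"
    then show ?thesis using test_function_zero[OF g, of x] test_function_zero[OF g, of y] L by simp
  qed (use H in auto)
qed

section \<open>Values of the potential from data on \<open>J\<close>\<close>

lemma powr_kernel_lipschitz:
  fixes p D u v :: real
  assumes p: "p > 0" and D: "D > 0" and u: "D \<le> u" and v: "D \<le> v"
  shows "\<bar>u powr (- 1 - p) - v powr (- 1 - p)\<bar> \<le> (1 + p) * D powr (- 2 - p) * \<bar>u - v\<bar>"
proof -
  have "norm (u powr (- 1 - p) - v powr (- 1 - p)) \<le> (1 + p) * D powr (- 2 - p) * norm (u - v)"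
  proof (rule field_differentiable_bound[of "{D..}"])
    fix y :: real assume y: "y \<in> {D..}"
    have "((\<lambda>x. x powr (- 1 - p)) has_real_derivative (- 1 - p) * y powr (- 1 - p - 1)) (at y)"
      using y D by (intro has_real_derivative_powr) auto
    moreover have "- 1 - p - 1 = - 2 - p" by simp
    ultimately show "((\<lambda>x. x powr (- 1 - p)) has_real_derivative (- 1 - p) * y powr (- 2 - p)) (at y within {D..})"
      by (simp only: has_field_derivative_at_within)
    have "y powr (- 2 - p) \<le> D powr (- 2 - p)" using y D p by (intro powr_mono2') auto
    from mult_left_mono[OF this, of "1 + p"]
    show "norm ((- 1 - p) * y powr (- 2 - p)) \<le> (1 + p) * D powr (- 2 - p)"
      using p by (simp add: abs_mult add.commute)
  qed (use u v in auto)
  then show ?thesis by simp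
qed

text \<open>The mollified value of the fractional Laplacian at \<open>x\<close> is controlled by its
  norm on \<open>J\<close>. Up to a constant factor the function is the potential, whose Lipschitz
  constant off the support of \<open>g\<close> is a multiple of \<open>l1_norm g\<close>; this
  bounds the effect of mollifying by \<open>r * l1_norm g\<close>.\<close>

lemma exterior_data_bound:
  assumes s: "0 < s" "s < 1" and e: "e > 0" and J: "cball c e \<subseteq> J"
  obtains C where "C \<ge> 0" "\<And>a b g r x. c + e \<le> a \<Longrightarrow> g \<in> test_functions {a<..<b} \<Longrightarrow> 0 < r \<Longrightarrow> r \<le> 1 \<Longrightarrow> r \<le> e / 4 \<Longrightarrow>
    \<bar>x - c\<bar> \<le> e / 2 \<Longrightarrow>
    cmod (potential (2 * s) g x) \<le>
      C * (fun_sobolev_norm_on (- s) J (abs_D_powr (2 * s) g) / r\<^sup>2 + r * l1_norm g)"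
proof -
  define p where "p = 2 * s"
  have p: "0 < p" "p < 2" using s by (auto simp: p_def)
  define A where "A = riesz_const p"
  have A: "A > 0" unfolding A_def by (rule riesz_const_pos[OF p])
  obtain B where B: "B \<ge> 0" "\<And>T c r. T \<in> sobolev (- s) \<Longrightarrow> 0 < r \<Longrightarrow> r \<le> 1 \<Longrightarrow>
    cmod (T (cmollifier c r)) \<le> B / r\<^sup>2 * sobolev_norm (- s) T"
    using sobolev_mollifier_negative s by (metis less_eq_real_def)
  \<comment> \<open>Points within \<open>r \<le> e / 4\<close> of an \<open>x\<close> with
    \<open>\<bar>x - c\<bar> \<le> e / 2\<close> are at most \<open>c + 3 * e / 4\<close>. Since
    \<open>c + e \<le> a\<close>, they keep the distance \<open>e / 4\<close> from the support of
    \<open>g\<close>.\<close>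
  define L where "L = (1 + p) * (e / 4) powr (- 2 - p)"
  have L: "L \<ge> 0" using p by (simp add: L_def)
  show ?thesis
  proof (rule that)
    show "2 * A * B + L \<ge> 0" using A B L by simp
    fix a b g r x
    assume a: "c + e \<le> a" and g: "g \<in> test_functions {a<..<b}" and r: "0 < r" "r \<le> 1" "r \<le> e / 4"
      and x: "\<bar>x - c\<bar> \<le> e / 2"
    have gS: "g \<in> schwartz" using g test_functions_schwartz by blast
    have gi: "integrable lborel g" by (rule schwartz_integrable[OF gS])
    have [measurable]: "g \<in> borel_measurable borel" using gi by auto
    have g0: "g y = 0" if "y \<le> a" for y using test_function_zero[OF g, of y] that by simp
    define G where "G = l1_norm g"
    have G: "G \<ge> 0" by (simp add: G_def)
    define f where "f = abs_D_powr p g"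
    define \<delta> where "\<delta> = fun_sobolev_norm_on (- s) J f"
    have mem: "distribution_of f \<in> sobolev (- s)"
      unfolding f_def by (rule abs_D_powr_in_sobolev[OF gS p]) (use s in simp)
    have \<delta>: "\<delta> \<ge> 0" unfolding \<delta>_def by (rule fun_sobolev_norm_on_nonneg[OF mem])
    have [measurable]: "f \<in> borel_measurable borel"
      unfolding f_def abs_D_powr_def using schwartz_measurable[OF schwartz_fourier[OF gS]] by measurable
    define F where "F x = (potential p g x)" for x
    have fF: "f z = - (1 / (2 * of_real A)) * F z" if "z \<le> a" for z
      unfolding f_def A_def F_def using abs_D_powr_left[OF p gS, of z] g0 that by (simp add: mult.commute)
    \<comment> \<open>The outer interval ends \<open>a + 1\<close> and
      \<open>c + 3 * e / 4 - 1\<close> are arbitrary values in the order that the context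
      demands.\<close>
    have Fi: "integrable lborel (\<lambda>y. g y * of_real ((y - z) powr (- 1 - p)))" if "z \<le> c + 3 * e / 4" for z
      by (rule weighted_integrable(1)[of a "a + 1" "c + 3 * e / 4 - 1" "c + 3 * e / 4" p g, OF _ _ _ p gi _ that])
        (use a e g0 in auto)
    have FL: "cmod (F z - F x) \<le> L * r * G" if z: "\<bar>z - x\<bar> \<le> r" for z
    proof -
      have zx: "z \<le> c + 3 * e / 4" "x \<le> c + 3 * e / 4" using z x r e by linarith+
      have eq: "F z - F x = (LINT y|lborel. g y * of_real ((y - z) powr (- 1 - p)) - g y * of_real ((y - x) powr (- 1 - p)))"
        unfolding F_def using Fi[OF zx(1)] Fi[OF zx(2)] by simp
      have "cmod (F z - F x) \<le> (LINT y|lborel. (L * r) * cmod (g y))"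
        unfolding eq
      proof (rule Bochner_Integration.integral_norm_bound_integral)
        show "integrable lborel (\<lambda>y. g y * of_real ((y - z) powr (- 1 - p)) - g y * of_real ((y - x) powr (- 1 - p)))"
          using Fi[OF zx(1)] Fi[OF zx(2)] by (intro Bochner_Integration.integrable_diff)
        show "integrable lborel (\<lambda>y. (L * r) * cmod (g y))" using gi by simp
        fix y
        show "cmod (g y * of_real ((y - z) powr (- 1 - p)) - g y * of_real ((y - x) powr (- 1 - p))) \<le> (L * r) * cmod (g y)"
        proof (cases "y \<le> a")
          case False
          have "\<bar>(y - z) powr (- 1 - p) - (y - x) powr (- 1 - p)\<bar> \<le> L * \<bar>(y - z) - (y - x)\<bar>"
            unfolding L_def by (rule powr_kernel_lipschitz) (use False zx a e p in auto)
          also have "\<dots> \<le> L * r" using z L by (intro mult_left_mono) auto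
          finally have "cmod (g y) * \<bar>(y - z) powr (- 1 - p) - (y - x) powr (- 1 - p)\<bar> \<le> cmod (g y) * (L * r)"
            by (intro mult_left_mono) auto
          moreover have "g y * of_real ((y - z) powr (- 1 - p)) - g y * of_real ((y - x) powr (- 1 - p))
            = g y * of_real ((y - z) powr (- 1 - p) - (y - x) powr (- 1 - p))"
            by (simp add: right_diff_distrib)
          ultimately show ?thesis by (simp only: norm_mult norm_of_real mult.commute)
        qed (simp add: g0)
      qed
      also have "\<dots> = L * r * G" unfolding G_def by (rule integral_mult_right_zero)
      finally show ?thesis .
    qed
    have xa: "x \<le> a" using x a e by linarith
    have "cmod (f z - f x) \<le> L * r * G / (2 * A)" if z: "\<bar>z - x\<bar> \<le> r" for z
    proof -
      have "z \<le> a" using z x a r e by linarith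
      then have "f z - f x = - (1 / (2 * of_real A)) * (F z - F x)"
        by (simp add: fF xa right_diff_distrib)
      then have "cmod (f z - f x) = 1 / (2 * A) * cmod (F z - F x)"
        using A by (simp only: norm_mult) (simp add: norm_divide norm_mult)
      also have "\<dots> \<le> 1 / (2 * A) * (L * r * G)" using A by (intro mult_left_mono FL z) auto
      finally show ?thesis by simp
    qed
    then have m: "cmod ((LINT y|lborel. f y * of_real (mollifier x r y)) - f x) \<le> L * r * G / (2 * A)"
      by (intro mollifier_approx r) auto
    have "cball x r \<subseteq> J"
    proof (rule order_trans[OF _ J])
      show "cball x r \<subseteq> cball c e"
      proof
        fix z assume "z \<in> cball x r"
        then have "\<bar>x - z\<bar> \<le> r" by (simp add: dist_real_def)
        then have "\<bar>c - z\<bar> \<le> e" using x r e by linarith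
        then show "z \<in> cball c e" by (simp add: dist_real_def)
      qed
    qed
    then have test: "(cmollifier x r) \<in> test_functions J" by (rule mollifier_test[OF r(1)])
    have "cmod (LINT y|lborel. f y * of_real (mollifier x r y)) \<le> B / r\<^sup>2 * \<delta>"
      unfolding \<delta>_def
    proof (rule le_fun_sobolev_norm_on[OF mem])
      fix T assume T: "T \<in> sobolev (- s)" and Tf: "\<And>\<phi>. \<phi> \<in> test_functions J \<Longrightarrow> T \<phi> = (LINT x|lborel. f x * \<phi> x)"
      show "cmod (LINT y|lborel. f y * of_real (mollifier x r y)) \<le> B / r\<^sup>2 * sobolev_norm (- s) T"
        unfolding Tf[OF test, symmetric] by (rule B(2)[OF T r(1,2)])
    qed (use B in simp)
    with m have fx: "cmod (f x) \<le> B / r\<^sup>2 * \<delta> + L * r * G / (2 * A)"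
      using norm_triangle_ineq2[of "f x" "LINT y|lborel. f y * of_real (mollifier x r y)"]
      by (simp add: norm_minus_commute)
    have "cmod (f x) = 1 / (2 * A) * cmod (F x)"
      unfolding fF[OF xa] using A by (simp only: norm_mult) (simp add: norm_divide norm_mult)
    then have "cmod (F x) = 2 * A * cmod (f x)" using A by simp
    also have "\<dots> \<le> 2 * A * (B / r\<^sup>2 * \<delta> + L * r * G / (2 * A))" using A by (intro mult_left_mono fx) auto
    also have "\<dots> = 2 * A * B * (\<delta> / r\<^sup>2) + L * (r * G)" using A by (simp add: distrib_left)
    also have "\<dots> \<le> (2 * A * B + L) * (\<delta> / r\<^sup>2) + (2 * A * B + L) * (r * G)"
      using A B L G \<delta> r by (intro add_mono mult_right_mono) auto
    finally show "cmod (potential (2 * s) g x) \<le>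
      (2 * A * B + L) * (fun_sobolev_norm_on (- s) J (abs_D_powr (2 * s) g) / r\<^sup>2 + r * l1_norm g)"
      unfolding F_def G_def \<delta>_def f_def p_def by (simp only: distrib_left)
  qed
qed

lemma open_interval_cases:
  fixes I :: "real set"
  assumes "open I" "connected I" "bounded I" "I \<noteq> {}"
  obtains a b where "a < b" "I = {a<..<b}"
proof
  have bd: "bdd_below I" "bdd_above I" using assms(3) bounded_imp_bdd_below bounded_imp_bdd_above by auto
  show eq: "I = {Inf I<..<Sup I}"
  proof (intro equalityI subsetI)
    fix x assume x: "x \<in> I"
    obtain e where e: "e > 0" "cball x e \<subseteq> I" using assms(1) x open_contains_cball by blast
    then have "x - e \<in> I" "x + e \<in> I" by (auto simp: subset_iff dist_real_def)
    then have "Inf I \<le> x - e" "x + e \<le> Sup I" using bd cInf_lower cSup_upper by auto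
    then show "x \<in> {Inf I<..<Sup I}" using e by auto
  next
    fix x assume x: "x \<in> {Inf I<..<Sup I}"
    obtain u where "u \<in> I" "u < x" using x assms(4) bd cInf_less_iff by (metis greaterThanLessThan_iff)
    moreover obtain v where "v \<in> I" "x < v" using x assms(4) bd less_cSup_iff by (metis greaterThanLessThan_iff)
    ultimately show "x \<in> I" using connectedD_interval[OF assms(2)] less_imp_le by blast
  qed
  show "Inf I < Sup I" using assms(4) eq by (metis greaterThanLessThan_empty_iff not_less)
qed

section \<open>Quantitative unique continuation\<close>

theorem theorem1p6:
  fixes s :: real and I J1 J2 J :: "real set"
  assumes s: "1 / 2 \<le> s" "s < 1"
    and I: "open I" "connected I" "bounded I" "I \<noteq> {}"
    and J1: "open J1" "connected J1" "bounded J1" "J1 \<noteq> {}"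
    and J2: "open J2" "connected J2" "bounded J2" "J2 \<noteq> {}"
    and disjoint: "closure I \<inter> closure J1 = {}" "closure I \<inter> closure J2 = {}"
    and left: "\<forall>x\<in>J1. \<forall>y\<in>I. x < y"
    and right: "\<forall>x\<in>J2. \<forall>y\<in>I. y < x"
    and J: "J = J1 \<union> J2"
  shows "\<exists>C > 0. \<exists>\<mu> > 0. \<forall>g \<in> test_functions I.
    fun_sobolev_norm_on (2 * s) I g
      \<le> C * exp (C * (fun_sobolev_norm_on (2 * s) I g / l2_norm_on I g) powr \<mu>)
          * fun_sobolev_norm_on (- s) J (abs_D_powr (2 * s) g)"
proof -
  obtain a b where ab: "a < b" and Iab: "I = {a<..<b}" using open_interval_cases[OF I] .
  obtain c where "c \<in> J1" using J1(4) by blast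
  then obtain e where e: "e > 0" "cball c e \<subseteq> J1" using J1(1) open_contains_cball by blast
  have cJ: "cball c e \<subseteq> J" using e(2) J by blast
  \<comment> \<open>The closed ball lies in \<open>J1\<close>, to the left of every point of
    \<open>I\<close>; otherwise \<open>I\<close> would contain a point below
    \<open>c + e\<close>.\<close>
  have ca: "c + e \<le> a"
  proof (rule ccontr)
    assume "\<not> c + e \<le> a"
    then obtain y where y: "a < y" "y < min (c + e) b" using ab dense[of a "min (c + e) b"] by auto
    have "c + e \<in> J1" using e by (auto simp: subset_iff dist_real_def)
    moreover have "y \<in> I" using y by (simp add: Iab)
    ultimately have "c + e < y" using left by blast
    then show False using y by simp
  qed
  have s0: "0 < s" and p: "0 < 2 * s" "2 * s < 2" using s by auto
  \<comment> \<open>Half of the ball is kept as a margin: the potential is sampled within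
    \<open>e / 2\<close> of \<open>c\<close>, and mollifiers of radius at most \<open>e / 4\<close>
    around such points stay inside \<open>J\<close>.\<close>
  define x0 where "x0 = c - e / 2"
  define x1 where "x1 = c + e / 2"
  have x: "x0 < x1" "x1 < a" using e ca by (auto simp: x0_def x1_def)
  show ?thesis
  proof (rule l2_norm_le_exterior_potential[OF ab x p])
    fix C0 assume C0: "C0 > 0" and core: "\<And>g Q S n h. integrable lborel g \<Longrightarrow> (\<And>y. y \<notin> {a..b} \<Longrightarrow> g y = 0) \<Longrightarrow>
      (\<And>y. cmod (g y) \<le> Q) \<Longrightarrow> (\<And>y z. cmod (g y - g z) \<le> Q * sqrt \<bar>y - z\<bar>) \<Longrightarrow>
      (\<And>x. x0 \<le> x \<Longrightarrow> x \<le> x1 \<Longrightarrow> cmod (potential (2 * s) g x) \<le> S) \<Longrightarrow>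
      n > 0 \<Longrightarrow> h > 0 \<Longrightarrow> real (n ^ 4) * h \<le> x1 - x0 \<Longrightarrow>
      (LINT y|lborel. (cmod (g y))\<^sup>2) \<le> C0 * Q / real n * l1_norm g +
        C0 * Q * 3 ^ (n ^ 4) * ((1 + C0 / h) ^ (n ^ 4) * S + C0 * real (n ^ 8) * h * l1_norm g)"
    show ?thesis
    proof (rule exterior_data_bound[OF s0 s(2) e(1) cJ])
      fix C1 assume C1: "C1 \<ge> 0" and data: "\<And>a b g r x. c + e \<le> a \<Longrightarrow> g \<in> test_functions {a<..<b} \<Longrightarrow> 0 < r \<Longrightarrow> r \<le> 1 \<Longrightarrow>
        r \<le> e / 4 \<Longrightarrow> \<bar>x - c\<bar> \<le> e / 2 \<Longrightarrow>
        cmod (potential (2 * s) g x) \<le>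
          C1 * (fun_sobolev_norm_on (- s) J (abs_D_powr (2 * s) g) / r\<^sup>2 + r * l1_norm g)"
      define C2 where "C2 = 2 * sqrt cauchy_mass"
      have C2: "C2 \<ge> 0" using cauchy_mass_nonneg by (simp add: C2_def)
      define B where "B = sqrt (b - a)"
      have B: "B > 0" using ab by (simp add: B_def)
      \<comment> \<open>A sum dominating every product of constants that arises once
        \<open>Q\<close>, \<open>S\<close> and \<open>G\<close> are expressed through
        \<open>m\<close> and \<open>q\<close>.\<close>
      define K where "K = 1 + C0 + C0 * C2 + C0 * C2 * B + C1 + C1 * B + C0 * B"
      have K: "1 \<le> K" "C0 \<le> K" "C0 * C2 \<le> K" "C0 * C2 * B \<le> K" "C1 \<le> K" "C1 * B \<le> K" "C0 * B \<le> K"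
        unfolding K_def using C0 C1 C2 B by (auto intro!: add_nonneg_nonneg mult_nonneg_nonneg simp: add_increasing add_increasing2)
      have l: "x1 - x0 > 0" and r0: "min 1 (e / 4) > 0" using x e by auto
      show ?thesis
      proof (rule parameter_choice[OF K(1) l r0])
        fix C assume C: "C > 0" and opt: "\<And>q \<delta>. q \<ge> 0 \<Longrightarrow> \<delta> \<ge> 0 \<Longrightarrow>
          (\<And>n h r. n > 0 \<Longrightarrow> h > 0 \<Longrightarrow> real (n ^ 4) * h \<le> x1 - x0 \<Longrightarrow> 0 < r \<Longrightarrow> r \<le> min 1 (e / 4) \<Longrightarrow>
            1 \<le> K * q / real n + K * q * 3 ^ (n ^ 4) * ((1 + K / h) ^ (n ^ 4) * (K * (\<delta> / r\<^sup>2 + r)) + K * real (n ^ 8) * h)) \<Longrightarrow>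
          q \<le> C * exp (C * q ^ 8) * \<delta>"
        show ?thesis
        proof (rule exI[of _ C], rule conjI[OF C], rule exI[of _ 8], rule conjI, simp, rule ballI)
          fix g assume g: "g \<in> test_functions I"
          have gS: "g \<in> schwartz" using g test_functions_schwartz by blast
          have gi: "integrable lborel g" by (rule schwartz_integrable[OF gS])
          have [measurable]: "g \<in> borel_measurable borel" using gi by auto
          have g0: "y \<notin> {a<..<b} \<Longrightarrow> g y = 0" for y using test_function_zero[OF g, of y] by (simp add: Iab)
          define M where "M = fun_sobolev_norm_on (2 * s) I g"
          define \<delta> where "\<delta> = fun_sobolev_norm_on (- s) J (abs_D_powr (2 * s) g)"
          define m where "m = l2_norm_on I g"
          define G where "G = l1_norm g"
          have G: "G \<ge> 0" by (simp add: G_def)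
          have M: "M \<ge> 0" unfolding M_def
            by (rule fun_sobolev_norm_on_nonneg, rule schwartz_in_sobolev[OF gS]) (use s in simp)
          have \<delta>: "\<delta> \<ge> 0" unfolding \<delta>_def
            by (rule fun_sobolev_norm_on_nonneg, rule abs_D_powr_in_sobolev[OF gS]) (use s in auto)
          obtain Cg where Cg: "\<And>y. cmod (g y) \<le> Cg" using schwartz_bound[OF gS, of 0 0] by auto
          have g2: "integrable lborel (\<lambda>y. (cmod (g y))\<^sup>2)"
            by (rule integrable_square[OF gi Cg])
          have m2: "m\<^sup>2 = (LINT y|lborel. (cmod (g y))\<^sup>2)"
          proof -
            have "(LINT y:I|lborel. (cmod (g y))\<^sup>2) = (LINT y|lborel. (cmod (g y))\<^sup>2)"
              unfolding set_lebesgue_integral_def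
            proof (intro Bochner_Integration.integral_cong refl)
              show "indicator I y *\<^sub>R (cmod (g y))\<^sup>2 = (cmod (g y))\<^sup>2" for y
                using g0[of y] by (cases "y \<in> I") (auto simp: Iab)
            qed
            then show ?thesis by (simp add: m_def l2_norm_on_def)
          qed
          have m: "m \<ge> 0" by (simp add: m_def l2_norm_nonneg)
          have "M \<le> C * exp (C * (M / m) powr 8) * \<delta>"
          \<comment> \<open>In this case \<open>M / m\<close> is 0 by the convention for division by
            zero. The inequality holds because a continuous \<open>g\<close> of norm 0 vanishes
            identically, which gives \<open>M \<le> 0\<close>.\<close>
          proof (cases "m = 0")
            case True
            then have "AE y in lborel. (cmod (g y))\<^sup>2 = 0"
              using m2 integral_nonneg_eq_0_iff_AE[OF g2] by simp
            then have "AE y in lborel. g y = 0" by simp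
            then have "g y = 0" for y
            proof -
              have "continuous_on UNIV g" using smooth_continuous[OF schwartz_smooth[OF gS], of UNIV 0] by simp
              then have "open {y. g y \<noteq> 0}"
                by (intro open_Collect_neq continuous_on_const)
              moreover have "{y. g y \<noteq> 0} \<in> null_sets lborel"
                using \<open>AE y in lborel. g y = 0\<close> by (subst AE_iff_null_sets) (auto simp: open_Collect_neq \<open>continuous_on UNIV g\<close>)
              ultimately have "{y. g y \<noteq> 0} = {}"
                using open_not_negligible negligible_iff_null_sets null_sets_completionI by blast
              then show ?thesis by blast
            qed
            then have gz: "g = (\<lambda>_. 0)" by (rule ext)
            have "M \<le> 0" unfolding M_def gz
              by (rule fun_sobolev_norm_on_zero) (use s schwartz_in_sobolev[OF gS, of "2 * s"] in \<open>auto simp: gz\<close>)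
            also have "0 \<le> C * exp (C * (M / m) powr 8) * \<delta>" using C \<delta> by simp
            finally show ?thesis .
          next
            case False
            with m have mp: "m > 0" by simp
            define q where "q = M / m"
            have q: "q \<ge> 0" using M m by (simp add: q_def)
            define Q where "Q = C2 * M"
            have Q: "Q \<ge> 0" using C2 M by (simp add: Q_def)
            have gQ: "cmod (g y) \<le> Q" for y
            proof (cases "y \<in> I")
              case True
              then show ?thesis using test_function_sobolev_bounds(1)[OF I(1) g, of "2 * s" y y] s
                by (simp add: Q_def C2_def M_def)
            next
              case False
              then show ?thesis using g0[of y] Q by (simp add: Iab)
            qed
            have gH: "cmod (g y - g z) \<le> Q * sqrt \<bar>y - z\<bar>" for y z
            proof (rule test_function_holder)
              show "g \<in> test_functions {a<..<b}" using g by (simp add: Iab)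
              fix y z assume "y \<in> {a<..<b}" "z \<in> {a<..<b}"
              then show "cmod (g y - g z) \<le> Q * sqrt \<bar>y - z\<bar>"
                using test_function_sobolev_bounds(2)[OF I(1) g, of "2 * s" y z] s
                by (simp add: Iab Q_def C2_def M_def mult_ac)
            qed (rule Q)
            \<comment> \<open>Cauchy-Schwarz on the bounded interval; it expresses the remaining
              norm of \<open>g\<close> through \<open>m\<close>.\<close>
            have Gm: "G \<le> B * m"
            proof -
              have i: "integrable lborel (\<lambda>y. (indicator {a<..<b} y :: real)\<^sup>2)"
                using emeasure_bounded_finite[of "{a<..<b}"] by (simp add: power2_eq_square flip: indicator_inter_arith)
              have "G = (LINT y|lborel. indicator {a<..<b} y * cmod (g y))"
                unfolding G_def
              proof (intro Bochner_Integration.integral_cong refl)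
                show "cmod (g y) = indicator {a<..<b} y * cmod (g y)" for y
                  using g0[of y] by (cases "y \<in> {a<..<b}") auto
              qed
              also have "\<dots> \<le> sqrt (LINT y|lborel. (indicator {a<..<b} y)\<^sup>2) * sqrt (LINT y|lborel. (cmod (g y))\<^sup>2)"
                by (rule Cauchy_Schwarz_integral(2)[OF _ _ i g2]) auto
              also have "(LINT y|lborel. (indicator {a<..<b} y :: real)\<^sup>2) = b - a"
                using ab by (simp add: power2_eq_square flip: indicator_inter_arith)
              finally show ?thesis using m by (simp add: B_def flip: m2)
            qed
            \<comment> \<open>The problem is homogeneous in \<open>g\<close>, so the exterior norm
              enters divided by \<open>m\<close>. Multiplication by \<open>m\<close> restores it at
              the end.\<close>
            have "q \<le> C * exp (C * q ^ 8) * (\<delta> / m)"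
            proof (rule opt[OF q])
              show "\<delta> / m \<ge> 0" using \<delta> m by simp
              fix n :: nat and h r :: real
              assume n: "n > 0" and h: "h > 0" and nh: "real (n ^ 4) * h \<le> x1 - x0"
                and r: "0 < r" "r \<le> min 1 (e / 4)"
              define N where "N = n ^ 4"
              define S where "S = C1 * (\<delta> / r\<^sup>2 + r * G)"
              have "m\<^sup>2 \<le> C0 * Q / real n * G + C0 * Q * 3 ^ N * ((1 + C0 / h) ^ N * S + C0 * real (n ^ 8) * h * G)"
                unfolding m2 G_def N_def
              proof (rule core[OF gi _ _ _ _ n h nh])
                show "g y = 0" if "y \<notin> {a..b}" for y using g0 that by auto
                fix x assume "x0 \<le> x" "x \<le> x1"
                then have "\<bar>x - c\<bar> \<le> e / 2" unfolding x0_def x1_def by linarith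
                then show "cmod (potential (2 * s) g x) \<le> S"
                  using data[OF ca, of g b r x] g r by (simp add: Iab S_def \<delta>_def G_def)
              qed (use gQ gH in auto)
              also have "\<dots> \<le> m\<^sup>2 * (K * q / real n + K * q * 3 ^ N * ((1 + K / h) ^ N * (K * (\<delta> / m / r\<^sup>2 + r)) + K * real (n ^ 8) * h))"
              proof -
                \<comment> \<open>Each of \<open>Q\<close>, \<open>S\<close> and \<open>G\<close>
                  carries one factor \<open>m\<close>. Every term is a product of \<open>Q\<close>
                  with \<open>S\<close> or \<open>G\<close>, so \<open>m\<^sup>2\<close> splits off
                  and can be cancelled against the left side.\<close>
                have Qq: "Q = C2 * q * m" using mp by (simp add: Q_def q_def)
                have "C0 * Q / real n * G \<le> C0 * Q / real n * (B * m)"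
                  using C0 Q by (intro mult_left_mono Gm) auto
                also have "\<dots> = (C0 * C2 * B) * (q / real n * m\<^sup>2)" by (simp add: Qq power2_eq_square)
                also have "\<dots> \<le> K * (q / real n * m\<^sup>2)" using q by (intro mult_right_mono K) auto
                finally have 1: "C0 * Q / real n * G \<le> m\<^sup>2 * (K * q / real n)" by (simp add: mult_ac)
                have S: "S \<le> K * (\<delta> / m / r\<^sup>2 + r) * m"
                proof -
                  have "S \<le> C1 * (\<delta> / r\<^sup>2 + r * (B * m))" unfolding S_def
                    using C1 r by (intro mult_left_mono add_left_mono Gm) auto
                  also have "\<dots> = C1 * (\<delta> / r\<^sup>2) + (C1 * B) * (r * m)" by (simp add: distrib_left mult_ac)
                  also have "\<dots> \<le> K * (\<delta> / r\<^sup>2) + K * (r * m)"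
                    using \<delta> r m by (intro add_mono mult_right_mono K) auto
                  also have "\<dots> = K * (\<delta> / m / r\<^sup>2 + r) * m" using mp by (simp add: distrib_left distrib_right)
                  finally show ?thesis .
                qed
                have S0: "S \<ge> 0" unfolding S_def using C1 \<delta> r G by simp
                have "(1 + C0 / h) ^ N \<le> (1 + K / h) ^ N"
                  using C0 K h by (intro power_mono add_left_mono divide_right_mono) auto
                then have "(1 + C0 / h) ^ N * S \<le> (1 + K / h) ^ N * (K * (\<delta> / m / r\<^sup>2 + r) * m)"
                  using K h S0 by (intro mult_mono S) auto
                moreover have "C0 * real (n ^ 8) * h * G \<le> K * real (n ^ 8) * h * m"
                proof -
                  have "C0 * real (n ^ 8) * h * G \<le> C0 * real (n ^ 8) * h * (B * m)"
                    using C0 h by (intro mult_left_mono Gm) auto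
                  also have "\<dots> = (C0 * B) * (real (n ^ 8) * h * m)" by (simp add: mult_ac)
                  also have "\<dots> \<le> K * (real (n ^ 8) * h * m)" using h m by (intro mult_right_mono K) auto
                  finally show ?thesis by (simp add: mult_ac)
                qed
                ultimately have X: "(1 + C0 / h) ^ N * S + C0 * real (n ^ 8) * h * G \<le>
                  ((1 + K / h) ^ N * (K * (\<delta> / m / r\<^sup>2 + r)) + K * real (n ^ 8) * h) * m" (is "_ \<le> ?X * m")
                  by (simp only: distrib_right mult.assoc)
                have X0: "?X \<ge> 0" using K h \<delta> m r by (intro add_nonneg_nonneg mult_nonneg_nonneg zero_le_power) auto
                have "C0 * Q * 3 ^ N * ((1 + C0 / h) ^ N * S + C0 * real (n ^ 8) * h * G) \<le> C0 * Q * 3 ^ N * (?X * m)"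
                  using C0 Q by (intro mult_left_mono X) auto
                also have "\<dots> = (C0 * C2) * (q * 3 ^ N * ?X * m\<^sup>2)" by (simp only: Qq power2_eq_square mult_ac)
                also have "\<dots> \<le> K * (q * 3 ^ N * ?X * m\<^sup>2)" using q X0 by (intro mult_right_mono K mult_nonneg_nonneg) auto
                also have "\<dots> = m\<^sup>2 * (K * q * 3 ^ N * ?X)" by (simp only: mult_ac)
                finally show ?thesis using 1 by (simp only: distrib_left)
              qed
              finally have "m\<^sup>2 * 1 \<le> m\<^sup>2 * (K * q / real n + K * q * 3 ^ N * ((1 + K / h) ^ N * (K * (\<delta> / m / r\<^sup>2 + r)) + K * real (n ^ 8) * h))"
                by (simp only: mult_1_right)
              then show "1 \<le> K * q / real n + K * q * 3 ^ (n ^ 4) * ((1 + K / h) ^ (n ^ 4) * (K * (\<delta> / m / r\<^sup>2 + r)) + K * real (n ^ 8) * h)"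
                using mp by (subst (asm) mult_le_cancel_left_pos) (simp_all add: N_def)
            qed
            then have "m * q \<le> m * (C * exp (C * q ^ 8) * (\<delta> / m))" using m by (rule mult_left_mono)
            moreover have "q ^ 8 = q powr 8" using q by simp
            ultimately show ?thesis using mp by (simp add: q_def)
          qed
          then show "fun_sobolev_norm_on (2 * s) I g
            \<le> C * exp (C * (fun_sobolev_norm_on (2 * s) I g / l2_norm_on I g) powr 8)
                * fun_sobolev_norm_on (- s) J (abs_D_powr (2 * s) g)"
            by (simp only: M_def m_def \<delta>_def)
        qed
      qed
    qed
  qed
qed

end
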